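(* Let $A$, $B$, $C$ and $D$ be $C^{*}$-algebras and let $\varphi:A \to B$ and $\psi:C \to D$ be completely positive contractive (c.p.c.) order zero maps. Let $\otimes_{\mu}$ denote either the minimal or the maximal $C^{*}$-tensor product. Then the induced c.p.c. map \[ \varphi \otimes_{\mu} \psi: A \otimes_{\mu} C \to B \otimes_{\mu} D \] has order zero. In particular, for any $k \in \mathbb{N}$ the amplification \[ \varphi^{(k)}: M_{k}(A) \to M_{k}(B) \] has order zero.
   Context: Two elements $a,b$ of a $C^{*}$-algebra are orthogonal, written $a \perp b$, if $ab=ba=a^{*}b=ab^{*}=0$. A completely positive map $\varphi:A\to B$ between $C^{*}$-algebras has order zero if, for all $a,b\in A_{+}$, $a\perp b$ implies $\varphi(a)\perp\varphi(b)$. The map $\varphi \otimes_{\mu}\psi$ is the continuous linear map determined by $a\otimes c\mapsto \varphi(a)\otimes\psi(c)$. The amplification $\varphi^{(k)}$ applies $\varphi$ entrywise to $k\times k$ matrices over $A$. *)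

theory Defs
  imports "HOL-Analysis.Analysis"
begin

section \<open>Complex vector spaces, C*-algebras and Hilbert spaces\<close>

class complex_vector = ab_group_add +
  fixes scaleC :: "complex \<Rightarrow> 'a \<Rightarrow> 'a"
  assumes scaleC_add_right: "scaleC c (x + y) = scaleC c x + scaleC c y"
    and scaleC_add_left: "scaleC (c + d) x = scaleC c x + scaleC d x"
    and scaleC_scaleC: "scaleC c (scaleC d x) = scaleC (c * d) x"
    and scaleC_one: "scaleC 1 x = x"

global_interpretation complex_vector: vector_space "scaleC :: complex \<Rightarrow> 'a \<Rightarrow> 'a::complex_vector"
  by unfold_locales
    (simp_all add: scaleC_add_right scaleC_add_left scaleC_scaleC scaleC_one)

instantiation complex :: complex_vector
begin

definition scaleC_complex :: "complex \<Rightarrow> complex \<Rightarrow> complex"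
  where "scaleC_complex c x = c * x"

instance
  by standard (simp_all add: scaleC_complex_def algebra_simps)

end

abbreviation clinear :: "('a::complex_vector \<Rightarrow> 'b::complex_vector) \<Rightarrow> bool"
  where "clinear \<equiv> Vector_Spaces.linear scaleC scaleC"

abbreviation cspan :: "'a::complex_vector set \<Rightarrow> 'a set"
  where "cspan \<equiv> module.span scaleC"

definition cbilinear ::
    "('a::complex_vector \<Rightarrow> 'b::complex_vector \<Rightarrow> 'c::complex_vector) \<Rightarrow> bool"
  where "cbilinear \<beta> \<longleftrightarrow> (\<forall>a. clinear (\<lambda>b. \<beta> a b)) \<and> (\<forall>b. clinear (\<lambda>a. \<beta> a b))"

text \<open>Algebras are not assumed to be unital.\<close>

class complex_star_algebra = complex_vector + ring +
  fixes star :: "'a \<Rightarrow> 'a"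
  assumes scaleC_mult_left: "scaleC c x * y = scaleC c (x * y)"
    and scaleC_mult_right: "x * scaleC c y = scaleC c (x * y)"
    and star_add: "star (x + y) = star x + star y"
    and star_scaleC: "star (scaleC c x) = scaleC (cnj c) (star x)"
    and star_mult: "star (x * y) = star y * star x"
    and star_star: "star (star x) = x"

class cstar_algebra = complex_star_algebra + real_normed_algebra + banach +
  assumes scaleR_eq_scaleC: "scaleR r x = scaleC (complex_of_real r) x"
    and norm_scaleC: "norm (scaleC c x) = cmod c * norm x"
    and cstar_identity: "norm (star x * x) = (norm x)\<^sup>2"

class complex_hilbert_space = complex_vector + banach +
  fixes cinner :: "'a \<Rightarrow> 'a \<Rightarrow> complex"
  assumes scaleR_eq_scaleC_hilbert: "scaleR r x = scaleC (complex_of_real r) x"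
    and cinner_add_right: "cinner x (y + z) = cinner x y + cinner x z"
    and cinner_scaleC_right: "cinner x (scaleC c y) = c * cinner x y"
    and cinner_commute: "cinner x y = cnj (cinner y x)"
    and norm_eq_cinner: "complex_of_real ((norm x)\<^sup>2) = cinner x x"


section \<open>Matrix algebras\<close>

typedef ('a, 'k) cmat = "UNIV :: ('k \<Rightarrow> 'k \<Rightarrow> 'a) set"
  morphisms entry Mat by simp

setup_lifting type_definition_cmat

instantiation cmat :: (complex_star_algebra, finite) complex_star_algebra
begin

lift_definition zero_cmat :: "('a, 'b) cmat" is "\<lambda>i j. 0" .

lift_definition plus_cmat :: "('a, 'b) cmat \<Rightarrow> ('a, 'b) cmat \<Rightarrow> ('a, 'b) cmat"
  is "\<lambda>X Y i j. X i j + Y i j" .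

lift_definition minus_cmat :: "('a, 'b) cmat \<Rightarrow> ('a, 'b) cmat \<Rightarrow> ('a, 'b) cmat"
  is "\<lambda>X Y i j. X i j - Y i j" .

lift_definition uminus_cmat :: "('a, 'b) cmat \<Rightarrow> ('a, 'b) cmat"
  is "\<lambda>X i j. - X i j" .

lift_definition times_cmat :: "('a, 'b) cmat \<Rightarrow> ('a, 'b) cmat \<Rightarrow> ('a, 'b) cmat"
  is "\<lambda>X Y i j. \<Sum>l\<in>UNIV. X i l * Y l j" .

lift_definition scaleC_cmat :: "complex \<Rightarrow> ('a, 'b) cmat \<Rightarrow> ('a, 'b) cmat"
  is "\<lambda>c X i j. scaleC c (X i j)" .

lift_definition star_cmat :: "('a, 'b) cmat \<Rightarrow> ('a, 'b) cmat"
  is "\<lambda>X i j. star (X j i)" .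

instance
proof
  fix a b c :: "('a, 'b) cmat" and r s :: complex
  have star_zero: "star (0::'a) = 0"
    using star_add[of "0::'a" 0] by simp
  have star_sum: "star (sum f S) = (\<Sum>l\<in>S. star (f l))"
    if "finite S" for f :: "'b \<Rightarrow> 'a" and S
    using that by (induction S rule: finite_induct) (simp_all add: star_zero star_add)
  show "a + b + c = a + (b + c)" by transfer (simp add: add.assoc)
  show "a + b = b + a" by transfer (simp add: add.commute)
  show "0 + a = a" by transfer simp
  show "- a + a = 0" by transfer simp
  show "a - b = a + - b" by transfer simp
  show "scaleC r (a + b) = scaleC r a + scaleC r b"
    by transfer (simp add: scaleC_add_right)
  show "scaleC (r + s) a = scaleC r a + scaleC s a"
    by transfer (simp add: scaleC_add_left)
  show "scaleC r (scaleC s a) = scaleC (r * s) a"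
    by transfer (simp add: scaleC_scaleC)
  show "scaleC 1 a = a"
    by transfer (simp add: scaleC_one)
  show "a * b * c = a * (b * c)"
  proof (transfer, intro ext)
    fix a b c :: "'b \<Rightarrow> 'b \<Rightarrow> 'a" and i j
    have "(\<Sum>l\<in>UNIV. (\<Sum>m\<in>UNIV. a i m * b m l) * c l j)
        = (\<Sum>l\<in>UNIV. \<Sum>m\<in>UNIV. a i m * (b m l * c l j))"
      by (simp add: sum_distrib_right mult.assoc)
    also have "\<dots> = (\<Sum>m\<in>UNIV. \<Sum>l\<in>UNIV. a i m * (b m l * c l j))"
      by (rule sum.swap)
    finally show "(\<Sum>l\<in>UNIV. (\<Sum>m\<in>UNIV. a i m * b m l) * c l j)
        = (\<Sum>m\<in>UNIV. a i m * (\<Sum>l\<in>UNIV. b m l * c l j))"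
      by (simp add: sum_distrib_left)
  qed
  show "(a + b) * c = a * c + b * c"
    by transfer (simp add: distrib_right sum.distrib)
  show "a * (b + c) = a * b + a * c"
    by transfer (simp add: distrib_left sum.distrib)
  show "scaleC r a * b = scaleC r (a * b)"
    by transfer (simp add: scaleC_mult_left complex_vector.scale_sum_right)
  show "a * scaleC r b = scaleC r (a * b)"
    by transfer (simp add: scaleC_mult_right complex_vector.scale_sum_right)
  show "star (a + b) = star a + star b"
    by transfer (simp add: star_add)
  show "star (scaleC r a) = scaleC (cnj r) (star a)"
    by transfer (simp add: star_scaleC)
  show "star (a * b) = star b * star a"
    by transfer (simp add: star_sum star_mult)
  show "star (star a) = a"
    by transfer (simp add: star_star)
qed

end

definition amplification :: "('a \<Rightarrow> 'b) \<Rightarrow> ('a, 'k) cmat \<Rightarrow> ('b, 'k) cmat"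
  where "amplification \<phi> X = Mat (\<lambda>i j. \<phi> (entry X i j))"


section \<open>Completely positive maps and order zero\<close>

text \<open>
  Positivity, complete positivity, orthogonality and order zero refer only to the *-algebra
  structure. They are defined at that level so that they apply to the matrix algebra
  over a C*-algebra \<open>A\<close>, on which the (unique) C*-norm is not made explicit here.
\<close>

definition positive :: "'a::complex_star_algebra \<Rightarrow> bool"
  where "positive a \<longleftrightarrow> (\<exists>b. a = star b * b)"

text \<open>
  \<open>X\<close>, restricted to indices below \<open>n\<close>, is positive as an \<open>n \<times> n\<close> matrix: it equals \<open>Y* Y\<close> for
  some \<open>n \<times> n\<close> matrix \<open>Y\<close>. Here the size is a number, not a type, since complete positivity
  quantifies over it.
\<close>

definition positive_matrix :: "nat \<Rightarrow> (nat \<Rightarrow> nat \<Rightarrow> 'a::complex_star_algebra) \<Rightarrow> bool"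
  where "positive_matrix n X \<longleftrightarrow>
    (\<exists>Y. \<forall>i<n. \<forall>j<n. X i j = (\<Sum>l<n. star (Y l i) * Y l j))"

definition completely_positive ::
    "('a::complex_star_algebra \<Rightarrow> 'b::complex_star_algebra) \<Rightarrow> bool"
  where "completely_positive \<phi> \<longleftrightarrow> clinear \<phi> \<and>
    (\<forall>n X. positive_matrix n X \<longrightarrow> positive_matrix n (\<lambda>i j. \<phi> (X i j)))"

definition cpc :: "('a::cstar_algebra \<Rightarrow> 'b::cstar_algebra) \<Rightarrow> bool"
  where "cpc \<phi> \<longleftrightarrow> completely_positive \<phi> \<and> (\<forall>a. norm (\<phi> a) \<le> norm a)"

definition orthogonal_elements :: "'a::complex_star_algebra \<Rightarrow> 'a \<Rightarrow> bool"
  where "orthogonal_elements a b \<longleftrightarrow>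
    a * b = 0 \<and> b * a = 0 \<and> star a * b = 0 \<and> a * star b = 0"

definition order_zero :: "('a::complex_star_algebra \<Rightarrow> 'b::complex_star_algebra) \<Rightarrow> bool"
  where "order_zero \<phi> \<longleftrightarrow> completely_positive \<phi> \<and>
    (\<forall>a b. positive a \<and> positive b \<and> orthogonal_elements a b
      \<longrightarrow> orthogonal_elements (\<phi> a) (\<phi> b))"


section \<open>C*-tensor products\<close>

text \<open>
  \<open>\<tau>\<close> is the map sending \<open>(a, c)\<close> to \<open>a \<otimes> c\<close>; the C*-algebra \<open>'t\<close> is the completion of the
  algebraic tensor product, realised as the linear span of the range of \<open>\<tau>\<close>, in some C*-norm.
  The fourth condition is the universal property of the algebraic tensor product. Scalar-valued
  bilinear forms suffice, because linear functionals separate the points of a vector space, and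
  the linear map may be taken on all of \<open>'t\<close>, because it is not required to be continuous.
\<close>

definition cstar_tensor ::
    "('a::cstar_algebra \<Rightarrow> 'c::cstar_algebra \<Rightarrow> 't::cstar_algebra) \<Rightarrow> bool"
  where "cstar_tensor \<tau> \<longleftrightarrow>
    cbilinear \<tau> \<and>
    (\<forall>a c a' c'. \<tau> a c * \<tau> a' c' = \<tau> (a * a') (c * c')) \<and>
    (\<forall>a c. star (\<tau> a c) = \<tau> (star a) (star c)) \<and>
    (\<forall>\<beta> :: 'a \<Rightarrow> 'c \<Rightarrow> complex. cbilinear \<beta> \<longrightarrow>
      (\<exists>L. clinear L \<and> (\<forall>a c. L (\<tau> a c) = \<beta> a c))) \<and>
    closure (cspan (range (\<lambda>(a, c). \<tau> a c))) = UNIV"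

definition cstar_seminorm_on :: "'a::complex_star_algebra set \<Rightarrow> ('a \<Rightarrow> real) \<Rightarrow> bool"
  where "cstar_seminorm_on S p \<longleftrightarrow>
    (\<forall>x\<in>S. 0 \<le> p x) \<and>
    (\<forall>x\<in>S. \<forall>y\<in>S. p (x + y) \<le> p x + p y) \<and>
    (\<forall>x\<in>S. \<forall>c. p (scaleC c x) = cmod c * p x) \<and>
    (\<forall>x\<in>S. \<forall>y\<in>S. p (x * y) \<le> p x * p y) \<and>
    (\<forall>x\<in>S. p (star x * x) = (p x)\<^sup>2)"

text \<open>The norm of the maximal tensor product is the greatest C*-seminorm on the algebraic one.\<close>

definition maximal_tensor ::
    "('a::cstar_algebra \<Rightarrow> 'c::cstar_algebra \<Rightarrow> 't::cstar_algebra) \<Rightarrow> bool"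
  where "maximal_tensor \<tau> \<longleftrightarrow> cstar_tensor \<tau> \<and>
    (\<forall>p. cstar_seminorm_on (cspan (range (\<lambda>(a, c). \<tau> a c))) p
      \<longrightarrow> (\<forall>x \<in> cspan (range (\<lambda>(a, c). \<tau> a c)). p x \<le> norm x))"

definition representation ::
    "('a::cstar_algebra \<Rightarrow> 'h::complex_hilbert_space \<Rightarrow> 'h) \<Rightarrow> bool"
  where "representation \<pi> \<longleftrightarrow>
    (\<forall>a. clinear (\<pi> a) \<and> bounded_linear (\<pi> a)) \<and>
    (\<forall>x. clinear (\<lambda>a. \<pi> a x)) \<and>
    (\<forall>a b x. \<pi> (a * b) x = \<pi> a (\<pi> b x)) \<and>
    (\<forall>a x y. cinner (\<pi> (star a) x) y = cinner x (\<pi> a y))"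

text \<open>\<open>\<theta>\<close> exhibits \<open>'l\<close> as the Hilbert space tensor product of \<open>'h\<close> and \<open>'k\<close>.\<close>

definition hilbert_tensor ::
    "('h::complex_hilbert_space \<Rightarrow> 'k::complex_hilbert_space \<Rightarrow> 'l::complex_hilbert_space) \<Rightarrow> bool"
  where "hilbert_tensor \<theta> \<longleftrightarrow>
    cbilinear \<theta> \<and>
    (\<forall>x y x' y'. cinner (\<theta> x y) (\<theta> x' y') = cinner x x' * cinner y y') \<and>
    closure (cspan (range (\<lambda>(x, y). \<theta> x y))) = UNIV"

text \<open>
  The minimal (spatial) tensor product, formed with faithful representations \<open>\<pi>\<close> on \<open>'h\<close> and
  \<open>\<rho>\<close> on \<open>'k\<close>: the norm is the operator norm of \<open>\<pi> \<otimes> \<rho>\<close> on the Hilbert space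
  tensor product. It does not depend on the chosen representations, but these
  have to be arguments, since a definition cannot quantify over the types of the Hilbert spaces.
\<close>

definition minimal_tensor ::
    "('a::cstar_algebra \<Rightarrow> 'h::complex_hilbert_space \<Rightarrow> 'h) \<Rightarrow>
     ('c::cstar_algebra \<Rightarrow> 'k::complex_hilbert_space \<Rightarrow> 'k) \<Rightarrow>
     ('h \<Rightarrow> 'k \<Rightarrow> 'l::complex_hilbert_space) \<Rightarrow>
     ('a \<Rightarrow> 'c \<Rightarrow> 't::cstar_algebra) \<Rightarrow> bool"
  where "minimal_tensor \<pi> \<rho> \<theta> \<tau> \<longleftrightarrow> cstar_tensor \<tau> \<and>
    representation \<pi> \<and> inj \<pi> \<and> representation \<rho> \<and> inj \<rho> \<and> hilbert_tensor \<theta> \<and>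
    (\<exists>\<sigma>. representation \<sigma> \<and>
      (\<forall>a c x y. \<sigma> (\<tau> a c) (\<theta> x y) = \<theta> (\<pi> a x) (\<rho> c y)) \<and>
      (\<forall>z. norm z = onorm (\<sigma> z)))"

definition is_tensor_map ::
    "('a::cstar_algebra \<Rightarrow> 'c::cstar_algebra \<Rightarrow> 's::cstar_algebra) \<Rightarrow>
     ('b::cstar_algebra \<Rightarrow> 'd::cstar_algebra \<Rightarrow> 't::cstar_algebra) \<Rightarrow>
     ('a \<Rightarrow> 'b) \<Rightarrow> ('c \<Rightarrow> 'd) \<Rightarrow> ('s \<Rightarrow> 't) \<Rightarrow> bool"
  where "is_tensor_map \<tau> \<tau>' \<phi> \<psi> \<Phi> \<longleftrightarrow>
    clinear \<Phi> \<and> continuous_on UNIV \<Phi> \<and> (\<forall>a c. \<Phi> (\<tau> a c) = \<tau>' (\<phi> a) (\<psi> c))"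

end

(*
  The key identity for a completely positive order zero map phi is phi(ab) phi(c) = phi(a) phi(bc).
  Complete positivity extends the preservation of orthogonality from positive elements to all
  products xy = 0; hence F(f, g) = phi(a f(b)) phi(g(b) c) vanishes for self-adjoint b whenever
  fg = 0, and a bounded bilinear form with this property satisfies F(t, 1) = F(1, t). The identity
  passes to matrices and to tensor products, and it implies order zero: if x = star(s) s and
  xy = 0 then sy = 0, so Phi(x) Phi(y) = Phi(star(s)) Phi(sy) = 0.

  It also yields the map on the tensor product. Let L be the map on the algebraic tensor product.
  Then |L(xy)|^2 <= |L(y)| |L(star(x) x y)|, so L(y) |-> L(xy) behaves like an
  action of a C-star algebra. For the maximal norm this action defines a C-star seminorm; for the minimal norm
  iterating the inequality leaves only a crude bound to be shown, which holds since products of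
  bounded functionals are bounded for the minimal norm. In both cases |L(xy)| <= |x| |L(y)|, and
  inserting an approximate unit for y shows that L is contractive. Complete positivity survives
  the passage to the completion because positivity of a matrix is a closed condition.
*)

theory Submission
  imports Defs "HOL-Complex_Analysis.Complex_Analysis" "HOL-Real_Asymp.Real_Asymp"
begin

section \<open>C*-algebras and their unitizations\<close>

text \<open>The action in the overview is the shadow of the structure theorem for order zero maps:
  \<open>\<phi>(a) = h \<alpha>(a)\<close>, where \<open>\<alpha>\<close> is a homomorphism into the
  multipliers of the algebra generated by the image and \<open>h\<close> is positive and commutes
  with it. Multiplication by \<open>\<alpha>(a)\<close> is the map
  \<open>\<phi>(b) |-> \<phi>(a b)\<close>; working with this map on values alone avoids multiplier
  algebras and biduals. The bound |L(xy)| <= |x| |L(y)| then says that the tensor product of two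
  such homomorphisms is contractive.

  The detour through an identity is forced by the completion: orthogonal positive elements there
  have no evident approximation by orthogonal elements of the algebraic tensor product, whereas an
  equation between continuous expressions extends from a dense set.

  Since no units are available, functional calculus, square roots and comparison of norms take place
  in the unitization; results return because the original algebra is an ideal in it. Spectra never
  occur: the interval \<open>[- norm h, norm h]\<close> replaces the spectrum of \<open>h\<close>,
  and positivity becomes being the square of a self-adjoint element.\<close>

lemma star_zero [simp]: "star (0::'a::complex_star_algebra) = 0"
  using star_add[of "0::'a" 0] by simp

lemma star_minus: "star (- x) = - star (x::'a::complex_star_algebra)"
  using star_add[of x "- x"] by (simp add: eq_neg_iff_add_eq_0 add.commute)

lemma star_diff: "star (x - y) = star x - star (y::'a::complex_star_algebra)"
  using star_add[of x "- y"] by (simp add: star_minus)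

lemma star_sum: "star (sum f S) = (\<Sum>i\<in>S. star (f i :: 'a::complex_star_algebra))"
  by (induction S rule: infinite_finite_induct) (simp_all add: star_add)

lemma star_one [simp]: "star (1::'a::{complex_star_algebra, ring_1}) = 1"
  by (metis mult.right_neutral mult.left_neutral star_mult star_star)

lemma star_power: "star (x ^ n) = star (x::'a::{complex_star_algebra, ring_1}) ^ n"
  by (induction n) (simp_all add: star_mult power_commutes)

lemma star_scaleR: "star (scaleR r x) = scaleR r (star (x::'a::cstar_algebra))"
  by (simp add: scaleR_eq_scaleC star_scaleC)

lemma norm_star [simp]: "norm (star x) = norm (x::'a::cstar_algebra)"
proof -
  have "norm x \<le> norm (star x)" for x :: 'a
  proof (cases "x = 0")
    case False
    have "norm x * norm x \<le> norm (star x) * norm x"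
      using norm_mult_ineq[of "star x" x] by (simp add: cstar_identity power2_eq_square)
    with False show ?thesis by simp
  qed simp
  from this[of x] this[of "star x"] show ?thesis by (simp add: star_star)
qed

lemma cstar_identity': "norm (x * star x) = (norm (x::'a::cstar_algebra))\<^sup>2"
  using cstar_identity[of "star x"] by (simp add: star_star)

lemma bounded_linear_star: "bounded_linear (star :: 'a::cstar_algebra \<Rightarrow> 'a)"
  by (rule bounded_linear_intro[where K = 1]) (simp_all add: star_add star_scaleR)

lemmas tendsto_star [tendsto_intros] = bounded_linear.tendsto[OF bounded_linear_star]
lemmas continuous_on_star [continuous_intros] = bounded_linear.continuous_on[OF bounded_linear_star]

lemma bounded_linear_scaleC: "bounded_linear (scaleC c :: 'a::cstar_algebra \<Rightarrow> 'a)"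
  by (rule bounded_linear_intro[where K = "cmod c"])
    (simp_all add: scaleC_add_right scaleR_eq_scaleC scaleC_scaleC norm_scaleC mult.commute)

lemmas tendsto_scaleC [tendsto_intros] = bounded_linear.tendsto[OF bounded_linear_scaleC]

section \<open>Adjoining a unit to a C*-algebra\<close>

datatype 'a unitization = Unitization (base: 'a) (scal: complex)

lemma unitization_eqI: "base x = base y \<Longrightarrow> scal x = scal y \<Longrightarrow> x = y"
  by (cases x; cases y) simp

instantiation unitization :: (cstar_algebra) complex_star_algebra
begin
definition "0 = Unitization 0 0"
definition "x + y = Unitization (base x + base y) (scal x + scal y)"
definition "x - y = Unitization (base x - base y) (scal x - scal y)"
definition "- x = Unitization (- base x) (- scal x)"
definition "x * y = Unitization (base x * base y + scaleC (scal x) (base y) + scaleC (scal y) (base x))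
   (scal x * scal y)"
definition "scaleC c x = Unitization (scaleC c (base x)) (c * scal x)"
definition "star x = Unitization (star (base x)) (cnj (scal x))"

lemmas unitization_defs = zero_unitization_def plus_unitization_def minus_unitization_def
  uminus_unitization_def times_unitization_def scaleC_unitization_def star_unitization_def

instance
  by standard
    (auto simp: unitization_defs algebra_simps scaleC_add_right scaleC_add_left scaleC_scaleC
      scaleC_one scaleC_mult_left scaleC_mult_right star_add star_scaleC star_mult star_star)
end

instantiation unitization :: (cstar_algebra) real_algebra_1
begin
definition "1 = Unitization 0 1"
definition "scaleR r x = Unitization (scaleR r (base x)) (of_real r * scal x)"
instance
  by standard
    (auto simp: unitization_defs one_unitization_def scaleR_unitization_def algebra_simps
      scaleC_one scaleR_eq_scaleC scaleC_scaleC scaleC_mult_left scaleC_mult_right scaleC_add_right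
      scaleC_add_left)
end

lemma base_simps [simp]:
  "base 0 = 0" "base 1 = 0" "base (x + y) = base x + base y" "base (x - y) = base x - base y"
  "base (- x) = - base x" "base (scaleC c x) = scaleC c (base x)" "base (star x) = star (base x)"
  "base (scaleR r x) = scaleR r (base x)"
  "scal 0 = 0" "scal 1 = 1" "scal (x + y) = scal x + scal y" "scal (x - y) = scal x - scal y"
  "scal (- x) = - scal x" "scal (scaleC c x) = c * scal x" "scal (star x) = cnj (scal x)"
  "scal (scaleR r x) = of_real r * scal x"
  "base (x * y) = base x * base y + scaleC (scal x) (base y) + scaleC (scal y) (base x)"
  "scal (x * y) = scal x * scal y"
  by (simp_all add: unitization_defs one_unitization_def scaleR_unitization_def)

text \<open>The original algebra is an ideal in its unitization, so every element of the unitization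
  acts on it from the left. The operator norm of this action is the source of the C*-norm, and the
  action carries elements found in the unitization back to the algebra.\<close>

definition left_action :: "'a::cstar_algebra unitization \<Rightarrow> 'a \<Rightarrow> 'a"
  where "left_action x b = base x * b + scaleC (scal x) b"

lemma bounded_linear_left_action: "bounded_linear (left_action x)"
  unfolding left_action_def
  by (intro bounded_linear_add bounded_linear_mult_right bounded_linear_scaleC)

lemma left_action_mult: "left_action (x * y) b = left_action x (left_action y b)"
  by (simp add: left_action_def algebra_simps scaleC_add_right scaleC_scaleC
      scaleC_mult_left scaleC_mult_right)

lemma left_action_adjoint: "star (left_action x b) * c = star b * left_action (star x) c"
  by (simp add: left_action_def algebra_simps star_add star_mult star_scaleC scaleC_mult_left
      scaleC_mult_right)

lemma onorm_left_action_mult: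
  "onorm (left_action (x * y)) \<le> onorm (left_action x) * onorm (left_action y)"
proof -
  have "left_action (x * y) = left_action x \<circ> left_action y"
    by (auto simp: left_action_mult)
  then show ?thesis
    using onorm_compose[OF bounded_linear_left_action bounded_linear_left_action] by metis
qed

text \<open>By the C*-identity in \<open>'a\<close>, \<open>(norm (x b))^2\<close> is the norm of
  \<open>star b * (star x * x) b\<close>, so the identity for operators follows from the one for the
  vectors they act on.\<close>

lemma onorm_left_action_square:
  "(onorm (left_action x))\<^sup>2 \<le> onorm (left_action (star x * x))" (is "?p\<^sup>2 \<le> ?q")
proof -
  have q0: "?q \<ge> 0" by (rule onorm_pos_le[OF bounded_linear_left_action])
  have "norm (left_action x b) \<le> sqrt ?q * norm b" for b
  proof -
    have "(norm (left_action x b))\<^sup>2 = norm (star b * left_action (star x * x) b)"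
      by (simp add: cstar_identity[symmetric] left_action_adjoint left_action_mult)
    also have "\<dots> \<le> norm b * (?q * norm b)"
      using norm_mult_ineq[of "star b"] onorm[OF bounded_linear_left_action, of "star x * x" b]
      by (metis mult_left_mono norm_ge_zero norm_star order.trans)
    also have "\<dots> = (sqrt ?q * norm b)\<^sup>2"
      using q0 by (simp add: power_mult_distrib) (simp add: power2_eq_square)
    finally show ?thesis
      by (rule power2_le_imp_le) (simp add: q0)
  qed
  then have "?p \<le> sqrt ?q"
    by (intro onorm_bound) (simp_all add: q0)
  then show ?thesis
    using onorm_pos_le[OF bounded_linear_left_action, of x] q0 real_le_rsqrt sqrt_ge_absD by fastforce
qed

lemma onorm_left_action_star: "onorm (left_action (star x)) = onorm (left_action x)"
proof -
  have "onorm (left_action x) \<le> onorm (left_action (star x))" for x :: "'a unitization"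
  proof (cases "onorm (left_action x) = 0")
    case True
    then show ?thesis by (simp add: onorm_pos_le[OF bounded_linear_left_action])
  next
    case False
    then have "onorm (left_action x) > 0"
      using onorm_pos_le[OF bounded_linear_left_action, of x] by simp
    with order.trans[OF onorm_left_action_square[of x] onorm_left_action_mult[of "star x" x]]
    show ?thesis by (simp add: power2_eq_square)
  qed
  from this[of x] this[of "star x"] show ?thesis by (simp add: star_star)
qed

lemma onorm_left_action_cstar: "onorm (left_action (star x * x)) = (onorm (left_action x))\<^sup>2"
  using onorm_left_action_square[of x] onorm_left_action_mult[of "star x" x]
  by (simp add: onorm_left_action_star power2_eq_square)

text \<open>
  The operator norm of left multiplication is only a seminorm when the algebra already has a
  unit, hence the maximum with the modulus of the scalar part.
\<close>

instantiation unitization :: (cstar_algebra) real_normed_algebra_1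
begin
definition "norm x = max (onorm (left_action x)) (cmod (scal x))"
definition "dist x y = norm (x - y)" for x y :: "'a unitization"
definition "sgn x = scaleR (inverse (norm x)) x" for x :: "'a unitization"
definition uniformity_unitization :: "('a unitization \<times> 'a unitization) filter"
  where "uniformity_unitization = (INF e\<in>{0 <..}. principal {(x, y). dist x y < e})"
definition open_unitization :: "'a unitization set \<Rightarrow> bool"
  where "open_unitization U \<longleftrightarrow> (\<forall>x\<in>U. eventually (\<lambda>(x', y). x' = x \<longrightarrow> y \<in> U) uniformity)"
instance
proof
  fix x y :: "'a unitization" and r :: real
  note bl = bounded_linear_left_action
  show "dist x y = norm (x - y)" by (rule dist_unitization_def)
  show "sgn x = scaleR (inverse (norm x)) x" by (rule sgn_unitization_def)
  show "uniformity = (INF e\<in>{0 <..}. principal {(x, y::'a unitization). dist x y < e})"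
    by (rule uniformity_unitization_def)
  show "open U \<longleftrightarrow> (\<forall>x\<in>U. eventually (\<lambda>(x', y). x' = x \<longrightarrow> y \<in> U) uniformity)"
    for U :: "'a unitization set" by (rule open_unitization_def)
  have "norm x \<ge> 0" by (simp add: norm_unitization_def le_max_iff_disj)
  show "norm x = 0 \<longleftrightarrow> x = 0"
  proof
    assume "norm x = 0"
    then have *: "scal x = 0" "onorm (left_action x) = 0"
      using onorm_pos_le[OF bl, of x] by (simp_all add: norm_unitization_def max_def split: if_splits)
    \<comment> \<open>The test vector \<open>star (base x)\<close> recovers
      \<open>norm (base x)\<close> through the C*-identity, in place of the absent unit.\<close>
    from *(2) have "left_action x (star (base x)) = 0"
      using onorm_eq_0[OF bl, of x] by simp
    then have "norm (base x * star (base x)) = 0" by (simp add: left_action_def *)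
    then show "x = 0" using * by (intro unitization_eqI) (simp_all add: cstar_identity')
  next
    assume "x = 0"
    then have "left_action x = (\<lambda>_. 0)" by (auto simp: left_action_def)
    then show "norm x = 0" using \<open>x = 0\<close> by (simp add: norm_unitization_def onorm_zero)
  qed
  have "left_action (x + y) = (\<lambda>b. left_action x b + left_action y b)"
    by (auto simp: left_action_def algebra_simps scaleC_add_left)
  then have "onorm (left_action (x + y)) \<le> onorm (left_action x) + onorm (left_action y)"
    using onorm_triangle[OF bl bl, of x y] by simp
  then show "norm (x + y) \<le> norm x + norm y"
    using norm_triangle_ineq[of "scal x" "scal y"] by (auto simp: norm_unitization_def max_def)
  have "left_action (scaleR r x) = (\<lambda>b. scaleR r (left_action x b))"
    by (auto simp: left_action_def scaleR_eq_scaleC scaleC_scaleC scaleC_add_right scaleC_mult_left)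
  then have "onorm (left_action (scaleR r x)) = \<bar>r\<bar> * onorm (left_action x)"
    using onorm_scaleR[OF bl, of r x] by simp
  then show "norm (scaleR r x) = \<bar>r\<bar> * norm x"
    by (simp add: norm_unitization_def norm_mult max_mult_distrib_left)
  show "norm (x * y) \<le> norm x * norm y"
  proof -
    have "onorm (left_action (x * y)) \<le> onorm (left_action x) * onorm (left_action y)"
      by (rule onorm_left_action_mult)
    also have "\<dots> \<le> norm x * norm y"
      by (intro mult_mono) (simp_all add: norm_unitization_def onorm_pos_le[OF bl] le_max_iff_disj)
    finally have "onorm (left_action (x * y)) \<le> norm x * norm y" .
    moreover have "cmod (scal (x * y)) \<le> norm x * norm y"
      by (simp add: norm_mult) (intro mult_mono; simp add: norm_unitization_def le_max_iff_disj)
    ultimately show ?thesis by (subst norm_unitization_def) simp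
  qed
  have "left_action (1 :: 'a unitization) = (\<lambda>b. b)"
    by (auto simp: left_action_def scaleC_one)
  then have "onorm (left_action (1 :: 'a unitization)) \<le> 1"
    by (simp add: onorm_id_le)
  then show "norm (1 :: 'a unitization) = 1"
    by (simp add: norm_unitization_def)
qed
end

abbreviation (input) embed :: "'a::cstar_algebra \<Rightarrow> 'a unitization"
  where "embed a \<equiv> Unitization a 0"

lemma embed_simps:
  "embed (a + b) = embed a + embed b" "embed (a - b) = embed a - embed b" "embed 0 = 0"
  "embed (a * b) = embed a * embed b" "embed (scaleC c a) = scaleC c (embed a)"
  "embed (scaleR r a) = scaleR r (embed a)" "embed (star a) = star (embed a)"
  "embed (- a) = - embed a"
  by (rule unitization_eqI; simp)+

lemma embed_base: "scal x = 0 \<Longrightarrow> embed (base x) = x"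
  by (cases x) simp

text \<open>The vector \<open>star a\<close> shows that left multiplication by \<open>a\<close> has
  norm at least \<open>norm a\<close>. Isometry is what transfers every norm statement between the
  algebra and its unitization.\<close>

lemma norm_embed [simp]: "norm (embed a) = norm (a::'a::cstar_algebra)"
proof -
  have act: "left_action (embed a) b = a * b" for b by (simp add: left_action_def)
  have "onorm (left_action (embed a)) \<le> norm a"
    by (rule onorm_bound) (simp_all add: act norm_mult_ineq)
  moreover have "norm a \<le> onorm (left_action (embed a))"
  proof (cases "a = 0")
    case False
    have "(norm a)\<^sup>2 \<le> onorm (left_action (embed a)) * norm a"
      using onorm[OF bounded_linear_left_action, of "embed a" "star a"]
      by (simp add: act cstar_identity')
    with False show ?thesis by (simp add: power2_eq_square)
  qed (simp add: onorm_pos_le[OF bounded_linear_left_action])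
  ultimately show ?thesis
    by (simp add: norm_unitization_def onorm_pos_le[OF bounded_linear_left_action])
qed

lemma norm_scal_le: "cmod (scal x) \<le> norm x"
  by (simp add: norm_unitization_def)

lemma unitization_decompose: "x = embed (base x) + scaleC (scal x) 1"
  by (rule unitization_eqI) simp_all

lemma norm_scaleC_unitization: "norm (scaleC c x) = cmod c * norm (x::'a::cstar_algebra unitization)"
proof -
  have act: "left_action (scaleC c x) = (\<lambda>b. scaleC c (left_action x b))" for c and x :: "'a unitization"
    by (auto simp: left_action_def scaleC_add_right scaleC_scaleC scaleC_mult_left)
  have le: "onorm (left_action (scaleC c x)) \<le> cmod c * onorm (left_action x)"
    for c and x :: "'a unitization"
    using onorm[OF bounded_linear_left_action, of x] onorm_pos_le[OF bounded_linear_left_action, of x]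
    by (intro onorm_bound) (simp_all add: act norm_scaleC mult.assoc mult_left_mono)
  have "onorm (left_action (scaleC c x)) = cmod c * onorm (left_action x)"
  proof (cases "c = 0")
    case True
    then show ?thesis
      using le[of c x] onorm_pos_le[OF bounded_linear_left_action, of "scaleC c x"] by simp
  next
    case False
    have "onorm (left_action x) \<le> cmod (1 / c) * onorm (left_action (scaleC c x))"
      using le[of "1 / c" "scaleC c x"] False by (simp add: scaleC_scaleC scaleC_one)
    with False le[of c x] show ?thesis by (simp add: norm_divide field_simps)
  qed
  then show ?thesis
    by (simp add: norm_unitization_def norm_mult max_mult_distrib_left)
qed

text \<open>\<open>scal\<close> is contractive, so the scalar parts of a Cauchy sequence converge;
  once they are subtracted, the rest is a Cauchy sequence in the isometric copy of the complete
  space \<open>'a\<close>.\<close>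

instance unitization :: (cstar_algebra) banach
proof
  fix X :: "nat \<Rightarrow> 'a unitization"
  assume X: "Cauchy X"
  have "Cauchy (\<lambda>n. scal (X n))"
    unfolding Cauchy_altdef2
  proof (intro allI impI)
    fix e :: real assume "e > 0"
    with X obtain N where "\<forall>n\<ge>N. dist (X n) (X N) < e" unfolding Cauchy_altdef2 by blast
    then show "\<exists>N. \<forall>n\<ge>N. dist (scal (X n)) (scal (X N)) < e"
      using norm_scal_le by (metis base_simps(12) dist_norm order_le_less_trans)
  qed
  then obtain l where l: "(\<lambda>n. scal (X n)) \<longlonglongrightarrow> l"
    using Cauchy_convergent convergent_def by blast
  have lim_scalar: "(\<lambda>n. scaleC (scal (X n)) (1::'a unitization)) \<longlonglongrightarrow> scaleC l 1"
    using l by (simp add: tendsto_iff dist_norm norm_scaleC_unitization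
        complex_vector.scale_left_diff_distrib[symmetric])
  have "Cauchy (\<lambda>n. X n - scaleC (scal (X n)) 1)"
    unfolding Cauchy_iff
  proof (intro allI impI)
    fix e :: real assume "e > 0"
    then obtain M N where M: "\<And>m n. m \<ge> M \<Longrightarrow> n \<ge> M \<Longrightarrow> norm (X m - X n) < e / 2"
      and N: "\<And>m n. m \<ge> N \<Longrightarrow> n \<ge> N \<Longrightarrow>
        norm (scaleC (scal (X m)) 1 - scaleC (scal (X n)) (1::'a unitization)) < e / 2"
      using X LIMSEQ_imp_Cauchy[OF lim_scalar] unfolding Cauchy_iff by (meson half_gt_zero)
    have "norm (X m - scaleC (scal (X m)) 1 - (X n - scaleC (scal (X n)) 1)) < e"
      if "m \<ge> max M N" "n \<ge> max M N" for m n
      using norm_diff_triangle_less[of "X m" "X n" "e / 2"] M[of m n] N[of m n] that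
        norm_triangle_ineq4[of "X m - X n" "scaleC (scal (X m)) 1 - scaleC (scal (X n)) 1"]
      by (simp add: algebra_simps)
    then show "\<exists>M. \<forall>m\<ge>M. \<forall>n\<ge>M.
        norm (X m - scaleC (scal (X m)) 1 - (X n - scaleC (scal (X n)) 1)) < e" by blast
  qed
  moreover have eq: "X n - scaleC (scal (X n)) 1 = embed (base (X n))" for n
    using unitization_decompose[of "X n"] by (metis add_diff_cancel_right')
  ultimately have "Cauchy (\<lambda>n. base (X n))"
    by (simp add: Cauchy_def dist_norm embed_simps(2)[symmetric])
  then obtain a where "(\<lambda>n. base (X n)) \<longlonglongrightarrow> a"
    using Cauchy_convergent convergent_def by blast
  then have "(\<lambda>n. embed (base (X n))) \<longlonglongrightarrow> embed a"
    by (simp add: tendsto_iff dist_norm embed_simps(2)[symmetric])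
  from tendsto_add[OF this lim_scalar] show "convergent X"
    unfolding convergent_def unitization_decompose[symmetric] by blast
qed

instance unitization :: (cstar_algebra) cstar_algebra
proof
  fix r :: real and c and x :: "'a unitization"
  show "scaleR r x = scaleC (complex_of_real r) x"
    by (rule unitization_eqI) (simp_all add: scaleR_eq_scaleC)
  show "norm (scaleC c x) = cmod c * norm x"
    by (rule norm_scaleC_unitization)
  have "max (p\<^sup>2) (q\<^sup>2) = (max p q)\<^sup>2" if "p \<ge> 0" "q \<ge> 0" for p q :: real
    using that by (auto simp: max_def power2_le_iff_abs_le)
  then show "norm (star x * x) = (norm x)\<^sup>2"
    by (simp add: norm_unitization_def onorm_left_action_cstar norm_mult power2_eq_square
        onorm_pos_le[OF bounded_linear_left_action])
qed

lemma tendsto_embed [tendsto_intros]: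
  "(f \<longlongrightarrow> a) F \<Longrightarrow> ((\<lambda>x. embed (f x)) \<longlongrightarrow> embed (a::'a::cstar_algebra)) F"
  by (simp add: tendsto_iff dist_norm embed_simps(2)[symmetric])

section \<open>Continuous functional calculus for a self-adjoint element\<close>

locale scalars =
  fixes s :: "'k::comm_ring_1 \<Rightarrow> 'u::ring_1"
  assumes s_add: "s (c + d) = s c + s d" and s_mult: "s (c * d) = s c * s d"
    and s_one: "s 1 = 1" and s_central: "s c * x = x * s c"
begin

text \<open>\<open>poly\<close> evaluates only inside the commutative ring of coefficients. Here the
  argument lies in an algebra in which the coefficients are merely central; real coefficients serve
  self-adjoint elements, complex ones serve unitaries.\<close>

definition eval :: "'k poly \<Rightarrow> 'u \<Rightarrow> 'u"
  where "eval p x = (\<Sum>i\<le>degree p. s (coeff p i) * x ^ i)"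

lemma s_zero: "s 0 = 0"
  using s_add[of 0 0] by simp

lemma eval_altdef: "degree p \<le> n \<Longrightarrow> eval p x = (\<Sum>i\<le>n. s (coeff p i) * x ^ i)"
  unfolding eval_def
  by (rule sum.mono_neutral_left) (auto simp: coeff_eq_0 s_zero not_le)

lemma eval_pCons: "eval (pCons c p) x = s c + x * eval p x"
proof -
  have "s d * (x * y) = x * (s d * y)" for d y
    by (metis mult.assoc s_central)
  then show ?thesis
    by (subst eval_altdef[of _ "Suc (degree p)"])
      (simp_all add: degree_pCons_le sum.atMost_Suc_shift eval_def sum_distrib_left del: sum.atMost_Suc)
qed

lemma eval_0 [simp]: "eval 0 x = 0"
  by (simp add: eval_def s_zero)

lemma eval_1 [simp]: "eval 1 x = 1"
  by (simp add: eval_def s_one)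

lemma eval_add: "eval (p + q) x = eval p x + eval q x"
  by (induction p q rule: poly_induct2) (simp_all add: eval_pCons s_add algebra_simps)

lemma eval_smult: "eval (smult c p) x = s c * eval p x"
  by (induction p) (simp_all add: eval_pCons s_mult distrib_left,
    metis mult.assoc s_central)

lemma eval_mult: "eval (p * q) x = eval p x * eval q x"
  by (induction p) (simp_all add: eval_pCons eval_add eval_smult s_zero distrib_right mult.assoc)

lemma eval_power: "eval (p ^ n) x = eval p x ^ n"
  by (induction n) (simp_all add: eval_mult)

lemma eval_sum: "eval (\<Sum>i\<in>A. f i) x = (\<Sum>i\<in>A. eval (f i) x)"
  by (induction A rule: infinite_finite_induct) (simp_all add: eval_add)

lemma eval_monom: "eval (monom c n) x = s c * x ^ n"
proof -
  have "s c * (x * y) = x * (s c * y)" for y by (metis mult.assoc s_central)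
  then show ?thesis
    by (induction n) (simp_all add: monom_0 monom_Suc eval_pCons s_zero)
qed

lemma eval_pcompose: "eval (pcompose p q) x = eval p (eval q x)"
  by (induction p) (simp_all add: pcompose_pCons eval_pCons eval_add eval_mult)

text \<open>With \<open>x' = x\<close> this is commutation; with two different arguments it relates
  functions of \<open>star d * d\<close> to functions of \<open>d * star d\<close>.\<close>

lemma eval_intertwine: "y * x = x' * y \<Longrightarrow> y * eval p x = eval p x' * y"
proof (induction p)
  case (pCons a p)
  then show ?case
    by (simp add: eval_pCons algebra_simps s_central) (metis mult.assoc)
qed simp

end

global_interpretation real_scalars: scalars "of_real :: real \<Rightarrow> 'u::real_algebra_1"
  defines peval = real_scalars.eval
  by standard (simp_all add: Real_Vector_Spaces.of_real_def algebra_simps)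

global_interpretation complex_scalars:
  scalars "\<lambda>c. scaleC c (1::'u::{complex_star_algebra, ring_1})"
  defines ceval = complex_scalars.eval
  by standard (simp_all add: scaleC_add_left scaleC_mult_left scaleC_mult_right scaleC_scaleC scaleC_one
      mult.commute)

section \<open>Norm estimates for polynomials in unitary and self-adjoint elements\<close>

lemma norm_coeff_le:
  assumes "\<And>z. cmod z = 1 \<Longrightarrow> cmod (poly P z) \<le> K"
  shows "cmod (coeff P n) \<le> K"
proof -
  have "(deriv ^^ n) (poly P) = poly ((pderiv ^^ n) P)"
  proof (induction n)
    case (Suc n)
    then show ?case by (auto intro!: DERIV_imp_deriv poly_DERIV)
  qed simp
  then have "(deriv ^^ n) (poly P) 0 = fact n * coeff P n"
    by (simp add: poly_0_coeff_0 coeff_higher_pderiv pochhammer_fact)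
  moreover have "cmod ((deriv ^^ n) (poly P) 0) \<le> fact n * K / 1 ^ n"
    by (rule Cauchy_inequality)
      (auto intro!: assms continuous_intros exI[of _ "poly (pderiv P) _"] DERIV_subset[OF poly_DERIV]
        simp: holomorphic_on_def field_differentiable_def)
  ultimately show ?thesis by (simp add: norm_mult)
qed

text \<open>The C*-identity is used for \<open>x * x\<close> and again for the self-adjoint element
  \<open>star x * x\<close>; normality rearranges the four factors in between.\<close>

lemma norm_square_normal:
  fixes x :: "'a::cstar_algebra"
  assumes "star x * x = x * star x"
  shows "norm (x * x) = (norm x)\<^sup>2"
proof -
  have "(norm (x * x))\<^sup>2 = norm (star x * (star x * x) * x)"
    by (simp add: cstar_identity[symmetric] star_mult mult.assoc)
  also have "\<dots> = norm (star (star x * x) * (star x * x))"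
    by (simp add: star_mult star_star) (metis assms mult.assoc)
  also have "\<dots> = ((norm x)\<^sup>2)\<^sup>2"
    by (simp only: cstar_identity)
  finally show ?thesis by (rule power2_eq_imp_eq) simp_all
qed

text \<open>Repeated squaring; this takes the place of the spectral radius formula.\<close>

lemma norm_power_normal:
  fixes x :: "'a::{cstar_algebra, real_normed_algebra_1}"
  assumes "star x * x = x * star x"
  shows "norm (x ^ (2 ^ n)) = norm x ^ (2 ^ n)"
proof (induction n)
  case (Suc n)
  have "star x ^ k * x = x * star x ^ k" for k
    by (rule power_commuting_commutes) (rule assms)
  then have "x ^ k * star x ^ k = star x ^ k * x ^ k" for k
    by (intro power_commuting_commutes) simp
  then have "star (x ^ (2 ^ n)) * x ^ (2 ^ n) = x ^ (2 ^ n) * star (x ^ (2 ^ n))"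
    by (simp add: star_power)
  from norm_square_normal[OF this] show ?case
    by (simp add: Suc power_add[symmetric] mult_2 power_mult[symmetric] power2_eq_square)
qed simp

text \<open>Cauchy's estimate bounds each coefficient of \<open>P ^ m\<close> by the
  \<open>m\<close>-th power of a bound of \<open>P\<close> on the circle, and there are at most
  \<open>m * degree P + 1\<close> coefficients. As \<open>ceval P u\<close> is normal, its norm is
  multiplicative for \<open>m = 2 ^ n\<close>, so a norm above \<open>K\<close> would force
  exponential growth below a linear bound.\<close>

lemma norm_unitary_eval_le:
  fixes u :: "'a::{cstar_algebra, real_normed_algebra_1}"
  assumes u: "star u * u = 1" "u * star u = 1"
    and K: "\<And>z. cmod z = 1 \<Longrightarrow> cmod (poly P z) \<le> K"
  shows "norm (ceval P u) \<le> K"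
proof (rule ccontr)
  assume "\<not> norm (ceval P u) \<le> K"
  then have less: "K < norm (ceval P u)" by simp
  have K0: "K \<ge> 0" using order.trans[OF norm_ge_zero K[of 1]] by simp
  \<comment> \<open>\<open>K\<close> may be 0; the midpoint is a strictly positive bound by which
    one can divide.\<close>
  define K' where "K' = (K + norm (ceval P u)) / 2"
  have K': "K' > 0" "K \<le> K'" "K' < norm (ceval P u)"
    using K0 less by (simp_all add: K'_def)
  have "norm u = 1"
    using cstar_identity[of u] by (simp add: u power2_eq_1_iff) (smt (verit) norm_ge_zero)
  then have norm_u: "norm (u ^ i) \<le> 1" for i
    using norm_power_ineq[of u i] by simp
  define x where "x = ceval P u"
  have "star u * x = x * star u"
    unfolding x_def by (rule complex_scalars.eval_intertwine) (simp add: u)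
  then have "star (star u * x) = star (x * star u)" by simp
  then have "star x * u = u * star x" by (simp add: star_mult star_star)
  then have normal: "star x * x = x * star x"
    unfolding x_def by (rule complex_scalars.eval_intertwine)
  define r where "r = norm x / K'"
  have r: "r > 1" using K' by (simp add: r_def x_def)
  have bound: "r ^ m \<le> real (m * degree P + 1)" if "m = 2 ^ n" for m n :: nat
  proof -
    have "norm x ^ m = norm (ceval (P ^ m) u)"
      by (simp add: complex_scalars.eval_power norm_power_normal normal that flip: x_def)
    also have "\<dots> \<le> (\<Sum>i\<le>degree (P ^ m). K' ^ m)"
      unfolding complex_scalars.eval_def
    proof (rule sum_norm_le)
      fix i
      have "cmod (poly (P ^ m) z) \<le> K' ^ m" if "cmod z = 1" for z
        using power_mono[of "cmod (poly P z)" K' m] K[OF that] K'(2)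
        by (simp add: poly_power norm_power)
      then have "cmod (coeff (P ^ m) i) \<le> K' ^ m" by (rule norm_coeff_le)
      then show "norm (scaleC (coeff (P ^ m) i) 1 * u ^ i) \<le> K' ^ m"
        using mult_mono[OF _ norm_u, of "cmod (coeff (P ^ m) i)" "K' ^ m" i] K'
        by (simp add: scaleC_mult_left norm_scaleC)
    qed
    also have "\<dots> = real (degree (P ^ m) + 1) * K' ^ m" by simp
    also have "\<dots> \<le> real (m * degree P + 1) * K' ^ m"
      using degree_power_le[of P m] K' by (intro mult_right_mono) (simp_all add: mult.commute flip: of_nat_mult)
    finally show ?thesis using K' by (simp add: r_def power_divide field_simps)
  qed
  have "LIM n sequentially. r ^ n / (real n + 1) :> at_top"
    using r by real_asymp
  then have "eventually (\<lambda>n. r ^ n / (real n + 1) > real (degree P + 1)) sequentially"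
    by (auto simp: filterlim_at_top_dense)
  then obtain N where N: "\<And>n. n \<ge> N \<Longrightarrow> r ^ n / (real n + 1) > real (degree P + 1)"
    by (auto simp: eventually_sequentially)
  define m :: nat where "m = 2 ^ N"
  have "m \<ge> N" using less_exp[of N] by (simp add: m_def)
  then have "real (degree P + 1) * (real m + 1) < r ^ m"
    using N[of m] by (simp add: pos_less_divide_eq add.commute del: of_nat_add)
  then show False
    using bound[OF m_def] by (simp add: algebra_simps)
qed

section \<open>The binomial series of \<open>(1 - x) ^ (1/2)\<close>\<close>

definition sqrt_coeff :: "nat \<Rightarrow> real"
  where "sqrt_coeff k = (1/2 gchoose k) * (-1) ^ k"

lemma sqrt_coeff_altdef: "sqrt_coeff k = pochhammer (-1/2) k / fact k"
proof -
  have "(-1) ^ k * ((-1) ^ k * c) = (c::real)" for c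
    by (simp flip: power_add mult.assoc)
  then show ?thesis
    by (simp add: sqrt_coeff_def gbinomial_pochhammer mult.commute)
qed

lemma sqrt_coeff_0 [simp]: "sqrt_coeff 0 = 1"
  by (simp add: sqrt_coeff_def)

lemma sqrt_coeff_nonpos: "sqrt_coeff (Suc k) \<le> 0"
  by (simp add: sqrt_coeff_altdef pochhammer_rec divide_nonpos_nonneg pochhammer_nonneg)

text \<open>All coefficients after the first are nonpositive, while the partial sums equal
  \<open>pochhammer (1/2) n / fact n\<close> and stay nonnegative; hence the tail has absolute sum
  at most 1. Convergence on the boundary of the disc admits contractions of norm exactly 1.\<close>

lemma summable_sqrt_coeff: "summable (\<lambda>k. \<bar>sqrt_coeff k\<bar>)"
proof -
  have "(\<Sum>k<n. \<bar>sqrt_coeff (Suc k)\<bar>) \<le> 1" for n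
  proof -
    have "(\<Sum>k\<le>n. sqrt_coeff k) = (-1) ^ n * (- 1/2 gchoose n)"
      unfolding sqrt_coeff_def using gbinomial_sum_lower_neg[of "1/2" n] by simp
    also have "\<dots> = pochhammer (1/2) n / fact n"
      by (simp add: gbinomial_pochhammer flip: mult.assoc power_add)
    also have "\<dots> \<ge> 0" by (simp add: pochhammer_nonneg)
    finally show ?thesis
      by (simp add: sqrt_coeff_nonpos sum_negf sum.atMost_shift)
  qed
  then have "summable (\<lambda>k. \<bar>sqrt_coeff (Suc k)\<bar>)"
    by (intro summableI_nonneg_bounded[where x = 1]) auto
  then show ?thesis by (subst (asm) summable_Suc_iff)
qed

text \<open>The Vandermonde convolution says that the square of the series is
  \<open>1 - x\<close>.\<close>

lemma sqrt_coeff_convolution: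
  "(\<Sum>k\<le>n. sqrt_coeff k * sqrt_coeff (n - k)) = (if n = 0 then 1 else if n = 1 then -1 else 0)"
proof -
  have "(\<Sum>k\<le>n. sqrt_coeff k * sqrt_coeff (n - k))
      = (\<Sum>k\<le>n. (-1) ^ n * ((1/2 gchoose k) * (1/2 gchoose (n - k))))"
    by (rule sum.cong) (auto simp: sqrt_coeff_def simp flip: power_add)
  also have "\<dots> = (-1) ^ n * (1 gchoose n)"
    using gbinomial_Vandermonde[of "1/2::real" "1/2" n]
    by (simp add: atLeast0AtMost flip: sum_distrib_left)
  also have "(1 gchoose n) = real (1 choose n)"
    by (simp add: binomial_gbinomial)
  finally show ?thesis
    by (cases n; cases "n - 1") auto
qed

text \<open>The product of partial sums runs over a square of indices, the Cauchy product over a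
  triangle; the difference is dominated by the same difference for the absolutely convergent scalar
  series. The sequence \<open>m\<close> is arbitrary and bounded so that it can be both the powers
  of an element and the entries of powers of an operator on tuples.\<close>

lemma sqrt_series_square:
  fixes m :: "nat \<Rightarrow> 'b::banach"
  assumes m: "\<And>k. norm (m k) \<le> K"
  shows "(\<lambda>N. \<Sum>k<N. \<Sum>l<N. scaleR (sqrt_coeff k * sqrt_coeff l) (m (k + l)))
    \<longlonglongrightarrow> m 0 - m 1"
proof -
  define a where "a k = \<bar>sqrt_coeff k\<bar>" for k
  define f where "f = (\<lambda>(k, l). scaleR (sqrt_coeff k * sqrt_coeff l) (m (k + l)))"
  define sq where "sq N = {..<N} \<times> {..<N::nat}" for N
  define tr where "tr N = {(k, l). k + l < (N::nat)}" for N
  have sub: "tr N \<subseteq> sq N" and fin: "finite (sq N)" for N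
    by (auto simp: tr_def sq_def)
  have "(\<lambda>N. (\<Sum>k<N. a k) * (\<Sum>k<N. a k)) \<longlonglongrightarrow> (\<Sum>k. a k) * (\<Sum>k. a k)"
    using summable_sqrt_coeff by (intro tendsto_mult summable_LIMSEQ) (simp_all add: a_def)
  moreover have "(\<lambda>N. \<Sum>n<N. \<Sum>k\<le>n. a k * a (n - k)) \<longlonglongrightarrow> (\<Sum>k. a k) * (\<Sum>k. a k)"
    using Cauchy_product_sums[of a a] summable_sqrt_coeff by (simp add: sums_def a_def)
  ultimately have "(\<lambda>N. (\<Sum>k<N. a k) * (\<Sum>k<N. a k) - (\<Sum>n<N. \<Sum>k\<le>n. a k * a (n - k))) \<longlonglongrightarrow> 0"
    using tendsto_diff by fastforce
  moreover have "(\<Sum>k<N. a k) * (\<Sum>k<N. a k) - (\<Sum>n<N. \<Sum>k\<le>n. a k * a (n - k))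
     = (\<Sum>(k, l)\<in>sq N - tr N. a k * a l)" for N
    using sum.subset_diff[OF sub fin, of "\<lambda>(k, l). a k * a l" N]
      sum.triangle_reindex[of "\<lambda>k l. a k * a l" N]
    by (simp add: sum_product sum.cartesian_product sq_def tr_def)
  ultimately have lim: "(\<lambda>N. K * (\<Sum>(k, l)\<in>sq N - tr N. a k * a l)) \<longlonglongrightarrow> 0"
    using tendsto_mult_right_zero by fastforce
  have "norm (sum f (sq N - tr N)) \<le> K * (\<Sum>(k, l)\<in>sq N - tr N. a k * a l)" for N
    unfolding sum_distrib_left
  proof (rule sum_norm_le, clarify)
    fix k l
    show "norm (f (k, l)) \<le> K * (a k * a l)"
      using mult_right_mono[OF m[of "k + l"], of "a k * a l"]
      by (simp add: f_def a_def abs_mult mult.commute)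
  qed
  then have "(\<lambda>N. sum f (sq N - tr N)) \<longlonglongrightarrow> 0"
    by (intro Lim_null_comparison[OF _ lim] always_eventually allI)
  moreover have "(\<lambda>N. sum f (tr N)) \<longlonglongrightarrow> m 0 - m 1"
  proof (rule tendsto_eventually)
    have "sum f (tr N) = m 0 - m 1" if "N \<ge> 2" for N
    proof -
      have "sum f (tr N) = (\<Sum>n<N. \<Sum>k\<le>n. scaleR (sqrt_coeff k * sqrt_coeff (n - k)) (m n))"
        unfolding tr_def f_def by (subst sum.triangle_reindex) simp
      also have "\<dots> = (\<Sum>n<N. scaleR (if n = 0 then 1 else if n = 1 then -1 else 0) (m n))"
        by (simp only: sqrt_coeff_convolution flip: scaleR_sum_left)
      also have "\<dots> = (\<Sum>n\<in>{0, 1}. scaleR (if n = 0 then 1 else if n = 1 then -1 else 0) (m n))"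
        using that by (intro sum.mono_neutral_right) auto
      finally show ?thesis by simp
    qed
    then show "\<forall>\<^sub>F N in sequentially. sum f (tr N) = m 0 - m 1"
      unfolding eventually_sequentially by blast
  qed
  ultimately have "(\<lambda>N. sum f (sq N - tr N) + sum f (tr N)) \<longlonglongrightarrow> 0 + (m 0 - m 1)"
    by (rule tendsto_add)
  moreover have "sum f (sq N - tr N) + sum f (tr N) =
    (\<Sum>k<N. \<Sum>l<N. scaleR (sqrt_coeff k * sqrt_coeff l) (m (k + l)))" for N
    using sum.subset_diff[OF sub fin, of f N] by (simp add: sq_def sum.cartesian_product f_def)
  ultimately show ?thesis by simp
qed

lemma sqrt_one_minus_square:
  fixes h :: "'a::{cstar_algebra, real_normed_algebra_1}"
  assumes h: "star h = h" "norm h \<le> 1"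
  obtains r where "star r = r" "r * h = h * r" "r * r = 1 - h * h"
proof -
  define q where "q = h * h"
  define S where "S N = (\<Sum>k<N. scaleR (sqrt_coeff k) (q ^ k))" for N
  have "norm q \<le> 1"
    using norm_mult_ineq[of h h] h(2) mult_mono[OF h(2) h(2)] by (simp add: q_def)
  then have q: "norm (q ^ k) \<le> 1" for k
    using norm_power_ineq[of q k] power_le_one[of "norm q" k] by simp
  have "summable (\<lambda>k. scaleR (sqrt_coeff k) (q ^ k))"
    using q by (intro summable_norm_cancel[OF summable_comparison_test'[OF summable_sqrt_coeff]])
      (simp add: mult_left_le)
  then obtain r where r: "S \<longlonglongrightarrow> r"
    unfolding S_def using summable_LIMSEQ by blast
  show ?thesis
  proof
    have "star (S N) = S N" for N
      by (simp add: S_def star_sum star_scaleR star_power q_def star_mult h)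
    then show "star r = r"
      using tendsto_star[OF r] r LIMSEQ_unique by simp
    have "q ^ k * h = h * q ^ k" for k
      by (rule power_commuting_commutes) (simp add: q_def mult.assoc)
    then have "S N * h = h * S N" for N
      by (simp add: S_def sum_distrib_left sum_distrib_right)
    then show "r * h = h * r"
      using tendsto_mult[OF r tendsto_const[of h]] tendsto_mult[OF tendsto_const[of h] r]
        LIMSEQ_unique by simp
    have "S N * S N = (\<Sum>k<N. \<Sum>l<N. scaleR (sqrt_coeff k * sqrt_coeff l) (q ^ (k + l)))" for N
      by (simp add: S_def sum_product power_add mult.commute)
    then have "(\<lambda>N. S N * S N) \<longlonglongrightarrow> q ^ 0 - q ^ 1"
      using sqrt_series_square[of "\<lambda>k. q ^ k", OF q] by simp
    then show "r * r = 1 - h * h"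
      using tendsto_mult[OF r r] LIMSEQ_unique by (fastforce simp: q_def)
  qed
qed

text \<open>
  With the unitary \<open>u = h + i (1 - h\<^sup>2)\<^sup>1\<^sup>/\<^sup>2\<close> one has \<open>p(h) = u\<^sup>-\<^sup>d P(u)\<close> for the
  polynomial \<open>P(z) = z\<^sup>d p((z + 1/z)/2)\<close>.
\<close>

lemma norm_peval_le_aux:
  fixes h :: "'a::{cstar_algebra, real_normed_algebra_1}"
  assumes h: "star h = h" "norm h \<le> 1" and K: "\<And>t. \<bar>t\<bar> \<le> 1 \<Longrightarrow> \<bar>poly p t\<bar> \<le> K"
  shows "norm (peval p h) \<le> K"
proof -
  obtain r where r: "star r = r" "r * h = h * r" "r * r = 1 - h * h"
    using sqrt_one_minus_square[OF h] .
  define u where "u = h + scaleC \<i> r"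
  have star_u: "star u = h - scaleC \<i> r"
    by (simp add: u_def star_add star_scaleC h r complex_vector.scale_minus_left)
  have u: "star u * u = 1" "u * star u = 1"
    unfolding star_u unfolding u_def
    by (simp_all add: algebra_simps r scaleC_mult_left scaleC_mult_right scaleC_scaleC
        complex_vector.scale_minus_left scaleC_one)
  define d where "d = degree p"
  \<comment> \<open>\<open>[:1/2, 0, 1/2:]\<close> is \<open>z (z + 1/z) / 2\<close>: each power of
    the argument of \<open>p\<close> uses up one of the \<open>d\<close> factors
    \<open>z\<close>.\<close>
  define P where "P = (\<Sum>i\<le>d. monom (complex_of_real (coeff p i)) (d - i) * [:1/2, 0, 1/2:] ^ i)"
  have uh: "u * h = h * u"
    by (simp add: u_def algebra_simps scaleC_mult_left scaleC_mult_right r)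
  have "u ^ k * h = h * u ^ k" for k
    by (rule power_commuting_commutes) (rule uh)
  then have uh_power: "(u * h) ^ k = u ^ k * h ^ k" for k
    by (induction k) (simp_all add: mult.assoc, metis mult.assoc)
  have "scaleC 2 h = u + star u"
    using scaleC_add_left[of 1 1 h] by (simp add: star_u) (simp add: u_def scaleC_one)
  then have "h = scaleC (1/2) (u + star u)"
    by (metis (no_types, lifting) divide_self_if mult.commute scaleC_one scaleC_scaleC times_divide_eq_right
        mult.right_neutral zero_neq_numeral)
  then have "u * h = scaleC (1/2) (u * u + 1)"
    by (metis (no_types) distrib_left scaleC_mult_right u(2))
  then have "ceval [:1/2, 0, 1/2:] u = u * h"
    by (simp add: complex_scalars.eval_pCons scaleC_add_right scaleC_mult_right add.commute)
  then have "ceval P u = (\<Sum>i\<le>d. scaleC (complex_of_real (coeff p i)) (u ^ (d - i) * (u * h) ^ i))"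
    by (simp add: P_def complex_scalars.eval_sum complex_scalars.eval_mult complex_scalars.eval_power
        complex_scalars.eval_monom scaleC_mult_left)
  also have "\<dots> = (\<Sum>i\<le>d. u ^ d * (of_real (coeff p i) * h ^ i))"
  proof (rule sum.cong)
    fix i assume "i \<in> {..d}"
    then have "u ^ (d - i) * (u * h) ^ i = u ^ d * h ^ i"
      by (simp add: uh_power flip: mult.assoc power_add)
    then show "scaleC (complex_of_real (coeff p i)) (u ^ (d - i) * (u * h) ^ i)
        = u ^ d * (of_real (coeff p i) * h ^ i)"
      by (simp add: of_real_def scaleR_eq_scaleC scaleC_mult_left scaleC_mult_right)
  qed simp
  also have "\<dots> = u ^ d * peval p h"
    by (simp add: real_scalars.eval_def d_def sum_distrib_left)
  finally have "star u ^ d * ceval P u = (star u ^ d * u ^ d) * peval p h"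
    by (simp add: mult.assoc)
  also have "star u ^ d * u ^ d = 1"
    by (metis left_right_inverse_power u(1))
  finally have "peval p h = star u ^ d * ceval P u" by simp
  moreover have "norm u = 1"
    using cstar_identity[of u] by (simp add: u power2_eq_1_iff) (smt (verit) norm_ge_zero)
  then have "norm (star u ^ d) \<le> 1"
    using norm_power_ineq[of "star u" d] by simp
  then have "norm (star u ^ d * ceval P u) \<le> norm (ceval P u)"
    using norm_mult_ineq[of "star u ^ d" "ceval P u"] mult_right_mono[of _ 1 "norm (ceval P u)"]
    by (metis mult_1 norm_ge_zero order.trans)
  \<comment> \<open>On the unit circle \<open>(z + 1/z) / 2\<close> is \<open>Re z\<close>, which
    lies in the interval where \<open>p\<close> is bounded by \<open>K\<close>.\<close>
  moreover have "norm (ceval P u) \<le> K"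
  proof (rule norm_unitary_eval_le[OF u])
    fix z assume z: "cmod z = 1"
    have "z * cnj z = 1" using z by (simp add: complex_norm_square[symmetric])
    moreover have "of_real (Re z) = (z + cnj z) / 2" by (simp add: complex_add_cnj)
    ultimately have *: "1/2 + z * z / 2 = z * of_real (Re z)"
      by (simp add: distrib_left add_divide_distrib)
    have "poly P z = (\<Sum>i\<le>d. of_real (coeff p i) * z ^ (d - i) * (z * of_real (Re z)) ^ i)"
      by (simp add: P_def poly_sum poly_mult poly_power poly_monom * del: of_real_mult)
    also have "\<dots> = (\<Sum>i\<le>d. z ^ d * of_real (coeff p i * Re z ^ i))"
      by (intro sum.cong) (auto simp: power_mult_distrib simp flip: power_add)
    also have "\<dots> = z ^ d * of_real (poly p (Re z))"
      by (simp add: poly_altdef d_def sum_distrib_left)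
    finally show "cmod (poly P z) \<le> K"
      using K[of "Re z"] abs_Re_le_cmod[of z] z by (simp add: norm_mult norm_power)
  qed
  ultimately show ?thesis by (metis order.trans)
qed

lemma norm_peval_le:
  fixes h :: "'a::{cstar_algebra, real_normed_algebra_1}"
  assumes h: "star h = h" and K: "\<And>t. \<bar>t\<bar> \<le> norm h \<Longrightarrow> \<bar>poly p t\<bar> \<le> K"
  shows "norm (peval p h) \<le> K"
proof (cases "h = 0")
  case True
  have "peval p (0::'a) = of_real (poly p 0)"
    by (induction p) (simp_all add: real_scalars.eval_pCons)
  then have "norm (peval p h) = \<bar>poly p 0\<bar>" using True by (simp only: norm_of_real)
  with K[of 0] show ?thesis by simp
next
  case False
  define h' where "h' = scaleR (inverse (norm h)) h"
  define q where "q = [:0, norm h:]"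
  have "peval q h' = h"
    using False by (simp add: q_def h'_def real_scalars.eval_pCons of_real_def)
  then have "peval p h = peval (pcompose p q) h'"
    by (simp add: real_scalars.eval_pcompose)
  moreover have "norm (peval (pcompose p q) h') \<le> K"
  proof (rule norm_peval_le_aux)
    show "star h' = h'" "norm h' \<le> 1" using False by (simp_all add: h'_def star_scaleR h)
    fix t :: real assume "\<bar>t\<bar> \<le> 1"
    then show "\<bar>poly (pcompose p q) t\<bar> \<le> K"
      using K[of "t * norm h"] by (simp add: poly_pcompose q_def abs_mult mult_left_le_one_le)
  qed
  ultimately show ?thesis by simp
qed

section \<open>Continuous functions of a self-adjoint element\<close>

lemma polynomial_approximation:
  fixes f :: "real \<Rightarrow> real"
  assumes "continuous_on UNIV f"
  obtains p where "uniform_limit {-L..L} (\<lambda>n. poly (p n)) f sequentially"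
proof -
  have "\<exists>p. \<forall>t\<in>{-L..L}. \<bar>poly p t - f t\<bar> < 1 / real (Suc n)" for n
  proof -
    obtain g where g: "real_polynomial_function g"
      "\<And>t. t \<in> {-L..L} \<Longrightarrow> \<bar>f t - g t\<bar> < 1 / real (Suc n)"
      using Stone_Weierstrass_real_polynomial_function[of "{-L..L}" f "1 / real (Suc n)"]
        continuous_on_subset[OF assms] by (metis compact_Icc of_nat_0_less_iff subset_UNIV zero_less_Suc zero_less_divide_1_iff)
    obtain a d where "g = (\<lambda>x. \<Sum>i\<le>d. a i * x ^ i)"
      using g(1) real_polynomial_function_iff_sum by blast
    then have "g t = poly (\<Sum>i\<le>d. monom (a i) i) t" for t
      by (simp add: poly_sum poly_monom)
    with g(2) have "\<forall>t\<in>{-L..L}. \<bar>poly (\<Sum>i\<le>d. monom (a i) i) t - f t\<bar> < 1 / real (Suc n)"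
      by (metis abs_minus_commute)
    then show ?thesis by blast
  qed
  then obtain p where p: "\<And>n t. t \<in> {-L..L} \<Longrightarrow> \<bar>poly (p n) t - f t\<bar> < 1 / real (Suc n)"
    by metis
  have "uniform_limit {-L..L} (\<lambda>n. poly (p n)) f sequentially"
    unfolding uniform_limit_sequentially_iff dist_real_def
  proof (intro allI impI)
    fix e :: real assume "e > 0"
    then obtain N where "1 / real (Suc N) < e" using nat_approx_posE by blast
    then have "1 / real (Suc n) < e" if "n \<ge> N" for n
      using that frac_le[of 1 1 "real (Suc N)" "real (Suc n)"] by linarith
    then show "\<exists>N. \<forall>n\<ge>N. \<forall>t\<in>{-L..L}. \<bar>poly (p n) t - f t\<bar> < e"
      using p by (metis order.strict_trans)
  qed
  then show ?thesis by (rule that)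
qed

text \<open>The extension of \<open>peval\<close> by continuity, as the common limit along all
  approximating sequences of polynomials. The interval contains the spectrum without being equal to
  it, so only its endpoints need to be known; functions are total so that sums, products and
  compositions carry no side conditions on domains.\<close>

definition fc :: "'a::{cstar_algebra, real_normed_algebra_1} \<Rightarrow> (real \<Rightarrow> real) \<Rightarrow> 'a"
  where "fc h f = (THE y. \<forall>p. uniform_limit {- norm h..norm h} (\<lambda>n. poly (p n)) f sequentially
    \<longrightarrow> (\<lambda>n. peval (p n) h) \<longlonglongrightarrow> y)"

context
  fixes h :: "'a::{cstar_algebra, real_normed_algebra_1}"
  assumes h: "star h = h"
begin

lemma peval_tendsto_0:
  assumes "uniform_limit {- norm h..norm h} (\<lambda>n. poly (p n)) (\<lambda>_. 0) F"
  shows "((\<lambda>n. peval (p n) h) \<longlongrightarrow> 0) F"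
proof (rule tendstoI)
  fix e :: real assume e: "e > 0"
  then have "\<forall>\<^sub>F n in F. \<forall>t\<in>{- norm h..norm h}. dist (poly (p n) t) 0 < e / 2"
    using assms unfolding uniform_limit_iff by (meson half_gt_zero)
  then show "\<forall>\<^sub>F n in F. dist (peval (p n) h) 0 < e"
  proof eventually_elim
    case (elim n)
    then have "norm (peval (p n) h) \<le> e / 2"
      by (intro norm_peval_le[OF h]) (auto simp: dist_real_def abs_le_iff intro: less_imp_le)
    with e show ?case by simp
  qed
qed

text \<open>\<open>norm_peval_le\<close> turns uniform closeness of polynomials on the interval into
  closeness of their values, which gives both existence of the limit and its independence of the
  sequence.\<close>

lemma peval_tendsto_fc:
  assumes f: "continuous_on UNIV f"
    and p: "uniform_limit {- norm h..norm h} (\<lambda>n. poly (p n)) f sequentially"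
  shows "(\<lambda>n. peval (p n) h) \<longlonglongrightarrow> fc h f"
proof -
  obtain q where q: "uniform_limit {- norm h..norm h} (\<lambda>n. poly (q n)) f sequentially"
    using polynomial_approximation[OF f] .
  have "Cauchy (\<lambda>n. peval (q n) h)"
    unfolding Cauchy_iff
  proof (intro allI impI)
    fix e :: real assume e: "e > 0"
    then obtain N where N: "\<And>n t. n \<ge> N \<Longrightarrow> t \<in> {- norm h..norm h} \<Longrightarrow> dist (poly (q n) t) (f t) < e / 4"
      using q unfolding uniform_limit_sequentially_iff by (metis divide_pos_pos zero_less_numeral)
    have "norm (peval (q m) h - peval (q n) h) < e" if "m \<ge> N" "n \<ge> N" for m n
    proof -
      have "norm (peval (q m - q n) h) \<le> e / 2"
      proof (rule norm_peval_le[OF h])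
        fix t assume "\<bar>t\<bar> \<le> norm h"
        then have "t \<in> {- norm h..norm h}" by auto
        then show "\<bar>poly (q m - q n) t\<bar> \<le> e / 2"
          using N[OF that(1), of t] N[OF that(2), of t] unfolding dist_real_def poly_diff by argo
      qed
      moreover have "peval (q m - q n) h = peval (q m) h - peval (q n) h"
        using real_scalars.eval_add[of "q m - q n" "q n" h] by simp
      ultimately show ?thesis using e by simp
    qed
    then show "\<exists>M. \<forall>m\<ge>M. \<forall>n\<ge>M. norm (peval (q m) h - peval (q n) h) < e" by blast
  qed
  then obtain y where y: "(\<lambda>n. peval (q n) h) \<longlonglongrightarrow> y"
    using Cauchy_convergent convergent_def by blast
  have all: "(\<lambda>n. peval (p n) h) \<longlonglongrightarrow> y"
    if p: "uniform_limit {- norm h..norm h} (\<lambda>n. poly (p n)) f sequentially" for p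
  proof -
    have "uniform_limit {- norm h..norm h} (\<lambda>n. poly (p n - q n)) (\<lambda>_. 0) sequentially"
      using uniform_limit_minus[OF p q] by (simp add: poly_diff[abs_def])
    from tendsto_add[OF peval_tendsto_0[OF this] y] show ?thesis
      by (simp flip: real_scalars.eval_add)
  qed
  moreover have "y' = y" if "\<forall>p. uniform_limit {- norm h..norm h} (\<lambda>n. poly (p n)) f sequentially
    \<longrightarrow> (\<lambda>n. peval (p n) h) \<longlonglongrightarrow> y'" for y'
    using that q y LIMSEQ_unique by blast
  ultimately have "fc h f = y"
    unfolding fc_def by (intro the_equality) blast+
  with all[OF p] show ?thesis by simp
qed

lemma fc_eqI:
  assumes "continuous_on UNIV f" "uniform_limit {- norm h..norm h} (\<lambda>n. poly (p n)) f sequentially"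
    and "(\<lambda>n. peval (p n) h) \<longlonglongrightarrow> y"
  shows "fc h f = y"
  using peval_tendsto_fc[OF assms(1,2)] assms(3) LIMSEQ_unique by blast

lemma fc_poly: "fc h (poly p) = peval p h"
  by (rule fc_eqI[where p = "\<lambda>_. p"])
    (auto intro!: continuous_intros simp: uniform_limit_iff)

lemma fc_id: "fc h (\<lambda>t. t) = h"
proof -
  have "poly [:0, 1:] = (\<lambda>t::real. t)" by auto
  then show ?thesis
    using fc_poly[of "[:0, 1:]"] by (simp add: real_scalars.eval_pCons)
qed

lemma fc_const: "fc h (\<lambda>t. c) = of_real c"
proof -
  have "poly [:c:] = (\<lambda>t::real. c)" by auto
  then show ?thesis
    using fc_poly[of "[:c:]"] by (simp add: real_scalars.eval_pCons)
qed

lemma fc_cong: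
  assumes "\<And>t. \<bar>t\<bar> \<le> norm h \<Longrightarrow> f t = g t"
  shows "fc h f = fc h g"
proof -
  have "uniform_limit {- norm h..norm h} p f sequentially \<longleftrightarrow>
    uniform_limit {- norm h..norm h} p g sequentially" for p
    by (rule uniform_limit_cong') (use assms in auto)
  then show ?thesis by (simp add: fc_def)
qed

lemma fc_add:
  assumes f: "continuous_on UNIV f" and g: "continuous_on UNIV g"
  shows "fc h (\<lambda>t. f t + g t) = fc h f + fc h g"
proof -
  obtain p q where p: "uniform_limit {- norm h..norm h} (\<lambda>n. poly (p n)) f sequentially"
    and q: "uniform_limit {- norm h..norm h} (\<lambda>n. poly (q n)) g sequentially"
    using polynomial_approximation[OF f] polynomial_approximation[OF g] by metis
  show ?thesis
    using uniform_limit_add[OF p q] tendsto_add[OF peval_tendsto_fc[OF f p] peval_tendsto_fc[OF g q]]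
    by (intro fc_eqI[where p = "\<lambda>n. p n + q n"] continuous_intros f g)
      (simp_all add: real_scalars.eval_add poly_add[abs_def])
qed

lemma fc_mult:
  assumes f: "continuous_on UNIV f" and g: "continuous_on UNIV g"
  shows "fc h (\<lambda>t. f t * g t) = fc h f * fc h g"
proof -
  obtain p q where p: "uniform_limit {- norm h..norm h} (\<lambda>n. poly (p n)) f sequentially"
    and q: "uniform_limit {- norm h..norm h} (\<lambda>n. poly (q n)) g sequentially"
    using polynomial_approximation[OF f] polynomial_approximation[OF g] by metis
  have "bounded (f ` {- norm h..norm h})" "bounded (g ` {- norm h..norm h})"
    by (intro compact_imp_bounded compact_continuous_image compact_Icc continuous_on_subset[OF f]
        continuous_on_subset[OF g] subset_UNIV)+
  from uniform_lim_mult[OF p q this] show ?thesis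
    using tendsto_mult[OF peval_tendsto_fc[OF f p] peval_tendsto_fc[OF g q]]
    by (intro fc_eqI[where p = "\<lambda>n. p n * q n"] continuous_intros f g)
      (simp_all add: real_scalars.eval_mult poly_mult[abs_def])
qed

lemma fc_minus: "continuous_on UNIV f \<Longrightarrow> fc h (\<lambda>t. - f t) = - fc h f"
  using fc_mult[of "\<lambda>_. -1" f] by (simp add: fc_const)

lemma fc_diff:
  "continuous_on UNIV f \<Longrightarrow> continuous_on UNIV g \<Longrightarrow> fc h (\<lambda>t. f t - g t) = fc h f - fc h g"
  using fc_add[of f "\<lambda>t. - g t"] by (simp add: fc_minus continuous_on_minus)

lemma star_peval: "star (peval p h) = peval p h"
  by (induction p) (simp_all add: real_scalars.eval_pCons star_add star_mult h of_real_def star_scaleR,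
    metis real_scalars.eval_intertwine)

lemma norm_fc_le:
  assumes f: "continuous_on UNIV f" and K: "\<And>t. \<bar>t\<bar> \<le> norm h \<Longrightarrow> \<bar>f t\<bar> \<le> K"
  shows "norm (fc h f) \<le> K"
proof (rule field_le_epsilon)
  fix e :: real assume e: "e > 0"
  obtain p where p: "uniform_limit {- norm h..norm h} (\<lambda>n. poly (p n)) f sequentially"
    using polynomial_approximation[OF f] .
  have "\<forall>\<^sub>F n in sequentially. \<forall>t\<in>{- norm h..norm h}. dist (poly (p n) t) (f t) < e"
    using p e unfolding uniform_limit_iff by blast
  then have "\<forall>\<^sub>F n in sequentially. norm (peval (p n) h) \<le> K + e"
  proof eventually_elim
    case (elim n)
    show ?case
    proof (rule norm_peval_le[OF h])
      fix t assume "\<bar>t\<bar> \<le> norm h"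
      then show "\<bar>poly (p n) t\<bar> \<le> K + e"
        using K[of t] elim[rule_format, of t] by (simp add: dist_real_def abs_le_iff abs_less_iff)
    qed
  qed
  then show "norm (fc h f) \<le> K + e"
    by (intro tendsto_upperbound[OF tendsto_norm[OF peval_tendsto_fc[OF f p]]]) auto
qed

lemma star_fc: "continuous_on UNIV f \<Longrightarrow> star (fc h f) = fc h f"
proof -
  assume f: "continuous_on UNIV f"
  obtain p where p: "uniform_limit {- norm h..norm h} (\<lambda>n. poly (p n)) f sequentially"
    using polynomial_approximation[OF f] .
  show ?thesis
    using tendsto_star[OF peval_tendsto_fc[OF f p]] peval_tendsto_fc[OF f p] LIMSEQ_unique
    by (fastforce simp: star_peval)
qed

end

lemma fc_peval:
  fixes h :: "'a::{cstar_algebra, real_normed_algebra_1}"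
  assumes h: "star h = h" and f: "continuous_on UNIV f"
  shows "fc (peval p h) f = fc h (\<lambda>t. f (poly p t))"
proof -
  have "bounded (poly p ` {- norm h..norm h})"
    by (intro compact_imp_bounded compact_continuous_image compact_Icc continuous_intros)
  then obtain B where B: "\<And>t. t \<in> {- norm h..norm h} \<Longrightarrow> \<bar>poly p t\<bar> \<le> B"
    unfolding bounded_iff by (metis image_eqI real_norm_def)
  \<comment> \<open>One approximating sequence has to serve both sides: on the range of
    \<open>p\<close> over the interval of \<open>h\<close>, and on the interval that belongs to
    \<open>peval p h\<close>.\<close>
  define L where "L = max B (norm (peval p h))"
  obtain q where q: "uniform_limit {- L..L} (\<lambda>n. poly (q n)) f sequentially"
    using polynomial_approximation[OF f] .
  have 1: "(\<lambda>n. peval (q n) (peval p h)) \<longlonglongrightarrow> fc (peval p h) f"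
  proof -
    have "uniform_limit {- norm (peval p h)..norm (peval p h)} (\<lambda>n. poly (q n)) f sequentially"
      by (rule uniform_limit_on_subset[OF q]) (auto simp: L_def)
    then show ?thesis
      using f star_peval[OF h] by (intro peval_tendsto_fc) 
  qed
  have "uniform_limit {- norm h..norm h} (\<lambda>n. poly (pcompose (q n) p)) (\<lambda>t. f (poly p t)) sequentially"
    unfolding uniform_limit_sequentially_iff
  proof (intro allI impI)
    fix e :: real assume "e > 0"
    then obtain N where N: "\<And>n t. n \<ge> N \<Longrightarrow> t \<in> {- L..L} \<Longrightarrow> dist (poly (q n) t) (f t) < e"
      using q unfolding uniform_limit_sequentially_iff by metis
    have "poly p t \<in> {- L..L}" if "t \<in> {- norm h..norm h}" for t
      using B[OF that] by (auto simp: L_def)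
    with N show "\<exists>N. \<forall>n\<ge>N. \<forall>t\<in>{- norm h..norm h}. dist (poly (pcompose (q n) p) t) (f (poly p t)) < e"
      by (metis poly_pcompose)
  qed
  from fc_eqI[OF h _ this] 1 show ?thesis
    using continuous_on_compose2[OF f, of UNIV "poly p"]
    by (simp add: real_scalars.eval_pcompose continuous_on_poly)
qed

text \<open>\<open>h\<close> and \<open>h'\<close> may have different norms, so the approximation is
  taken on an interval containing both; the identity for polynomials then passes to the
  limit.\<close>

lemma fc_intertwine:
  assumes h: "star h = h" "star h' = h'" and x: "x * h = h' * x" and f: "continuous_on UNIV f"
  shows "x * fc h f = fc h' f * x"
proof -
  define L where "L = max (norm h) (norm h')"
  obtain p where p: "uniform_limit {- L..L} (\<lambda>n. poly (p n)) f sequentially"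
    using polynomial_approximation[OF f] .
  have "(\<lambda>n. peval (p n) h) \<longlonglongrightarrow> fc h f" "(\<lambda>n. peval (p n) h') \<longlonglongrightarrow> fc h' f"
    by (intro peval_tendsto_fc h f uniform_limit_on_subset[OF p]; simp add: L_def)+
  then have "(\<lambda>n. x * peval (p n) h) \<longlonglongrightarrow> x * fc h f"
    "(\<lambda>n. peval (p n) h' * x) \<longlonglongrightarrow> fc h' f * x"
    by (auto intro!: tendsto_mult)
  then show ?thesis
    using LIMSEQ_unique by (simp add: real_scalars.eval_intertwine[OF x])
qed

section \<open>Positive elements\<close>

text \<open>A working form of positivity, shown below to agree with \<open>positive\<close>. Given
  \<open>a = k * k\<close>, a function \<open>f\<close> of \<open>a\<close> is the function
  \<open>f (t * t)\<close> of \<open>k\<close>; this replaces the knowledge that the spectrum of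
  \<open>a\<close> is nonnegative, which the symmetric interval of \<open>fc\<close> does not
  record.\<close>

definition sa_square :: "'a::{cstar_algebra, real_normed_algebra_1} \<Rightarrow> bool"
  where "sa_square a \<longleftrightarrow> (\<exists>k. star k = k \<and> a = k * k)"

lemma star_of_real [simp]: "star (of_real r :: 'a::{cstar_algebra, real_normed_algebra_1}) = of_real r"
  by (simp add: of_real_def star_scaleR)

lemma norm_square_sa: "star k = k \<Longrightarrow> norm (k * k) = (norm (k::'a::cstar_algebra))\<^sup>2"
  using cstar_identity[of k] by simp

lemma square_eq_0_sa: "star k = k \<Longrightarrow> k * k = 0 \<Longrightarrow> k = (0::'a::cstar_algebra)"
  using norm_square_sa[of k] by simp

lemma fc_square: "star h = h \<Longrightarrow> fc h (\<lambda>t. t * t) = h * h"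
  by (simp add: fc_mult fc_id continuous_intros)

lemma fc_of_square:
  assumes "star h = h" "continuous_on UNIV f"
  shows "fc (h * h) f = fc h (\<lambda>t. f (t * t))"
proof -
  have "peval [:0, 0, 1:] h = h * h"
    by (simp add: real_scalars.eval_pCons)
  then show ?thesis
    using fc_peval[OF assms, of "[:0, 0, 1:]"] by simp
qed

lemma fc_of_minus_square:
  assumes "star h = h" "continuous_on UNIV f"
  shows "fc (- (h * h)) f = fc h (\<lambda>t. f (- (t * t)))"
proof -
  have "peval [:0, 0, -1:] h = - (h * h)"
    by (simp add: real_scalars.eval_pCons)
  then show ?thesis
    using fc_peval[OF assms, of "[:0, 0, -1:]"] by simp
qed

lemma sa_square_star: "sa_square a \<Longrightarrow> star a = a"
  by (auto simp: sa_square_def star_mult)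

lemma sa_square_fc:
  assumes h: "star h = h" and f: "continuous_on UNIV f" and nonneg: "\<And>t. \<bar>t\<bar> \<le> norm h \<Longrightarrow> f t \<ge> 0"
  shows "sa_square (fc h f)"
proof -
  have r: "continuous_on UNIV (\<lambda>t. sqrt (f t))" by (intro continuous_intros f)
  have "fc h f = fc h (\<lambda>t. sqrt (f t) * sqrt (f t))"
    by (rule fc_cong[OF h]) (simp add: nonneg)
  also have "\<dots> = fc h (\<lambda>t. sqrt (f t)) * fc h (\<lambda>t. sqrt (f t))"
    by (rule fc_mult[OF h r r])
  finally show ?thesis
    unfolding sa_square_def using star_fc[OF h r] by blast
qed

lemma sa_square_imp_norm_le:
  assumes "sa_square a" "norm a \<le> t"
  shows "norm (of_real t - a) \<le> t"
proof -
  obtain k where k: "star k = k" "a = k * k"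
    using assms(1) by (auto simp: sa_square_def)
  have "fc k (\<lambda>x. t - x * x) = of_real t - a"
    using k by (simp add: fc_diff fc_const fc_square continuous_intros)
  moreover have "norm (fc k (\<lambda>x. t - x * x)) \<le> t"
  proof (rule norm_fc_le[OF k(1)])
    fix x assume "\<bar>x\<bar> \<le> norm k"
    then have "x * x \<le> norm k * norm k"
      by (metis abs_ge_zero abs_mult_self_eq mult_mono norm_ge_zero)
    also have "\<dots> \<le> t"
      using assms(2) norm_square_sa[OF k(1)] by (simp add: k(2) power2_eq_square)
    finally show "\<bar>t - x * x\<bar> \<le> t" using zero_le_square[of x] by linarith
  qed (intro continuous_intros)
  ultimately show ?thesis by simp
qed

text \<open>Put \<open>c = t - a\<close>; then \<open>a\<close> is the value at \<open>c\<close> of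
  a function that is nonnegative on the interval of \<open>c\<close>. With the converse this
  describes positivity by a norm inequality, from which sums and limits follow.\<close>

lemma norm_le_imp_sa_square:
  assumes a: "star a = a" and t: "norm (of_real t - a) \<le> t"
  shows "sa_square a"
proof -
  define c where "c = of_real t - a"
  have c: "star c = c" by (simp add: c_def star_diff a)
  have "fc c (\<lambda>x. t - x) = a"
    by (simp add: fc_diff fc_const fc_id c continuous_intros) (simp add: c_def)
  moreover have "sa_square (fc c (\<lambda>x. t - x))"
    using t by (intro sa_square_fc c continuous_intros) (simp add: c_def)
  ultimately show ?thesis by simp
qed

lemma sa_square_add:
  assumes "sa_square a" "sa_square b"
  shows "sa_square (a + b)"
proof (rule norm_le_imp_sa_square)
  show "star (a + b) = a + b"
    using assms by (simp add: star_add sa_square_star)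
  have "norm ((of_real (norm a) - a) + (of_real (norm b) - b)) \<le> norm a + norm b"
    using sa_square_imp_norm_le[OF assms(1) order.refl] sa_square_imp_norm_le[OF assms(2) order.refl]
    by (intro norm_triangle_le) simp
  then show "norm (of_real (norm a + norm b) - (a + b)) \<le> norm a + norm b"
    by (simp add: algebra_simps)
qed

text \<open>The positive part of \<open>a\<close> is \<open>a\<close> when computed from a root of
  \<open>a\<close>, and 0 when computed from a root of \<open>- a\<close>.\<close>

lemma sa_square_antisym:
  assumes "sa_square a" "sa_square (- a)"
  shows "a = 0"
proof -
  obtain k l where k: "star k = k" "a = k * k" and l: "star l = l" "- a = l * l"
    using assms by (auto simp: sa_square_def)
  have c: "continuous_on UNIV (\<lambda>t::real. max t 0)" by (intro continuous_intros)
  have "a = fc k (\<lambda>t. max (t * t) 0)"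
    using fc_square[OF k(1)] k(2) by (simp add: max_absorb1)
  also have "\<dots> = fc a (\<lambda>t. max t 0)"
    unfolding k(2) by (rule fc_of_square[OF k(1) c, symmetric])
  also have "a = - (l * l)" using l(2) by (simp flip: l(2))
  then have "fc a (\<lambda>t. max t 0) = fc l (\<lambda>t. max (- (t * t)) 0)"
    by (simp add: fc_of_minus_square[OF l(1) c])
  also have "\<dots> = fc l (\<lambda>t. 0)" by (rule fc_cong[OF l(1)]) simp
  also have "\<dots> = 0" by (simp add: fc_const l)
  finally show ?thesis .
qed

text \<open>Kaplansky's argument: otherwise \<open>d = b c\<^sub>-\<close> with \<open>c = b* b\<close> has \<open>d* d = -c\<^sub>-\<^sup>3\<close>.\<close>

lemma sa_square_star_mult:
  fixes b :: "'a::{cstar_algebra, real_normed_algebra_1}"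
  shows "sa_square (star b * b)"
proof -
  define c where "c = star b * b"
  have c: "star c = c" by (simp add: c_def star_mult star_star)
  define neg where "neg = fc c (\<lambda>t. max (- t) 0)"
  have neg: "star neg = neg"
    unfolding neg_def by (intro star_fc c continuous_intros)
  define d where "d = b * neg"
  define cube where "cube = fc c (\<lambda>t. max (- t) 0 ^ 3)"
  have "star d * d = neg * c * neg"
    by (simp add: d_def c_def star_mult neg mult.assoc)
  also have "\<dots> = fc c (\<lambda>t. (max (- t) 0 * t) * max (- t) 0)"
    unfolding neg_def by (simp add: fc_mult fc_id c continuous_intros)
  also have "\<dots> = fc c (\<lambda>t. - (max (- t) 0 ^ 3))"
    by (rule fc_cong[OF c]) (auto simp: max_def power3_eq_cube)
  also have "\<dots> = - cube"
    unfolding cube_def by (intro fc_minus c continuous_intros)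
  finally have dd: "star d * d = - cube" .
  have "sa_square cube"
    unfolding cube_def by (intro sa_square_fc c continuous_intros) simp
  then obtain m where m: "star m = m" "cube = m * m"
    by (auto simp: sa_square_def)
  define e where "e = d * star d"
  have e: "star e = e" by (simp add: e_def star_mult star_star)
  have cp: "continuous_on UNIV (\<lambda>t::real. max t 0)"
    and cr: "continuous_on UNIV (\<lambda>t::real. sqrt (max t 0))" by (intro continuous_intros)+
  define r where "r = fc e (\<lambda>t. sqrt (max t 0))"
  have r: "star r = r" unfolding r_def by (rule star_fc[OF e cr])
  have rr: "r * r = fc e (\<lambda>t. max t 0)"
    unfolding r_def by (simp flip: fc_mult[OF e cr cr])
  \<comment> \<open>Intertwining replaces the fact that \<open>star d * d\<close> and
    \<open>d * star d\<close> share their nonzero spectrum: the positive part of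
    \<open>star d * d = - cube\<close> is 0, hence so is that of
    \<open>e = d * star d\<close>.\<close>
  have "star d * fc e (\<lambda>t. max t 0) = fc (star d * d) (\<lambda>t. max t 0) * star d"
    by (rule fc_intertwine[OF e _ _ cp]) (simp_all add: e_def star_mult star_star mult.assoc)
  also have "fc (star d * d) (\<lambda>t. max t 0) = fc m (\<lambda>t. max (- (t * t)) 0)"
    by (simp add: dd m(2) fc_of_minus_square[OF m(1) cp])
  also have "\<dots> = fc m (\<lambda>t. 0)" by (rule fc_cong[OF m(1)]) simp
  also have "\<dots> = 0" by (simp add: fc_const m)
  finally have "star d * (r * r) * d = 0" by (simp add: rr)
  then have "star (r * d) * (r * d) = 0"
    by (simp add: star_mult r mult.assoc)
  then have "r * d = 0"
    using cstar_identity[of "r * d"] by simp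
  then have "r * r * e = 0" by (simp add: e_def mult.assoc) (simp flip: mult.assoc)
  moreover have "r * r * e = fc e (\<lambda>t. max t 0) * fc e (\<lambda>t. max t 0)"
  proof -
    have "r * r * e = fc e (\<lambda>t. max t 0 * t)"
      by (simp add: rr fc_mult[OF e cp continuous_on_id] fc_id e)
    also have "\<dots> = fc e (\<lambda>t. max t 0 * max t 0)"
      by (rule fc_cong[OF e]) (simp add: max_def)
    finally show ?thesis by (simp add: fc_mult[OF e cp cp])
  qed
  ultimately have "fc e (\<lambda>t. max t 0) = 0"
    using square_eq_0_sa star_fc[OF e cp] by metis
  have "- e = fc e (\<lambda>t. - t)"
    by (simp add: fc_minus fc_id e continuous_intros)
  also have "\<dots> = fc e (\<lambda>t. max (- t) 0 - max t 0)"
    by (rule fc_cong[OF e]) (simp add: max_def)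
  also have "\<dots> = fc e (\<lambda>t. max (- t) 0)"
    using \<open>fc e (\<lambda>t. max t 0) = 0\<close> by (simp add: fc_diff e continuous_intros)
  finally have "sa_square (- e)"
    using sa_square_fc[OF e, of "\<lambda>t. max (- t) 0"] by (simp add: continuous_intros)
  \<comment> \<open>In the Cartesian decomposition \<open>d = x + i y\<close>, the sum
    \<open>star d * d + d * star d\<close> is \<open>2 (x^2 + y^2)\<close>. As \<open>- e\<close> is
    a square, so is \<open>star d * d = - cube\<close>, and antisymmetry gives
    \<open>cube = 0\<close>.\<close>
  define x where "x = scaleC (1/2) (d + star d)"
  define y where "y = scaleC (- \<i>/2) (d - star d)"
  have xy: "star x = x" "star y = y"
    by (simp_all add: x_def y_def star_scaleC star_add star_diff star_star add.commute
        complex_vector.scale_right_diff_distrib complex_vector.scale_minus_left)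
  have half: "scaleC (1/2) z + scaleC (1/2) z = z" for z :: 'a
    by (simp add: scaleC_one flip: scaleC_add_left)
  have quarter: "scaleC (1/4) (z + z) = scaleC (1/2) z" for z :: 'a
    unfolding scaleC_add_right by (simp flip: scaleC_add_left)
  have "x * x = scaleC (1/4) ((d + star d) * (d + star d))"
    unfolding x_def by (simp only: scaleC_mult_left scaleC_mult_right scaleC_scaleC) simp
  moreover have "y * y = scaleC (- (1/4)) ((d - star d) * (d - star d))"
    unfolding y_def by (simp only: scaleC_mult_left scaleC_mult_right scaleC_scaleC) simp
  ultimately have "x * x + y * y
      = scaleC (1/4) ((d + star d) * (d + star d)) - scaleC (1/4) ((d - star d) * (d - star d))"
    by (simp only: complex_vector.scale_minus_left) simp
  also have "\<dots> = scaleC (1/4) ((d + star d) * (d + star d) - (d - star d) * (d - star d))"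
    by (simp only: complex_vector.scale_right_diff_distrib)
  finally have "x * x + y * y = scaleC (1/4) ((d + star d) * (d + star d) - (d - star d) * (d - star d))" .
  also have "(d + star d) * (d + star d) - (d - star d) * (d - star d)
      = (d * star d + star d * d) + (d * star d + star d * d)"
    by (simp add: algebra_simps)
  also have "scaleC (1/4) \<dots> = scaleC (1/2) (d * star d + star d * d)"
    by (rule quarter)
  finally have "(x * x + y * y) + (x * x + y * y) = e + star d * d"
    by (simp add: half e_def)
  then have "star d * d = ((x * x + y * y) + (x * x + y * y)) + (- e)" by simp
  moreover have "sa_square (x * x)" "sa_square (y * y)"
    using xy by (auto simp: sa_square_def)
  ultimately have "sa_square (star d * d)"
    using \<open>sa_square (- e)\<close> by (simp only: sa_square_add)
  then have "cube = 0"
    using \<open>sa_square cube\<close> dd sa_square_antisym[of cube] by simp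
  moreover have "(neg * neg) * (neg * neg) = cube * neg"
    unfolding neg_def cube_def
    by (simp add: fc_mult[symmetric] c continuous_intros power3_eq_cube mult.assoc)
  ultimately have "neg * neg = 0"
    using square_eq_0_sa[of "neg * neg"] by (simp add: star_mult neg)
  then have "neg = 0" using square_eq_0_sa[OF neg] by simp
  have "c = fc c (\<lambda>t. max t 0 - max (- t) 0)"
    using fc_cong[OF c, of "\<lambda>t. t" "\<lambda>t. max t 0 - max (- t) 0"] fc_id[OF c]
    by (simp add: max_def)
  also have "\<dots> = fc c (\<lambda>t. max t 0)"
    using \<open>neg = 0\<close> by (simp add: fc_diff c continuous_intros flip: neg_def)
  finally have "sa_square c"
    using sa_square_fc[OF c cp] by simp
  then show ?thesis by (simp add: c_def)
qed

section \<open>The order of a C*-algebra without unit\<close>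

lemma positive_iff_sa_square: "positive a \<longleftrightarrow> sa_square (a::'a::{cstar_algebra, real_normed_algebra_1})"
  unfolding positive_def using sa_square_star_mult
  by (metis sa_square_def)

text \<open>\<open>scal\<close> is multiplicative and compatible with \<open>star\<close>, so a
  factor \<open>b\<close> of an element of the ideal has \<open>cnj (scal b) * scal b = 0\<close>
  and lies in the ideal. Positivity is thus the same in both algebras.\<close>

lemma positive_embed: "positive (embed a) \<longleftrightarrow> positive (a::'a::cstar_algebra)"
proof
  assume "positive (embed a)"
  then obtain b where b: "embed a = star b * b" by (auto simp: positive_def)
  then have "cnj (scal b) * scal b = 0" by (metis base_simps(15,18) unitization.sel(2))
  then have "b = embed (base b)" by (simp add: embed_base)
  then have "embed a = embed (star (base b) * base b)"
    using b by (metis embed_simps(4,7))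
  then show "positive a" by (auto simp: positive_def)
next
  assume "positive a"
  then show "positive (embed a)"
    by (auto simp: positive_def embed_simps)
qed

lemma positive_star: "positive a \<Longrightarrow> star a = (a::'a::complex_star_algebra)"
  by (auto simp: positive_def star_mult star_star)

lemma positive_zero [simp]: "positive (0::'a::complex_star_algebra)"
  by (auto simp: positive_def intro: exI[of _ 0])

lemma positive_star_mult: "positive (star b * (b::'a::complex_star_algebra))"
  by (auto simp: positive_def)

lemma positive_conj: "positive a \<Longrightarrow> positive (star x * a * (x::'a::complex_star_algebra))"
  unfolding positive_def by (metis mult.assoc star_mult)

lemma positive_scaleR: "positive a \<Longrightarrow> r \<ge> 0 \<Longrightarrow> positive (scaleR r (a::'a::cstar_algebra))"
proof -
  assume "positive a" "r \<ge> 0"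
  then obtain b where "a = star b * b" by (auto simp: positive_def)
  then have "scaleR r a = star (scaleR (sqrt r) b) * scaleR (sqrt r) b"
    using \<open>r \<ge> 0\<close> by (simp add: star_scaleR flip: power2_eq_square)
  then show ?thesis unfolding positive_def by blast
qed

lemma positive_add: "positive a \<Longrightarrow> positive b \<Longrightarrow> positive (a + (b::'a::cstar_algebra))"
  using sa_square_add[of "embed a" "embed b"]
  by (simp flip: positive_iff_sa_square embed_simps add: positive_embed)

lemma positive_sum: "(\<And>i. i \<in> S \<Longrightarrow> positive (f i)) \<Longrightarrow> positive (\<Sum>i\<in>S. f i :: 'a::cstar_algebra)"
  by (induction S rule: infinite_finite_induct) (auto intro: positive_add)

lemma positive_antisym: "positive a \<Longrightarrow> positive (- a) \<Longrightarrow> a = (0::'a::cstar_algebra)"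
  using sa_square_antisym[of "embed a"]
  by (simp flip: positive_iff_sa_square embed_simps add: positive_embed)

lemma positive_sum_eq_0:
  assumes "finite S" "(\<Sum>i\<in>S. f i) = (0::'a::cstar_algebra)" "\<And>i. i \<in> S \<Longrightarrow> positive (f i)" "j \<in> S"
  shows "f j = 0"
proof -
  have "f j + (\<Sum>i\<in>S - {j}. f i) = 0"
    using assms by (simp flip: sum.remove)
  then have "- f j = (\<Sum>i\<in>S - {j}. f i)" by (rule minus_unique)
  then have "positive (- f j)" using positive_sum[of "S - {j}" f] assms(3) by simp
  then show ?thesis using positive_antisym assms(3,4) by blast
qed

lemma sum_star_mult_eq_0:
  assumes "finite S" "(\<Sum>i\<in>S. star (z i) * z i) = (0::'a::cstar_algebra)" "j \<in> S"
  shows "z j = 0"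
proof -
  have "star (z j) * z j = 0"
    by (rule positive_sum_eq_0[OF assms(1,2) _ assms(3)]) (rule positive_star_mult)
  then show ?thesis using cstar_identity[of "z j"] by simp
qed

lemma positive_iff_norm_le:
  fixes a :: "'a::{cstar_algebra, real_normed_algebra_1}"
  shows "positive a \<longleftrightarrow> star a = a \<and> norm (of_real (norm a) - a) \<le> norm a"
  using sa_square_imp_norm_le[of a "norm a"] norm_le_imp_sa_square[of a "norm a"]
    positive_star[of a] by (auto simp: positive_iff_sa_square)

text \<open>An existential condition says nothing about limits; the equivalent norm inequality
  compares continuous functions of the element.\<close>

lemma closed_positive: "closed {a::'a::cstar_algebra. positive a}"
proof -
  have "(\<lambda>a::'a. embed a) = embed" by simp
  have cont: "continuous_on UNIV (embed :: 'a \<Rightarrow> _)"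
    unfolding continuous_on_def by (intro ballI tendsto_embed tendsto_ident_at)
  have "{a::'a. positive a} = {a. star (embed a) = embed a \<and> norm (of_real (norm (embed a)) - embed a) \<le> norm (embed a)}"
    by (simp only: positive_iff_norm_le flip: positive_embed)
  also have "closed \<dots>"
    unfolding of_real_def
    by (intro closed_Collect_conj closed_Collect_eq closed_Collect_le continuous_intros cont)
  finally show ?thesis .
qed

lemma positive_lim:
  assumes "f \<longlonglongrightarrow> (a::'a::cstar_algebra)" "\<And>n. positive (f n)"
  shows "positive a"
  using closed_sequentially[OF closed_positive, of f a] assms by simp

lemma positive_norm_diff:
  fixes a :: "'a::{cstar_algebra, real_normed_algebra_1}"
  assumes "star a = a" "norm a \<le> t"
  shows "positive (of_real t - a)"
  unfolding positive_iff_sa_square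
  by (rule norm_le_imp_sa_square[of _ t]) (use assms in \<open>simp_all add: star_diff\<close>)

lemma norm_mono_unital:
  fixes a b :: "'a::{cstar_algebra, real_normed_algebra_1}"
  assumes a: "positive a" and "positive (b - a)"
  shows "norm a \<le> norm b"
proof -
  define t where "t = norm b"
  have "star b = b"
    using positive_star[OF a] positive_star[OF assms(2)] by (simp add: star_diff)
  then have "positive ((of_real t - b) + (b - a))"
    by (intro positive_add positive_norm_diff assms) (simp_all add: t_def)
  then have diff: "positive (of_real t - a)" by simp
  obtain k where k: "star k = k" "a = k * k"
    using a by (auto simp: positive_iff_sa_square sa_square_def)
  \<comment> \<open>The part of \<open>a\<close> above \<open>t\<close>. On the one hand
    \<open>y (a - t) y\<close> is the cube of a nonnegative function, on the other
    \<open>t - a\<close> is positive; so this element and its negative are positive, and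
    \<open>y\<close> vanishes.\<close>
  define y where "y = fc k (\<lambda>x. max (x * x - t) 0)"
  have cont: "continuous_on UNIV (\<lambda>x::real. max (x * x - t) 0)" by (intro continuous_intros)
  have y: "star y = y" unfolding y_def by (rule star_fc[OF k(1) cont])
  have "y * (a - of_real t) * y = fc k (\<lambda>x. max (x * x - t) 0 * (x * x - t) * max (x * x - t) 0)"
    unfolding y_def k(2) using k(1)
    by (simp add: fc_mult fc_diff fc_square fc_const fc_id continuous_intros)
  also have "\<dots> = fc k (\<lambda>x. max (x * x - t) 0 ^ 3)"
    by (rule fc_cong[OF k(1)]) (auto simp: max_def power3_eq_cube)
  finally have yay: "y * (a - of_real t) * y = fc k (\<lambda>x. max (x * x - t) 0 ^ 3)" .
  then have "positive (y * (a - of_real t) * y)"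
    unfolding positive_iff_sa_square by (simp, intro sa_square_fc k continuous_intros) simp
  moreover have "positive (- (y * (a - of_real t) * y))"
    using positive_conj[OF diff, of y] by (simp add: y algebra_simps)
  ultimately have "fc k (\<lambda>x. max (x * x - t) 0 ^ 3) = 0"
    using positive_antisym yay by metis
  moreover have "(y * y) * (y * y) = fc k (\<lambda>x. max (x * x - t) 0 ^ 3) * y"
    unfolding y_def by (simp add: fc_mult[symmetric] k continuous_intros power3_eq_cube mult.assoc)
  ultimately have "y * y = 0"
    using square_eq_0_sa[of "y * y"] by (simp add: star_mult y)
  then have "y = 0" using square_eq_0_sa[OF y] by simp
  have "a = fc k (\<lambda>x. min (x * x) t + max (x * x - t) 0)"
    using fc_cong[OF k(1), of "\<lambda>x. x * x" "\<lambda>x. min (x * x) t + max (x * x - t) 0"] fc_square[OF k(1)] k(2)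
    by (simp add: max_def min_def)
  also have "\<dots> = fc k (\<lambda>x. min (x * x) t)"
    using \<open>y = 0\<close> by (simp add: fc_add k continuous_intros flip: y_def)
  finally have "norm a = norm (fc k (\<lambda>x. min (x * x) t))" by simp
  also have "\<dots> \<le> t"
    by (rule norm_fc_le[OF k(1)]) (auto intro!: continuous_intros simp: t_def abs_le_iff min_le_iff_disj)
  finally show ?thesis by (simp add: t_def)
qed

lemma norm_mono: "positive a \<Longrightarrow> positive (b - a) \<Longrightarrow> norm a \<le> norm (b::'a::cstar_algebra)"
  using norm_mono_unital[of "embed a" "embed b"]
  by (simp add: positive_embed flip: embed_simps)

lemma embed_left_action: "embed (left_action x b) = x * embed b"
  by (rule unitization_eqI) (simp_all add: left_action_def)

lemma left_action_mult_right: "left_action x (b * c) = left_action x b * c"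
  by (simp add: left_action_def algebra_simps scaleC_mult_left)

text \<open>\<open>(norm a)^2 - star a * a\<close> is positive only as an element of the
  unitization, and so is its factor \<open>d\<close>. Through the action,
  \<open>left_action d y\<close> is an element of the algebra and can be inserted into maps that are
  defined only there.\<close>

lemma norm_defect:
  fixes a :: "'a::cstar_algebra"
  obtains d where "\<And>y. left_action (star d) (left_action d y) = scaleR ((norm a)\<^sup>2) y - star a * (a * y)"
proof -
  define c where "c = embed (star a * a)"
  have "positive (of_real ((norm a)\<^sup>2) - c)"
    by (rule positive_norm_diff)
      (simp_all add: c_def cstar_identity star_mult star_star flip: embed_simps)
  then obtain d where d: "of_real ((norm a)\<^sup>2) - c = star d * d"
    by (auto simp: positive_def)
  have "left_action (of_real ((norm a)\<^sup>2) - c) y = scaleR ((norm a)\<^sup>2) y - star a * (a * y)" for y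
    by (simp add: left_action_def c_def of_real_def scaleR_eq_scaleC algebra_simps
        complex_vector.scale_minus_left)
  then show ?thesis
    unfolding d left_action_mult by (rule that)
qed

text \<open>The element is \<open>h^2 / (h^2 + \<delta>)\<close> for \<open>h\<close> the sum of all
  \<open>star a * a\<close>. It has \<open>h\<close> as a right factor, so it annihilates exactly
  what \<open>F\<close> annihilates from the left; this last property later yields products that are
  exactly 0, not just small.\<close>

lemma approximate_unit:
  fixes F :: "'a::cstar_algebra set"
  assumes F: "finite F" and e: "e > 0"
  obtains u where "star u = u" "norm u \<le> 1" "\<And>a. a \<in> F \<Longrightarrow> norm (a * u - a) \<le> e"
    "\<And>y. (\<And>a. a \<in> F \<Longrightarrow> a * y = 0) \<Longrightarrow> u * y = 0"
proof -
  define h where "h = (\<Sum>a\<in>F. star a * a)"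
  have star_h: "star h = h" by (simp add: h_def star_sum star_mult star_star)
  have star_H: "star (embed h) = embed h"
    using star_h by (simp flip: embed_simps)
  \<comment> \<open>With \<open>\<delta> = e ^ 4\<close> the inequality
    \<open>2 \<bar>t\<bar> e^2 \<le> t^2 + e^4\<close> bounds
    \<open>\<bar>t\<bar> \<delta>^2 / (t^2 + \<delta>)^2\<close> by \<open>e^2\<close>, uniformly in
    \<open>t\<close> and hence regardless of the norm of \<open>h\<close>.\<close>
  define \<delta> where "\<delta> = e ^ 4"
  have \<delta>: "\<delta> > 0" using e by (simp add: \<delta>_def)
  have nz: "t * t + \<delta> > 0" for t using \<delta> by (simp add: add_nonneg_pos)
  note nz' = nz[THEN less_imp_neq, THEN not_sym]
  define g where "g t = t / (t * t + \<delta>)" for t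
  define r where "r t = \<delta> / (t * t + \<delta>)" for t
  have cont: "continuous_on UNIV g" "continuous_on UNIV r"
    unfolding g_def[abs_def] r_def[abs_def] by (intro continuous_intros ballI nz')+
  define k where "k = fc (embed h) g"
  define u where "u = left_action k h"
  have u: "embed u = fc (embed h) (\<lambda>t. g t * t)"
    unfolding u_def embed_left_action k_def
    by (simp add: fc_mult[OF star_H cont(1)] fc_id[OF star_H] continuous_intros)
  have "star (embed u) = embed u"
    unfolding u by (intro star_fc star_H continuous_intros cont)
  then have 1: "star u = u" by (metis base_simps(7) unitization.sel(1))
  have "\<bar>g t * t\<bar> \<le> 1" for t
    using nz[of t] \<delta> by (simp add: g_def)
  then have 2: "norm u \<le> 1"
    using norm_fc_le[OF star_H, of "\<lambda>t. g t * t" 1] by (simp add: u[symmetric] cont continuous_intros)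
  have r: "r t = 1 - g t * t" for t
    using nz'[of t] by (simp add: r_def g_def field_simps)
  have R: "fc (embed h) r = 1 - embed u"
    unfolding u r[abs_def] by (simp add: fc_diff[OF star_H] fc_const[OF star_H] cont continuous_intros)
  have star_R: "star (fc (embed h) r) = fc (embed h) r" by (rule star_fc[OF star_H cont(2)])
  have 3: "norm (a * u - a) \<le> e" if "a \<in> F" for a
  proof -
    have "(norm (a * u - a))\<^sup>2 = (norm (embed a * fc (embed h) r))\<^sup>2"
      by (simp add: R algebra_simps norm_minus_commute flip: embed_simps)
    also have "\<dots> = norm (fc (embed h) r * embed (star a * a) * fc (embed h) r)"
      by (simp add: cstar_identity[symmetric] star_mult star_R embed_simps mult.assoc)
    also have "\<dots> \<le> norm (fc (embed h) r * embed h * fc (embed h) r)"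
    proof (rule norm_mono)
      have "positive (embed (star a * a))"
        by (simp add: positive_embed positive_star_mult)
      from positive_conj[OF this, of "fc (embed h) r"]
      show "positive (fc (embed h) r * embed (star a * a) * fc (embed h) r)"
        by (simp add: star_R)
      have "h - star a * a = (\<Sum>a\<in>F - {a}. star a * a)"
        using F that by (simp add: h_def sum_diff1)
      then have "positive (embed (h - star a * a))"
        by (simp add: positive_embed positive_sum positive_star_mult)
      from positive_conj[OF this, of "fc (embed h) r"]
      show "positive (fc (embed h) r * embed h * fc (embed h) r
          - fc (embed h) r * embed (star a * a) * fc (embed h) r)"
        by (simp add: star_R embed_simps algebra_simps)
    qed
    also have "fc (embed h) r * embed h * fc (embed h) r = fc (embed h) (\<lambda>t. r t * t * r t)"
      by (simp add: fc_mult[OF star_H] fc_id[OF star_H] cont continuous_intros)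
    also have "norm \<dots> \<le> e\<^sup>2"
    proof (rule norm_fc_le[OF star_H])
      fix t :: real
      have "0 \<le> (\<bar>t\<bar> - e\<^sup>2)\<^sup>2" by simp
      then have "2 * (\<bar>t\<bar> * e\<^sup>2) \<le> t * t + \<delta>"
        by (simp add: power2_eq_square algebra_simps \<delta>_def power4_eq_xxxx)
      then have "\<bar>t\<bar> * e\<^sup>2 \<le> t * t + \<delta>"
        using mult_nonneg_nonneg[OF abs_ge_zero[of t] zero_le_power2[of e]] by linarith
      then have "\<bar>t\<bar> * e\<^sup>2 / (t * t + \<delta>) \<le> 1"
        using nz[of t] by simp
      moreover have "r t \<le> 1" "r t \<ge> 0" using \<delta> nz[of t] by (simp_all add: r_def)
      ultimately have "(\<bar>t\<bar> * e\<^sup>2 / (t * t + \<delta>)) * r t \<le> 1"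
        using nz[of t] by (intro mult_le_one) simp_all
      then have "e\<^sup>2 * ((\<bar>t\<bar> * e\<^sup>2 / (t * t + \<delta>)) * r t) \<le> e\<^sup>2"
        by (rule mult_left_le) simp
      moreover have "\<bar>r t * t * r t\<bar> = e\<^sup>2 * ((\<bar>t\<bar> * e\<^sup>2 / (t * t + \<delta>)) * r t)"
      proof -
        have "\<bar>r t * t * r t\<bar> = \<bar>t\<bar> * r t * r t"
          using \<open>r t \<ge> 0\<close> by (simp add: abs_mult)
        also have "\<dots> = \<bar>t\<bar> * (\<delta> / (t * t + \<delta>)) * r t" by (simp add: r_def)
        also have "\<delta> = e\<^sup>2 * e\<^sup>2" by (simp add: \<delta>_def flip: power_add)
        finally show ?thesis by (simp add: \<delta>_def flip: power_add)
      qed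
      ultimately show "\<bar>r t * t * r t\<bar> \<le> e\<^sup>2" by simp
    qed (intro continuous_intros cont)
    finally show ?thesis
      using e by (simp add: power2_le_iff_abs_le)
  qed
  have 4: "u * y = 0" if "\<And>a. a \<in> F \<Longrightarrow> a * y = 0" for y
  proof -
    have "u * y = left_action k (h * y)" by (simp add: u_def left_action_mult_right)
    also have "h * y = 0" using that by (simp add: h_def sum_distrib_right mult.assoc)
    finally show ?thesis by (simp add: left_action_def)
  qed
  show ?thesis using that 1 2 3 4 by blast
qed

text \<open>
  If \<open>p a < s < \<parallel>a\<parallel>\<close>, then the part of \<open>a\<close> with spectrum outside \<open>[-s, s]\<close> can be divided by
  arbitrarily high powers of \<open>a\<close>, so that \<open>p\<close> vanishes on it.
\<close>

lemma cstar_norm_unique: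
  fixes p :: "'a::cstar_algebra \<Rightarrow> real"
  assumes nonneg: "\<And>x. p x \<ge> 0" and mult: "\<And>x y. p (x * y) \<le> p x * p y"
    and square: "\<And>x. p (star x * x) = (p x)\<^sup>2" and le: "\<And>x. p x \<le> norm x"
    and faithful: "\<And>x. p x = 0 \<Longrightarrow> x = 0"
  shows "p x = norm x"
proof -
  have self_adjoint: "norm a \<le> p a" if a: "star a = a" for a
  proof (rule ccontr)
    assume "\<not> norm a \<le> p a"
    then have "p a < norm a" by simp
    then obtain s where s: "p a < s" "s < norm a" using dense by blast
    have s0: "s > 0" using s(1) nonneg[of a] by linarith
    have A: "star (embed a) = embed a" using a by (simp flip: embed_simps)
    define f where "f t = max (\<bar>t\<bar> - s) 0" for t :: real
    \<comment> \<open>Equal to \<open>\<bar>t\<bar>\<close> on the support of \<open>f\<close>, yet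
      bounded below by \<open>s\<close>, so that the inverse \<open>w\<close> is continuous and its
      powers undo powers of \<open>\<bar>t\<bar>\<close> wherever \<open>f\<close> is
      nonzero.\<close>
    define m where "m t = max \<bar>t\<bar> s" for t :: real
    have m: "m t > 0" "m t \<ge> s" for t using s0 by (auto simp: m_def)
    have nz: "m t \<noteq> 0" for t using m(1)[of t] by simp
    define w where "w t = inverse (m t)" for t
    have contm: "continuous_on UNIV m" unfolding m_def[abs_def] by (intro continuous_intros)
    have cont: "continuous_on UNIV f" "continuous_on UNIV w"
      unfolding f_def[abs_def] w_def[abs_def]
      by (intro continuous_intros contm ballI nz)+
    have fm: "f t = 0 \<or> m t = \<bar>t\<bar>" for t by (auto simp: f_def m_def)
    define y where "y n = left_action (fc (embed a) (\<lambda>t. f t * w t ^ (2 * n))) a" for n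
    have y: "embed (y n) = fc (embed a) (\<lambda>t. f t * w t ^ (2 * n) * t)" for n
      unfolding y_def embed_left_action
      by (simp add: fc_mult[OF A] fc_id[OF A] cont continuous_intros)
    have step: "y n = a * a * y (Suc n)" for n
    proof -
      have "embed (a * a * y (Suc n)) = fc (embed a) (\<lambda>t. t * t * (f t * w t ^ (2 * Suc n) * t))"
        by (simp add: embed_simps y fc_mult[OF A] fc_id[OF A] cont continuous_intros del: power_Suc mult_Suc_right)
      also have "\<dots> = embed (y n)"
        unfolding y
      proof (rule fc_cong[OF A])
        fix t
        have "t * t * (w t * w t) = 1 \<or> f t = 0"
          using fm[of t] nz[of t] by (auto simp: w_def field_simps)
        then show "t * t * (f t * w t ^ (2 * Suc n) * t) = f t * w t ^ (2 * n) * t"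
          by (auto simp: algebra_simps)
      qed
      finally show ?thesis by simp
    qed
    have "p (y 0) \<le> (p a)\<^sup>2 ^ n * p (y n)" for n
    proof (induction n)
      case (Suc n)
      have "p (y n) \<le> p a * p a * p (y (Suc n))"
        using mult[of "a * a" "y (Suc n)"] mult_right_mono[OF mult[of a a] nonneg[of "y (Suc n)"]] step[of n]
        by simp
      then have "(p a)\<^sup>2 ^ n * p (y n) \<le> (p a)\<^sup>2 ^ n * (p a * p a * p (y (Suc n)))"
        by (intro mult_left_mono) simp_all
      with Suc show ?case by (simp add: power2_eq_square algebra_simps)
    qed simp
    moreover have "p (y n) \<le> (norm a)\<^sup>2 / s\<^sup>2 ^ n" for n
    proof -
      have "norm (embed (y n)) \<le> (norm a)\<^sup>2 / s\<^sup>2 ^ n"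
        unfolding y
      proof (rule norm_fc_le[OF A])
        fix t assume t: "\<bar>t\<bar> \<le> norm (embed a)"
        have "\<bar>f t\<bar> * \<bar>t\<bar> \<le> norm a * norm a"
          using t s0 by (intro mult_mono) (auto simp: f_def)
        moreover have "s ^ (2 * n) \<le> m t ^ (2 * n)"
          using m(2)[of t] s0 by (intro power_mono) auto
        ultimately have "\<bar>f t\<bar> * \<bar>t\<bar> / m t ^ (2 * n) \<le> norm a * norm a / s ^ (2 * n)"
          using s0 by (intro frac_le) auto
        moreover have "\<bar>f t * w t ^ (2 * n) * t\<bar> = \<bar>f t\<bar> * \<bar>t\<bar> / m t ^ (2 * n)"
          using m(1)[of t] by (simp add: w_def abs_mult divide_inverse power_inverse)
        ultimately show "\<bar>f t * w t ^ (2 * n) * t\<bar> \<le> (norm a)\<^sup>2 / s\<^sup>2 ^ n"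
          by (simp add: power2_eq_square power_mult)
      qed (intro continuous_intros cont)
      then show ?thesis using le[of "y n"] by simp
    qed
    ultimately have "p (y 0) \<le> (p a)\<^sup>2 ^ n * ((norm a)\<^sup>2 / s\<^sup>2 ^ n)" for n
      by (meson mult_left_mono order.trans zero_le_power zero_le_power2)
    then have bound: "p (y 0) \<le> ((p a)\<^sup>2 / s\<^sup>2) ^ n * (norm a)\<^sup>2" for n
      by (simp add: power_divide)
    have "(p a)\<^sup>2 / s\<^sup>2 < 1"
      using s(1) s0 nonneg[of a] by (simp add: power_strict_mono)
    then have "(\<lambda>n. ((p a)\<^sup>2 / s\<^sup>2) ^ n * (norm a)\<^sup>2) \<longlonglongrightarrow> 0 * (norm a)\<^sup>2"
      by (intro tendsto_mult LIMSEQ_power_zero tendsto_const) simp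
    then have "p (y 0) \<le> 0"
      using bound by (intro LIMSEQ_le_const[where X = "\<lambda>n. ((p a)\<^sup>2 / s\<^sup>2) ^ n * (norm a)\<^sup>2"]) auto
    then have "y 0 = 0" using nonneg[of "y 0"] faithful by force
    then have zero: "fc (embed a) (\<lambda>t. f t * t) = 0"
      using y[of 0] by (simp flip: embed_simps)
    \<comment> \<open>Subtracting a function whose value at \<open>a\<close> is 0 does not change
      \<open>a\<close>, but it truncates \<open>t\<close> to the interval \<open>[-s, s]\<close>,
      which contradicts \<open>s < norm a\<close>.\<close>
    have "fc (embed a) (\<lambda>t. f t * t * w t) = 0"
      using zero by (simp add: fc_mult[OF A, of "\<lambda>t. f t * t"] cont continuous_intros)
    then have "embed a = fc (embed a) (\<lambda>t. t - f t * t * w t)"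
      by (simp add: fc_diff[OF A] fc_id[OF A] cont continuous_intros)
    moreover have "norm \<dots> \<le> s"
    proof (rule norm_fc_le[OF A])
      fix t
      show "\<bar>t - f t * t * w t\<bar> \<le> s"
      proof (cases "\<bar>t\<bar> \<le> s")
        case True
        then show ?thesis by (simp add: f_def)
      next
        case False
        then have "t - f t * t * w t = s * (t / \<bar>t\<bar>)"
          using s0 by (simp add: f_def m_def w_def max_def field_simps)
        with False s0 show ?thesis by (simp add: abs_mult)
      qed
    qed (intro continuous_intros cont)
    ultimately have "norm (embed a) \<le> s" by simp
    with s(2) show False by simp
  qed
  have "(norm x)\<^sup>2 = norm (star x * x)" by (simp add: cstar_identity)
  also have "\<dots> \<le> p (star x * x)" by (rule self_adjoint) (simp add: star_mult star_star)
  also have "\<dots> = (p x)\<^sup>2" by (rule square)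
  finally have "norm x \<le> p x" by (rule power2_le_imp_le) (rule nonneg)
  with le[of x] show ?thesis by simp
qed

section \<open>Positive matrices\<close>

text \<open>Completing the square: with \<open>\<beta> = norm b\<close> the difference is
  \<open>1/\<beta>\<close> times the square of \<open>\<beta> x - b y\<close> plus
  \<open>1/\<beta>\<close> times \<open>star y * (\<beta>^2 - star b * b) * y\<close>.\<close>

lemma positive_cross_term:
  fixes b :: "'a::{cstar_algebra, real_normed_algebra_1}"
  shows "positive (scaleR (norm b) (star x * x + star y * y) - (star x * b * y + star y * star b * x))"
proof (cases "b = 0")
  case False
  define \<beta> where "\<beta> = norm b"
  have \<beta>: "\<beta> > 0" using False by (simp add: \<beta>_def)
  have "positive (of_real (\<beta>\<^sup>2) - star b * b)"
    by (rule positive_norm_diff) (simp_all add: \<beta>_def cstar_identity star_mult star_star)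
  then have "positive (scaleR (inverse \<beta>) (star y * (of_real (\<beta>\<^sup>2) - star b * b) * y))"
    using \<beta> by (intro positive_scaleR positive_conj) auto
  moreover have "positive (scaleR (inverse \<beta>) (star (scaleR \<beta> x - b * y) * (scaleR \<beta> x - b * y)))"
    using \<beta> by (intro positive_scaleR positive_star_mult) auto
  ultimately have "positive (scaleR (inverse \<beta>) (star y * (of_real (\<beta>\<^sup>2) - star b * b) * y)
    + scaleR (inverse \<beta>) (star (scaleR \<beta> x - b * y) * (scaleR \<beta> x - b * y)))"
    by (rule positive_add)
  also have "scaleR (inverse \<beta>) (star y * (of_real (\<beta>\<^sup>2) - star b * b) * y)
    + scaleR (inverse \<beta>) (star (scaleR \<beta> x - b * y) * (scaleR \<beta> x - b * y))
    = scaleR \<beta> (star x * x + star y * y) - (star x * b * y + star y * star b * x)"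
    using \<beta> by (simp add: algebra_simps star_diff star_mult star_scaleR of_real_def
        scaleR_diff_right scaleR_add_right power2_eq_square)
  finally show ?thesis by (simp add: \<beta>_def)
qed simp

text \<open>The algebra-valued inner product of the Hilbert module of \<open>n\<close>-tuples.
  Testing matrices on it makes their positivity accessible without a C*-norm on matrices.\<close>

definition form :: "nat \<Rightarrow> (nat \<Rightarrow> 'a::complex_star_algebra) \<Rightarrow> (nat \<Rightarrow> 'a) \<Rightarrow> 'a"
  where "form n v w = (\<Sum>i<n. star (v i) * w i)"

definition mat_vec :: "nat \<Rightarrow> (nat \<Rightarrow> nat \<Rightarrow> 'a::complex_star_algebra) \<Rightarrow> (nat \<Rightarrow> 'a) \<Rightarrow> nat \<Rightarrow> 'a"
  where "mat_vec n X v i = (\<Sum>j<n. X i j * v j)"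

lemma form_diff_left: "form n (\<lambda>i. v i - v' i) w = form n v w - form n v' w"
  by (simp add: form_def star_diff left_diff_distrib sum_subtractf)

lemma form_diff_right: "form n v (\<lambda>i. w i - w' i) = form n v w - form n v w'"
  by (simp add: form_def right_diff_distrib sum_subtractf)

lemma mat_vec_diff: "mat_vec n X (\<lambda>i. v i - w i) = (\<lambda>i. mat_vec n X v i - mat_vec n X w i)"
  by (auto simp: mat_vec_def right_diff_distrib sum_subtractf)

lemma positive_form: "positive (form n v (v :: nat \<Rightarrow> 'a::cstar_algebra))"
  by (simp add: form_def positive_sum positive_star_mult)

lemma norm_entry_le: "i < n \<Longrightarrow> (norm (v i))\<^sup>2 \<le> norm (form n v (v :: nat \<Rightarrow> 'a::cstar_algebra))"
  unfolding cstar_identity[symmetric]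
proof (rule norm_mono)
  assume "i < n"
  then have "form n v v - star (v i) * v i = (\<Sum>j\<in>{..<n} - {i}. star (v j) * v j)"
    by (simp add: form_def sum_diff1)
  then show "positive (form n v v - star (v i) * v i)"
    by (simp add: positive_sum positive_star_mult)
qed (rule positive_star_mult)

lemma form_mat_vec:
  assumes "\<And>i j. i < n \<Longrightarrow> j < n \<Longrightarrow> star (X j i) = X i j"
  shows "form n (mat_vec n X v) w = form n v (mat_vec n X w)"
proof -
  have "form n (mat_vec n X v) w = (\<Sum>i<n. \<Sum>j<n. star (v j) * (star (X i j) * w i))"
    by (simp add: form_def mat_vec_def star_sum star_mult sum_distrib_right mult.assoc)
  also have "\<dots> = (\<Sum>j<n. \<Sum>i<n. star (v j) * (star (X i j) * w i))" by (rule sum.swap)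
  also have "\<dots> = form n v (mat_vec n X w)"
    by (simp add: form_def mat_vec_def sum_distrib_left assms)
  finally show ?thesis .
qed

text \<open>
  A square root of \<open>X\<close> is obtained from the power series of \<open>(1 - C)\<^sup>1\<^sup>/\<^sup>2\<close> at \<open>C = 1 - X\<close>, a contraction
  because \<open>X - X\<^sup>2 = X (1 - X) X + (1 - X) X (1 - X)\<close>.
\<close>

lemma gram_factorization_contractive:
  fixes X :: "nat \<Rightarrow> nat \<Rightarrow> 'a::{cstar_algebra, real_normed_algebra_1}"
  assumes herm: "\<And>i j. i < n \<Longrightarrow> j < n \<Longrightarrow> star (X j i) = X i j"
    and pos: "\<And>v. positive (form n v (mat_vec n X v))"
    and le: "\<And>v. positive (form n v v - form n v (mat_vec n X v))"
  obtains Y where "\<And>i j. i < n \<Longrightarrow> j < n \<Longrightarrow> X i j = (\<Sum>l<n. star (Y l i) * Y l j)"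
proof -
  define C where "C v = (\<lambda>i. v i - mat_vec n X v i)" for v
  note adj = form_mat_vec[of n X, OF herm]
  have C_adj: "form n (C v) w = form n v (C w)" for v w
    by (simp add: C_def form_diff_left form_diff_right adj)
  have contr: "positive (form n v v - form n (C v) (C v))" for v
  proof -
    have "form n v v - form n (C v) (C v) = form n v (mat_vec n X v)
      + ((form n (mat_vec n X v) (mat_vec n X v) - form n (mat_vec n X v) (mat_vec n X (mat_vec n X v)))
      + form n (C v) (mat_vec n X (C v)))"
      by (simp add: C_def form_diff_left form_diff_right mat_vec_diff adj)
    then show ?thesis using pos le by (simp add: positive_add)
  qed
  have norm_pow: "norm (form n ((C ^^ k) v) ((C ^^ k) v)) \<le> norm (form n v v)" for k v
  proof (induction k)
    case (Suc k)
    have "norm (form n ((C ^^ Suc k) v) ((C ^^ Suc k) v)) \<le> norm (form n ((C ^^ k) v) ((C ^^ k) v))"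
      by (rule norm_mono) (simp_all add: positive_form contr)
    with Suc show ?case by simp
  qed simp
  define e where "e j = (\<lambda>i. if i = j then 1 else 0 :: 'a)" for j :: nat
  have star_e: "star (e j i) = e j i" for i j by (simp add: e_def)
  have form_e: "form n (e i) w = w i" if "i < n" for i w
    using that by (simp add: form_def star_e) (simp add: e_def if_distrib[of "\<lambda>x. x * _"] cong: if_cong)
  have bound: "norm ((C ^^ k) (e j) l) \<le> 1" if "j < n" "l < n" for j k l
  proof -
    have "(norm ((C ^^ k) (e j) l))\<^sup>2 \<le> norm (form n (e j) (e j))"
      using norm_entry_le[OF that(2)] norm_pow order.trans by blast
    also have "\<dots> = 1" using form_e[OF that(1), of "e j"] by (simp add: e_def)
    finally show ?thesis by (simp add: abs_square_le_1)
  qed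
  \<comment> \<open>Column \<open>j\<close> of a partial sum of the series for the square root; the
    limit columns are the vectors whose Gram matrix is \<open>X\<close>.\<close>
  define S where "S N j l = (\<Sum>k<N. scaleR (sqrt_coeff k) ((C ^^ k) (e j) l))" for N j l
  have "\<exists>y. (\<lambda>N. S N j l) \<longlonglongrightarrow> y" if "j < n" "l < n" for j l
  proof -
    have "summable (\<lambda>k. scaleR (sqrt_coeff k) ((C ^^ k) (e j) l))"
      using bound[OF that]
      by (intro summable_norm_cancel[OF summable_comparison_test'[OF summable_sqrt_coeff]])
        (simp add: mult_left_le)
    then show ?thesis unfolding S_def using summable_LIMSEQ by blast
  qed
  then obtain y where y: "\<And>j l. j < n \<Longrightarrow> l < n \<Longrightarrow> (\<lambda>N. S N j l) \<longlonglongrightarrow> y j l"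
    by metis
  show ?thesis
  proof
    fix i j assume ij: "i < n" "j < n"
    \<comment> \<open>The \<open>(i, j)\<close> entry of \<open>C ^^ k\<close>. As \<open>C\<close>
      is symmetric for \<open>form\<close>, products of columns depend only on the total exponent,
      as \<open>sqrt_series_square\<close> requires.\<close>
    define m where "m k = form n (e i) ((C ^^ k) (e j))" for k
    have shift: "form n ((C ^^ k) v) w = form n v ((C ^^ k) w)" for k v w
      by (induction k arbitrary: v) (simp_all add: C_adj funpow_swap1)
    have "form n (S N i) (S N j) = (\<Sum>k<N. \<Sum>l<N. scaleR (sqrt_coeff k * sqrt_coeff l) (m (k + l)))" for N
    proof -
      have "form n (S N i) (S N j) = (\<Sum>q<n. \<Sum>k<N. \<Sum>l<N. scaleR (sqrt_coeff k * sqrt_coeff l)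
          (star ((C ^^ k) (e i) q) * (C ^^ l) (e j) q))"
        by (simp add: form_def S_def star_sum star_scaleR sum_product mult.commute)
      also have "\<dots> = (\<Sum>k<N. \<Sum>q<n. \<Sum>l<N. scaleR (sqrt_coeff k * sqrt_coeff l)
          (star ((C ^^ k) (e i) q) * (C ^^ l) (e j) q))"
        by (rule sum.swap)
      also have "\<dots> = (\<Sum>k<N. \<Sum>l<N. \<Sum>q<n. scaleR (sqrt_coeff k * sqrt_coeff l)
          (star ((C ^^ k) (e i) q) * (C ^^ l) (e j) q))"
        by (intro sum.cong refl sum.swap)
      also have "\<dots> = (\<Sum>k<N. \<Sum>l<N. scaleR (sqrt_coeff k * sqrt_coeff l)
          (form n ((C ^^ k) (e i)) ((C ^^ l) (e j))))"
        by (simp add: form_def scaleR_sum_right)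
      finally show ?thesis by (simp add: shift m_def funpow_add)
    qed
    moreover have "norm (m k) \<le> 1" for k
      using form_e[OF ij(1)] bound[OF ij(2,1)] by (simp add: m_def)
    ultimately have "(\<lambda>N. form n (S N i) (S N j)) \<longlonglongrightarrow> m 0 - m 1"
      using sqrt_series_square[of m 1] by simp
    moreover have "(\<lambda>N. form n (S N i) (S N j)) \<longlonglongrightarrow> form n (y i) (y j)"
      unfolding form_def using y ij by (intro tendsto_intros) auto
    moreover have "m 0 - m 1 = X i j"
      using ij by (simp add: m_def C_def form_diff_right)
        (simp add: form_e mat_vec_def, simp add: e_def if_distrib[of "\<lambda>x. _ * x"] cong: if_cong)
    ultimately show "X i j = (\<Sum>l<n. star (y i l) * y j l)"
      using LIMSEQ_unique by (fastforce simp: form_def)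
  qed
qed

lemma gram_factorization:
  fixes X :: "nat \<Rightarrow> nat \<Rightarrow> 'a::{cstar_algebra, real_normed_algebra_1}"
  assumes herm: "\<And>i j. i < n \<Longrightarrow> j < n \<Longrightarrow> star (X j i) = X i j"
    and pos: "\<And>v. positive (form n v (mat_vec n X v))"
  obtains Y where "\<And>i j. i < n \<Longrightarrow> j < n \<Longrightarrow> X i j = (\<Sum>l<n. star (Y l i) * Y l j)"
proof -
  \<comment> \<open>\<open>M\<close> dominates every row sum of norms, so
    \<open>positive_cross_term\<close> bounds the form of \<open>X\<close> by \<open>M\<close> times
    the identity; the summand 1 keeps it positive when \<open>X = 0\<close>.\<close>
  define M where "M = 1 + (\<Sum>i<n. \<Sum>j<n. norm (X i j))"
  have M: "M > 0" unfolding M_def by (intro add_pos_nonneg sum_nonneg) auto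
  have row: "(\<Sum>j<n. norm (X i j)) \<le> M" if "i < n" for i
  proof -
    have "(\<Sum>j<n. norm (X i j)) \<le> (\<Sum>i<n. \<Sum>j<n. norm (X i j))"
      using that by (intro member_le_sum[of i _ "\<lambda>i. \<Sum>j<n. norm (X i j)"]) (auto intro: sum_nonneg)
    then show ?thesis by (simp add: M_def)
  qed
  have norm_sym: "norm (X j i) = norm (X i j)" if "i < n" "j < n" for i j
    using herm[OF that] by (metis norm_star)
  define X' where "X' i j = scaleR (inverse M) (X i j)" for i j
  have mat: "mat_vec n X' v = (\<lambda>i. scaleR (inverse M) (mat_vec n X v i))" for v
    by (auto simp: mat_vec_def X'_def scaleR_sum_right)
  have form': "form n v (mat_vec n X' v) = scaleR (inverse M) (form n v (mat_vec n X v))" for v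
    by (simp add: mat form_def scaleR_sum_right)
  have le: "positive (scaleR M (form n v v) - form n v (mat_vec n X v))" for v
  proof -
    define T where "T i j = scaleR (norm (X i j)) (star (v i) * v i + star (v j) * v j)
      - (star (v i) * X i j * v j + star (v j) * star (X i j) * v i)" for i j
    have form_eq: "form n v (mat_vec n X v) = (\<Sum>i<n. \<Sum>j<n. star (v i) * X i j * v j)"
      by (simp add: form_def mat_vec_def sum_distrib_left mult.assoc)
    have "(\<Sum>i<n. \<Sum>j<n. star (v j) * star (X i j) * v i) = (\<Sum>j<n. \<Sum>i<n. star (v j) * star (X i j) * v i)"
      by (rule sum.swap)
    also have "\<dots> = form n v (mat_vec n X v)"
      unfolding form_eq by (intro sum.cong refl) (simp add: herm)
    finally have form_eq': "(\<Sum>i<n. \<Sum>j<n. star (v j) * star (X i j) * v i) = form n v (mat_vec n X v)" .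
    define D where "D = (\<Sum>i<n. scaleR (\<Sum>j<n. norm (X i j)) (star (v i) * v i))"
    have "(\<Sum>i<n. \<Sum>j<n. scaleR (norm (X i j)) (star (v j) * v j))
        = (\<Sum>j<n. \<Sum>i<n. scaleR (norm (X i j)) (star (v j) * v j))" by (rule sum.swap)
    also have "\<dots> = D"
      unfolding D_def scaleR_sum_left by (intro sum.cong refl) (simp add: norm_sym)
    finally have D': "(\<Sum>i<n. \<Sum>j<n. scaleR (norm (X i j)) (star (v j) * v j)) = D" .
    have "(\<Sum>i<n. \<Sum>j<n. T i j) = (D + D) - (form n v (mat_vec n X v) + form n v (mat_vec n X v))"
      unfolding T_def by (simp add: sum_subtractf sum.distrib scaleR_add_right D' form_eq' flip: form_eq)
        (simp add: D_def scaleR_sum_left)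
    moreover have "positive (\<Sum>i<n. \<Sum>j<n. T i j)"
      unfolding T_def by (intro positive_sum positive_cross_term)
    ultimately have "positive (scaleR (1/2) ((D + D) - (form n v (mat_vec n X v) + form n v (mat_vec n X v))))"
      by (intro positive_scaleR) simp_all
    then have "positive (D - form n v (mat_vec n X v))"
      by (simp add: scaleR_diff_right scaleR_add_right flip: scaleR_add_left)
    moreover have "scaleR M (form n v v) - D = (\<Sum>i<n. scaleR (M - (\<Sum>j<n. norm (X i j))) (star (v i) * v i))"
      by (simp add: D_def form_def scaleR_sum_right scaleR_diff_left sum_subtractf)
    then have "positive (scaleR M (form n v v) - D)"
      by (simp only:) (intro positive_sum positive_scaleR positive_star_mult, simp add: row)
    ultimately have "positive ((scaleR M (form n v v) - D) + (D - form n v (mat_vec n X v)))"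
      by (intro positive_add)
    then show ?thesis by simp
  qed
  obtain Y where Y: "\<And>i j. i < n \<Longrightarrow> j < n \<Longrightarrow> X' i j = (\<Sum>l<n. star (Y l i) * Y l j)"
  proof (rule gram_factorization_contractive[of n X'])
    show "star (X' j i) = X' i j" if "i < n" "j < n" for i j
      using herm[OF that] by (simp add: X'_def star_scaleR)
    fix v
    show "positive (form n v (mat_vec n X' v))"
      using M pos by (simp add: form' positive_scaleR)
    have "positive (scaleR (inverse M) (scaleR M (form n v v) - form n v (mat_vec n X v)))"
      using M le by (intro positive_scaleR) simp_all
    then show "positive (form n v v - form n v (mat_vec n X' v))"
      using M by (simp add: form' scaleR_diff_right)
  qed blast
  have "X i j = (\<Sum>l<n. star (scaleR (sqrt M) (Y l i)) * scaleR (sqrt M) (Y l j))" if "i < n" "j < n" for i j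
  proof -
    have "X i j = scaleR M (X' i j)" using M by (simp add: X'_def)
    also have "\<dots> = (\<Sum>l<n. star (scaleR (sqrt M) (Y l i)) * scaleR (sqrt M) (Y l j))"
      using M that by (simp add: Y star_scaleR scaleR_sum_right)
    finally show ?thesis .
  qed
  then show ?thesis by (rule that)
qed

text \<open>Existence of a factor is traded for conditions that survive sums and limits. The vectors
  range over the unitization because the square root is constructed there; its entries return to the
  algebra since the scalar part of the diagonal entry \<open>X i i\<close>, which is 0, is the sum
  of the squared moduli of the scalar parts in column \<open>i\<close>.\<close>

lemma positive_matrix_iff_form:
  fixes X :: "nat \<Rightarrow> nat \<Rightarrow> 'a::cstar_algebra"
  shows "positive_matrix n X \<longleftrightarrow> (\<forall>i<n. \<forall>j<n. star (X j i) = X i j) \<and>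
    (\<forall>v. positive (form n v (mat_vec n (\<lambda>i j. embed (X i j)) v)))"
proof (intro iffI conjI allI impI)
  assume "positive_matrix n X"
  then obtain Y where Y: "\<And>i j. i < n \<Longrightarrow> j < n \<Longrightarrow> X i j = (\<Sum>l<n. star (Y l i) * Y l j)"
    unfolding positive_matrix_def by blast
  show "star (X j i) = X i j" if "i < n" "j < n" for i j
    using that by (simp add: Y star_sum star_mult star_star)
  fix v :: "nat \<Rightarrow> 'a unitization"
  have embed_sum: "embed (\<Sum>l<n. f l) = (\<Sum>l<n. embed (f l))" for f :: "nat \<Rightarrow> 'a"
    by (induction n) (simp_all add: embed_simps)
  have "form n v (mat_vec n (\<lambda>i j. embed (X i j)) v)
    = (\<Sum>i<n. \<Sum>j<n. \<Sum>l<n. star (embed (Y l i) * v i) * (embed (Y l j) * v j))"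
    by (simp add: form_def mat_vec_def Y embed_sum embed_simps sum_distrib_left sum_distrib_right star_mult mult.assoc)
  also have "\<dots> = (\<Sum>i<n. \<Sum>l<n. \<Sum>j<n. star (embed (Y l i) * v i) * (embed (Y l j) * v j))"
    by (intro sum.cong refl sum.swap)
  also have "\<dots> = (\<Sum>l<n. \<Sum>i<n. \<Sum>j<n. star (embed (Y l i) * v i) * (embed (Y l j) * v j))"
    by (rule sum.swap)
  also have "\<dots> = (\<Sum>l<n. star (\<Sum>i<n. embed (Y l i) * v i) * (\<Sum>i<n. embed (Y l i) * v i))"
    by (simp add: star_sum sum_product)
  finally show "positive (form n v (mat_vec n (\<lambda>i j. embed (X i j)) v))"
    by (simp add: positive_sum positive_star_mult)
next
  assume *: "(\<forall>i<n. \<forall>j<n. star (X j i) = X i j) \<and>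
    (\<forall>v. positive (form n v (mat_vec n (\<lambda>i j. embed (X i j)) v)))"
  obtain Y where Y: "\<And>i j. i < n \<Longrightarrow> j < n \<Longrightarrow> embed (X i j) = (\<Sum>l<n. star (Y l i) * Y l j)"
  proof (rule gram_factorization[of n "\<lambda>i j. embed (X i j)"])
    show "star (embed (X j i)) = embed (X i j)" if "i < n" "j < n" for i j
      using * that by (simp flip: embed_simps)
    show "positive (form n v (mat_vec n (\<lambda>i j. embed (X i j)) v))" for v
      using * by blast
  qed blast
  have scal_sum: "scal (\<Sum>l<n. f l) = (\<Sum>l<n. scal (f l))" for f :: "nat \<Rightarrow> 'a unitization"
    by (induction n) simp_all
  have base_sum: "base (\<Sum>l<n. f l) = (\<Sum>l<n. base (f l))" for f :: "nat \<Rightarrow> 'a unitization"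
    by (induction n) simp_all
  have zero: "scal (Y l i) = 0" if "l < n" "i < n" for l i
  proof -
    have "complex_of_real (\<Sum>l<n. (cmod (scal (Y l i)))\<^sup>2) = scal (embed (X i i))"
      unfolding Y[OF that(2) that(2)] scal_sum
      by (simp add: complex_norm_square mult.commute del: of_real_power)
    then have "(\<Sum>l<n. (cmod (scal (Y l i)))\<^sup>2) = 0" by (simp only: unitization.sel of_real_eq_0_iff)
    then show ?thesis using that by (simp add: sum_nonneg_eq_0_iff)
  qed
  have "X i j = (\<Sum>l<n. star (base (Y l i)) * base (Y l j))" if "i < n" "j < n" for i j
    using arg_cong[OF Y[OF that], of base] that zero by (simp add: base_sum)
  then show "positive_matrix n X"
    unfolding positive_matrix_def by (intro exI[of _ "\<lambda>l i. base (Y l i)"]) blast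
qed

lemma positive_matrix_lim:
  fixes X :: "nat \<Rightarrow> nat \<Rightarrow> 'a::cstar_algebra"
  assumes lim: "\<And>i j. i < n \<Longrightarrow> j < n \<Longrightarrow> (\<lambda>m. Z m i j) \<longlonglongrightarrow> X i j" and pos: "\<And>m. positive_matrix n (Z m)"
  shows "positive_matrix n X"
  unfolding positive_matrix_iff_form
proof (intro conjI allI impI)
  show "star (X j i) = X i j" if "i < n" "j < n" for i j
  proof -
    have "(\<lambda>m. star (Z m j i)) = (\<lambda>m. Z m i j)"
      using pos that unfolding positive_matrix_iff_form by auto
    then show ?thesis
      using tendsto_star[OF lim[OF that(2,1)]] lim[OF that] LIMSEQ_unique by simp
  qed
  show "positive (form n v (mat_vec n (\<lambda>i j. embed (X i j)) v))" for v
  proof (rule positive_lim)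
    show "(\<lambda>m. form n v (mat_vec n (\<lambda>i j. embed (Z m i j)) v)) \<longlonglongrightarrow> form n v (mat_vec n (\<lambda>i j. embed (X i j)) v)"
      unfolding form_def mat_vec_def using lim by (intro tendsto_intros) auto
    show "positive (form n v (mat_vec n (\<lambda>i j. embed (Z m i j)) v))" for m
      using pos unfolding positive_matrix_iff_form by blast
  qed
qed

lemma positive_matrix_add:
  fixes X Y :: "nat \<Rightarrow> nat \<Rightarrow> 'a::cstar_algebra"
  assumes "positive_matrix n X" "positive_matrix n Y"
  shows "positive_matrix n (\<lambda>i j. X i j + Y i j)"
proof -
  have "form n v (mat_vec n (\<lambda>i j. embed (X i j + Y i j)) v)
    = form n v (mat_vec n (\<lambda>i j. embed (X i j)) v) + form n v (mat_vec n (\<lambda>i j. embed (Y i j)) v)" for v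
    by (simp add: form_def mat_vec_def embed_simps algebra_simps sum.distrib)
  then show ?thesis
    using assms unfolding positive_matrix_iff_form by (simp add: star_add positive_add)
qed

lemma positive_matrix_rank_one:
  fixes y :: "nat \<Rightarrow> 'a::complex_star_algebra"
  shows "positive_matrix n (\<lambda>i j. star (y i) * y j)"
proof (cases n)
  case (Suc m)
  have "(\<Sum>l<n. star (if l = 0 then y i else 0) * (if l = 0 then y j else 0)) = star (y i) * y j" for i j
    unfolding Suc sum.lessThan_Suc_shift by simp
  then show ?thesis
    unfolding positive_matrix_def by (intro exI[of _ "\<lambda>l i. if l = 0 then y i else 0"]) simp
qed (simp add: positive_matrix_def)

lemma positive_matrix_sum:
  assumes "finite R" "\<And>r. r \<in> R \<Longrightarrow> positive_matrix n (X r)"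
  shows "positive_matrix n (\<lambda>i j. \<Sum>r\<in>R. X r i j :: 'a::cstar_algebra)"
  using assms
proof (induction R rule: finite_induct)
  case empty
  show ?case using positive_matrix_rank_one[of n "\<lambda>_. 0"] by simp
qed (auto intro: positive_matrix_add)

section \<open>Order zero maps\<close>

lemma clinear_iff:
  "clinear f \<longleftrightarrow> (\<forall>x y. f (x + y) = f x + f y) \<and> (\<forall>c x. f (scaleC c x) = scaleC c (f x))"
  unfolding Vector_Spaces.linear_iff
  by (simp add: complex_vector.vector_space_axioms)

lemma
  assumes "clinear f"
  shows clinear_add: "f (x + y) = f x + f y"
    and clinear_scaleC: "f (scaleC c x) = scaleC c (f x)"
    and clinear_zero: "f 0 = 0"
    and clinear_diff: "f (x - y) = f x - f y"
    and clinear_sum: "f (sum g S) = (\<Sum>i\<in>S. f (g i))"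
proof -
  interpret Vector_Spaces.linear scaleC scaleC f by (rule assms)
  show "f (x + y) = f x + f y" "f (scaleC c x) = scaleC c (f x)" "f 0 = 0"
    "f (x - y) = f x - f y" "f (sum g S) = (\<Sum>i\<in>S. f (g i))"
    by (simp_all add: add scale zero diff sum)
qed

lemma clinear_scaleR:
  "clinear f \<Longrightarrow> f (scaleR r x) = scaleR r (f (x::'a::cstar_algebra) :: 'b::cstar_algebra)"
  by (simp add: scaleR_eq_scaleC clinear_scaleC)

text \<open>Complete positivity is stated for initial segments of the naturals, while block matrices
  and sums of elementary tensors are indexed by pairs; a bijection transports it to any finite index
  set.\<close>

lemma completely_positive_gram:
  assumes \<phi>: "completely_positive \<phi>" and J: "finite J"
    and X: "\<And>i j. i \<in> J \<Longrightarrow> j \<in> J \<Longrightarrow> X i j = (\<Sum>l\<in>J. star (Z l i) * Z l j)"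
  obtains V where "\<And>i j. i \<in> J \<Longrightarrow> j \<in> J \<Longrightarrow> \<phi> (X i j) = (\<Sum>l\<in>J. star (V l i) * V l j)"
proof -
  obtain h where h: "bij_betw h {..<card J} J"
    using ex_bij_betw_nat_finite[OF J] by (auto simp: lessThan_atLeast0)
  have hJ: "h i \<in> J" if "i < card J" for i using h that by (auto simp: bij_betw_def)
  define k where "k = the_inv_into {..<card J} h"
  have k: "k i < card J" "h (k i) = i" if "i \<in> J" for i
    using h that the_inv_into_into[of h "{..<card J}" i] f_the_inv_into_f[of h "{..<card J}" i]
    by (auto simp: k_def bij_betw_def)
  have kh: "k (h l) = l" if "l < card J" for l
    using h that by (simp add: k_def the_inv_into_f_f bij_betw_def)
  have "positive_matrix (card J) (\<lambda>i j. X (h i) (h j))"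
    unfolding positive_matrix_def
    by (intro exI[of _ "\<lambda>l i. Z (h l) (h i)"] allI impI)
      (simp add: X hJ sum.reindex_bij_betw[OF h, of "\<lambda>l. star (Z l _) * Z l _"])
  then have "positive_matrix (card J) (\<lambda>i j. \<phi> (X (h i) (h j)))"
    using \<phi> by (simp add: completely_positive_def)
  then obtain Y where Y: "\<And>i j. i < card J \<Longrightarrow> j < card J \<Longrightarrow>
      \<phi> (X (h i) (h j)) = (\<Sum>l<card J. star (Y l i) * Y l j)"
    unfolding positive_matrix_def by blast
  show ?thesis
  proof
    fix i j assume ij: "i \<in> J" "j \<in> J"
    have "\<phi> (X i j) = (\<Sum>l<card J. star (Y l (k i)) * Y l (k j))"
      using Y[of "k i" "k j"] k ij by simp
    also have "\<dots> = (\<Sum>l<card J. star (Y (k (h l)) (k i)) * Y (k (h l)) (k j))"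
      by (simp add: kh)
    also have "\<dots> = (\<Sum>l\<in>J. star (Y (k l) (k i)) * Y (k l) (k j))"
      by (rule sum.reindex_bij_betw[OF h])
    finally show "\<phi> (X i j) = (\<Sum>l\<in>J. star (Y (k l) (k i)) * Y (k l) (k j))" .
  qed
qed

lemma completely_positive_rank_one:
  fixes \<phi> :: "'a::complex_star_algebra \<Rightarrow> 'b::complex_star_algebra"
  assumes \<phi>: "completely_positive \<phi>" and J: "finite J"
  obtains V where "\<And>i j. i \<in> J \<Longrightarrow> j \<in> J \<Longrightarrow> \<phi> (star (z i) * z j) = (\<Sum>l\<in>J. star (V l i) * V l j)"
proof (cases "J = {}")
  case False
  then obtain l0 where l0: "l0 \<in> J" by blast
  obtain V where "\<And>i j. i \<in> J \<Longrightarrow> j \<in> J \<Longrightarrow> \<phi> (star (z i) * z j) = (\<Sum>l\<in>J. star (V l i) * V l j)"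
  proof (rule completely_positive_gram[OF \<phi> J, of "\<lambda>i j. star (z i) * z j"])
    fix i j
    have "(\<Sum>l\<in>J. star (if l = l0 then z i else 0) * (if l = l0 then z j else 0))
      = (\<Sum>l\<in>J. if l = l0 then star (z i) * z j else 0)"
      by (rule sum.cong) auto
    then show "star (z i) * z j = (\<Sum>l\<in>J. star (if l = l0 then z i else 0) * (if l = l0 then z j else 0))"
      using l0 J by (simp add: sum.delta)
  qed blast
  then show ?thesis by (rule that)
qed (use that in blast)

section \<open>Local bilinear forms in continuous functions\<close>

definition clamp :: "real \<Rightarrow> real" where "clamp x = max 0 (min x 1)"

text \<open>
  The hat functions \<open>e\<^sub>i\<close> form a partition of unity with \<open>e\<^sub>i e\<^sub>j = 0\<close> for \<open>\<bar>i - j\<bar> > 1\<close>. Grouping them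
  by residues modulo 3 bounds \<open>\<Sum> (t\<^sub>i - t\<^sub>j) F(e\<^sub>i, e\<^sub>j)\<close> by nine terms of the size of the mesh.
\<close>

lemma local_bilinear_balanced:
  fixes F :: "(real \<Rightarrow> real) \<Rightarrow> (real \<Rightarrow> real) \<Rightarrow> 'b::real_normed_vector"
  assumes add_left: "\<And>f f' g. continuous_on UNIV f \<Longrightarrow> continuous_on UNIV f' \<Longrightarrow> continuous_on UNIV g \<Longrightarrow>
      F (\<lambda>t. f t + f' t) g = F f g + F f' g"
    and add_right: "\<And>f g g'. continuous_on UNIV f \<Longrightarrow> continuous_on UNIV g \<Longrightarrow> continuous_on UNIV g' \<Longrightarrow>
      F f (\<lambda>t. g t + g' t) = F f g + F f g'"
    and scale_left: "\<And>c f g. continuous_on UNIV f \<Longrightarrow> continuous_on UNIV g \<Longrightarrow>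
      F (\<lambda>t. c * f t) g = scaleR c (F f g)"
    and scale_right: "\<And>c f g. continuous_on UNIV f \<Longrightarrow> continuous_on UNIV g \<Longrightarrow>
      F f (\<lambda>t. c * g t) = scaleR c (F f g)"
    and bound: "\<And>f g k l. continuous_on UNIV f \<Longrightarrow> continuous_on UNIV g \<Longrightarrow>
      (\<And>t. \<bar>t\<bar> \<le> M \<Longrightarrow> \<bar>f t\<bar> \<le> k) \<Longrightarrow> (\<And>t. \<bar>t\<bar> \<le> M \<Longrightarrow> \<bar>g t\<bar> \<le> l) \<Longrightarrow> norm (F f g) \<le> C * k * l"
    and local: "\<And>f g. continuous_on UNIV f \<Longrightarrow> continuous_on UNIV g \<Longrightarrow>
      (\<And>t. \<bar>t\<bar> \<le> M \<Longrightarrow> f t * g t = 0) \<Longrightarrow> F f g = 0"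
    and M: "M \<ge> 0" and C: "C \<ge> 0"
  shows "F (\<lambda>t. t) (\<lambda>_. 1) = F (\<lambda>_. 1) (\<lambda>t. t)"
proof -
  \<comment> \<open>\<open>11 = 2 + 9\<close>: two errors from replacing \<open>t\<close> by its
    interpolant \<open>T\<close>, and one error for each of the nine pairs of residue
    classes.\<close>
  have small: "norm (F (\<lambda>t. t) (\<lambda>_. 1) - F (\<lambda>_. 1) (\<lambda>t. t)) \<le> 11 * C * \<delta>" if \<delta>: "\<delta> > 0" for \<delta>
  proof -
    obtain K :: nat where K: "2 * M / \<delta> \<le> real K" using real_arch_simple by blast
    \<comment> \<open>A difference of two ramps is the hat of half-width \<open>\<delta>\<close>
      around the node \<open>p i\<close>; written this way, the sum over \<open>i\<close>
      telescopes.\<close>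
    define e where "e i t = clamp ((t + M) / \<delta> - real i + 1) - clamp ((t + M) / \<delta> - real i)" for i :: nat and t
    define p where "p i = real i * \<delta> - M" for i :: nat
    have cont_clamp: "continuous_on UNIV (\<lambda>t. clamp (f t))" if "continuous_on UNIV f" for f :: "real \<Rightarrow> real"
      unfolding clamp_def by (intro continuous_intros that)
    have cont_e: "continuous_on UNIV (e i)" for i
      unfolding e_def[abs_def] using \<delta> by (intro continuous_intros cont_clamp) auto
    have e_nonneg: "e i t \<ge> 0" for i t by (simp add: e_def clamp_def)
    have e_nz: "\<bar>(t + M) / \<delta> - real i\<bar> < 1" if "e i t \<noteq> 0" for i t
      using that by (auto simp: e_def clamp_def max_def min_def split: if_splits)
    have e_sum: "(\<Sum>i\<le>K. e i t) = 1" if "\<bar>t\<bar> \<le> M" for t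
    proof -
      have "(\<Sum>i\<le>n. e i t) = clamp ((t + M) / \<delta> + 1) - clamp ((t + M) / \<delta> - real n)" for n
        by (induction n) (simp_all add: e_def)
      moreover have "(t + M) / \<delta> \<ge> 0" using that \<delta> by (auto simp: abs_le_iff)
      moreover have "(t + M) / \<delta> \<le> 2 * M / \<delta>" using that \<delta> by (intro divide_right_mono) auto
      ultimately show ?thesis using K by (simp add: clamp_def)
    qed
    have near: "\<bar>t - p i\<bar> * e i t \<le> \<delta> * e i t" for i t
    proof (cases "e i t = 0")
      case False
      have "t - p i = \<delta> * ((t + M) / \<delta> - real i)" using \<delta> by (simp add: p_def field_simps)
      then have "\<bar>t - p i\<bar> \<le> \<delta> * 1"
        using e_nz[OF False] \<delta> by (simp only: abs_mult) (intro mult_mono, auto)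
      then show ?thesis by (intro mult_right_mono e_nonneg) simp
    qed simp
    define T where "T t = (\<Sum>i\<le>K. p i * e i t)" for t
    define E where "E t = (\<Sum>i\<le>K. e i t)" for t
    have cont: "continuous_on UNIV T" "continuous_on UNIV E"
      unfolding T_def[abs_def] E_def[abs_def] by (intro continuous_intros cont_e)+
    have T: "\<bar>t - T t\<bar> \<le> \<delta>" if "\<bar>t\<bar> \<le> M" for t
    proof -
      have "t - T t = (\<Sum>i\<le>K. (t - p i) * e i t)"
        using e_sum[OF that] by (simp add: T_def algebra_simps sum_subtractf flip: sum_distrib_left)
      also have "\<bar>\<dots>\<bar> \<le> (\<Sum>i\<le>K. \<delta> * e i t)"
        using near by (intro order.trans[OF sum_abs] sum_mono) (simp add: abs_mult e_nonneg)
      also have "\<dots> = \<delta>" using e_sum[OF that] by (simp flip: sum_distrib_left)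
      finally show ?thesis .
    qed
    have sum_left: "F (\<lambda>t. \<Sum>i\<in>A. f i t) g = (\<Sum>i\<in>A. F (f i) g)"
      if "\<And>i. continuous_on UNIV (f i)" "continuous_on UNIV g" for f :: "nat \<Rightarrow> real \<Rightarrow> real" and A g
    proof (induction A rule: infinite_finite_induct)
      case (insert x A)
      then show ?case using that by (simp add: add_left continuous_on_sum)
    qed (use that in \<open>simp_all add: local continuous_on_const\<close>)
    have sum_right: "F f (\<lambda>t. \<Sum>i\<in>A. g i t) = (\<Sum>i\<in>A. F f (g i))"
      if "\<And>i. continuous_on UNIV (g i)" "continuous_on UNIV f" for g :: "nat \<Rightarrow> real \<Rightarrow> real" and A f
    proof (induction A rule: infinite_finite_induct)
      case (insert x A)
      then show ?case using that by (simp add: add_right continuous_on_sum)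
    qed (use that in \<open>simp_all add: local continuous_on_const\<close>)
    have diff_left: "norm (F f g - F f' g) \<le> C * k * l"
      if "continuous_on UNIV f" "continuous_on UNIV f'" "continuous_on UNIV g"
        "\<And>t. \<bar>t\<bar> \<le> M \<Longrightarrow> \<bar>f t - f' t\<bar> \<le> k" "\<And>t. \<bar>t\<bar> \<le> M \<Longrightarrow> \<bar>g t\<bar> \<le> l" for f f' g k l
      using bound[of "\<lambda>t. f t - f' t" g k l] add_left[of "\<lambda>t. f t - f' t" f' g] that
      by (simp add: continuous_on_diff)
    have diff_right: "norm (F f g - F f g') \<le> C * k * l"
      if "continuous_on UNIV g" "continuous_on UNIV g'" "continuous_on UNIV f"
        "\<And>t. \<bar>t\<bar> \<le> M \<Longrightarrow> \<bar>g t - g' t\<bar> \<le> l" "\<And>t. \<bar>t\<bar> \<le> M \<Longrightarrow> \<bar>f t\<bar> \<le> k" for f g g' k l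
      using bound[of f "\<lambda>t. g t - g' t" k l] add_right[of f "\<lambda>t. g t - g' t" g'] that
      by (simp add: continuous_on_diff)
    have 1: "norm (F (\<lambda>t. t) (\<lambda>_. 1) - F T (\<lambda>_. 1)) \<le> C * \<delta> * 1"
      using T by (intro diff_left cont) (auto intro: continuous_intros)
    have 2: "norm (F (\<lambda>_. 1) (\<lambda>t. t) - F (\<lambda>_. 1) T) \<le> C * 1 * \<delta>"
      using T by (intro diff_right cont) (auto intro: continuous_intros)
    \<comment> \<open>\<open>E\<close> equals 1 on \<open>[-M, M]\<close>, so the factor 0 makes
      this replacement exact; \<open>\<bar>M\<bar> + \<delta>\<close> only bounds
      \<open>T\<close>.\<close>
    have "norm (F T (\<lambda>_. 1) - F T E) \<le> C * (\<bar>M\<bar> + \<delta>) * 0"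
      using e_sum T by (intro diff_right cont) (fastforce simp: E_def intro: continuous_intros)+
    then have 3: "F T (\<lambda>_. 1) = F T E" by simp
    have "norm (F (\<lambda>_. 1) T - F E T) \<le> C * 0 * (\<bar>M\<bar> + \<delta>)"
      using e_sum T by (intro diff_left cont) (fastforce simp: E_def intro: continuous_intros)+
    then have 4: "F (\<lambda>_. 1) T = F E T" by simp
    have FTE: "F T E = (\<Sum>i\<le>K. \<Sum>j\<le>K. scaleR (p i) (F (e i) (e j)))"
      unfolding T_def[abs_def] E_def[abs_def]
      by (simp add: sum_left sum_right scale_left cont_e continuous_intros)
    have FET: "F E T = (\<Sum>i\<le>K. \<Sum>j\<le>K. scaleR (p j) (F (e i) (e j)))"
      unfolding T_def[abs_def] E_def[abs_def]
      by (simp add: sum_left sum_right scale_right cont_e continuous_intros)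
    \<comment> \<open>The representative of \<open>r - r'\<close> modulo 3 in
      \<open>{-1, 0, 1}\<close>. It equals \<open>i - j\<close> whenever
      \<open>F (e i) (e j)\<close> can be nonzero, but depends only on residues, so it can be taken
      out of the sums over residue classes.\<close>
    define off where "off r r' = real_of_int ((int r - int r' + 1) mod 3 - 1)" for r r' :: nat
    have off: "scaleR (p i - p j) (F (e i) (e j)) = scaleR (\<delta> * off (i mod 3) (j mod 3)) (F (e i) (e j))" for i j
    proof (cases "\<bar>int i - int j\<bar> \<le> 1")
      case True
      then have "int i - int j \<in> {-1, 0, 1}" by auto
      moreover have "off (i mod 3) (j mod 3) = real_of_int ((int i - int j + 1) mod 3 - 1)"
        unfolding off_def by (simp add: zmod_int) (metis mod_add_left_eq mod_diff_eq)
      ultimately have "off (i mod 3) (j mod 3) = real_of_int (int i - int j)" by auto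
      moreover have "p i - p j = \<delta> * real_of_int (int i - int j)" by (simp add: p_def algebra_simps)
      ultimately show ?thesis by simp
    next
      case False
      have "e i t * e j t = 0" for t
      proof (rule ccontr)
        assume "e i t * e j t \<noteq> 0"
        then have "\<bar>(t + M) / \<delta> - real i\<bar> < 1" "\<bar>(t + M) / \<delta> - real j\<bar> < 1" using e_nz by auto
        then have "\<bar>real i - real j\<bar> < 2" by linarith
        with False show False by linarith
      qed
      then have "F (e i) (e j) = 0" by (intro local cont_e)
      then show ?thesis by simp
    qed
    define V where "V r t = (\<Sum>i\<in>{i\<in>{..K}. i mod 3 = r}. e i t)" for r :: nat and t
    have cont_V: "continuous_on UNIV (V r)" for r
      unfolding V_def[abs_def] by (intro continuous_intros cont_e)
    have V_le: "\<bar>V r t\<bar> \<le> 1" if "\<bar>t\<bar> \<le> M" for r t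
    proof -
      have "V r t \<ge> 0" unfolding V_def by (intro sum_nonneg e_nonneg)
      moreover have "V r t \<le> (\<Sum>i\<le>K. e i t)"
        unfolding V_def by (rule sum_mono2) (auto simp: e_nonneg)
      ultimately show ?thesis using e_sum[OF that] by simp
    qed
    have group: "(\<Sum>i\<le>K. f i) = (\<Sum>r<3. \<Sum>i\<in>{i\<in>{..K}. i mod 3 = r}. f i)" for f :: "nat \<Rightarrow> 'b"
      by (rule sum.group[symmetric]) auto
    have "F T E - F E T = (\<Sum>i\<le>K. \<Sum>j\<le>K. scaleR (\<delta> * off (i mod 3) (j mod 3)) (F (e i) (e j)))"
      unfolding FTE FET by (simp add: sum_subtractf[symmetric] off flip: scaleR_diff_left)
    also have "\<dots> = (\<Sum>i\<le>K. \<Sum>r'<3. \<Sum>j\<in>{j\<in>{..K}. j mod 3 = r'}.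
        scaleR (\<delta> * off (i mod 3) (j mod 3)) (F (e i) (e j)))"
      by (intro sum.cong refl group)
    also have "\<dots> = (\<Sum>r<3. \<Sum>i\<in>{i\<in>{..K}. i mod 3 = r}. \<Sum>r'<3. \<Sum>j\<in>{j\<in>{..K}. j mod 3 = r'}.
        scaleR (\<delta> * off (i mod 3) (j mod 3)) (F (e i) (e j)))"
      by (rule group)
    also have "\<dots> = (\<Sum>r<3. \<Sum>i\<in>{i\<in>{..K}. i mod 3 = r}. \<Sum>r'<3. scaleR (\<delta> * off r r') (F (e i) (V r')))"
      by (intro sum.cong refl) (simp add: V_def[abs_def] sum_right cont_e scaleR_sum_right)
    also have "\<dots> = (\<Sum>r<3. \<Sum>r'<3. scaleR (\<delta> * off r r') (F (V r) (V r')))"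
    proof (rule sum.cong[OF refl])
      fix r :: nat
      have "(\<Sum>i\<in>{i\<in>{..K}. i mod 3 = r}. \<Sum>r'<3. scaleR (\<delta> * off r r') (F (e i) (V r')))
        = (\<Sum>r'<3. \<Sum>i\<in>{i\<in>{..K}. i mod 3 = r}. scaleR (\<delta> * off r r') (F (e i) (V r')))"
        by (rule sum.swap)
      also have "\<dots> = (\<Sum>r'<3. scaleR (\<delta> * off r r') (F (V r) (V r')))"
        by (intro sum.cong refl) (simp add: V_def[of r, abs_def] sum_left cont_e cont_V scaleR_sum_right)
      finally show "(\<Sum>i\<in>{i\<in>{..K}. i mod 3 = r}. \<Sum>r'<3. scaleR (\<delta> * off r r') (F (e i) (V r')))
        = (\<Sum>r'<3. scaleR (\<delta> * off r r') (F (V r) (V r')))" .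
    qed
    finally have "norm (F T E - F E T) \<le> (\<Sum>r<3::nat. \<Sum>r'<3::nat. C * \<delta>)"
    proof (simp only:, intro sum_norm_le)
      fix r r' :: nat
      have "\<bar>off r r'\<bar> \<le> 1"
        unfolding off_def using pos_mod_bound[of 3 "int r - int r' + 1"] pos_mod_sign[of 3 "int r - int r' + 1"]
        by linarith
      moreover have "norm (F (V r) (V r')) \<le> C"
        using bound[OF cont_V cont_V, of r 1 r' 1] V_le by simp
      ultimately have "\<bar>off r r'\<bar> * norm (F (V r) (V r')) \<le> 1 * C"
        by (intro mult_mono) auto
      then have "\<delta> * (\<bar>off r r'\<bar> * norm (F (V r) (V r'))) \<le> \<delta> * C"
        using \<delta> by (intro mult_left_mono) auto
      then show "norm (scaleR (\<delta> * off r r') (F (V r) (V r'))) \<le> C * \<delta>"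
        using \<delta> by (simp add: abs_mult mult.commute mult.left_commute)
    qed
    then have 5: "norm (F T E - F E T) \<le> 9 * C * \<delta>" by simp
    have "F (\<lambda>t. t) (\<lambda>_. 1) - F (\<lambda>_. 1) (\<lambda>t. t) = (F (\<lambda>t. t) (\<lambda>_. 1) - F T (\<lambda>_. 1))
      - (F (\<lambda>_. 1) (\<lambda>t. t) - F (\<lambda>_. 1) T) + (F T E - F E T)"
      by (simp add: 3 4)
    also have "norm \<dots> \<le> (C * \<delta> * 1 + C * 1 * \<delta>) + 9 * C * \<delta>"
      by (intro norm_triangle_le add_mono 5 order.trans[OF norm_triangle_ineq4] 1 2)
    finally show ?thesis by (simp add: algebra_simps)
  qed
  have "norm (F (\<lambda>t. t) (\<lambda>_. 1) - F (\<lambda>_. 1) (\<lambda>t. t)) \<le> 0"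
  proof (rule field_le_epsilon)
    fix x :: real assume x: "x > 0"
    have "11 * C * (x / (11 * C + 1)) \<le> x"
      using x C by (simp add: field_simps)
    then show "norm (F (\<lambda>t. t) (\<lambda>_. 1) - F (\<lambda>_. 1) (\<lambda>t. t)) \<le> 0 + x"
      using small[of "x / (11 * C + 1)"] x C by simp
  qed
  then show ?thesis by simp
qed

section \<open>The key identity for order zero maps\<close>

locale cpc_order_zero =
  fixes \<phi> :: "'a::cstar_algebra \<Rightarrow> 'b::cstar_algebra"
  assumes cpc: "cpc \<phi>" and order_zero: "order_zero \<phi>"
begin

lemma norm_le: "norm (\<phi> a) \<le> norm a"
  using cpc by (simp add: cpc_def)

lemma cp: "completely_positive \<phi>"
  using cpc by (simp add: cpc_def)

lemma clinear: "clinear \<phi>"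
  using cp by (simp add: completely_positive_def)

lemmas add = clinear_add[OF clinear] and scaleC = clinear_scaleC[OF clinear]
  and diff = clinear_diff[OF clinear] and sum = clinear_sum[OF clinear]
  and scaleR = clinear_scaleR[OF clinear]

text \<open>Complete positivity of the rank-one 2 x 2 matrix built from \<open>x\<close> and
  \<open>y\<close>; the resulting Gram vectors do the work of a Stinespring dilation.\<close>

lemma star_mult_pair:
  obtains V :: "nat \<Rightarrow> nat \<Rightarrow> 'b" where "\<phi> (star x * x) = (\<Sum>l<2. star (V l 0) * V l 0)"
    "\<phi> (star x * y) = (\<Sum>l<2. star (V l 0) * V l 1)" "\<phi> (star y * x) = (\<Sum>l<2. star (V l 1) * V l 0)"
    "\<phi> (star y * y) = (\<Sum>l<2. star (V l 1) * V l 1)"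
proof -
  define z where "z i = (if i = 0 then x else y)" for i :: nat
  obtain V :: "nat \<Rightarrow> nat \<Rightarrow> 'b" where V: "\<And>i j. i \<in> {..<2} \<Longrightarrow> j \<in> {..<2} \<Longrightarrow>
      \<phi> (star (z i) * z j) = (\<Sum>l<2. star (V l i) * V l j)"
    using completely_positive_rank_one[OF cp, of "{..<2}" z] by blast
  from V[of 0 0] V[of 0 1] V[of 1 0] V[of 1 1] show ?thesis
    by (intro that[of V]) (simp_all add: z_def)
qed

text \<open>The Gram vectors give the claim for products, and an approximate unit makes every
  element a limit of products.\<close>

lemma star_preserving: "\<phi> (star a) = star (\<phi> a)"
proof -
  have prod: "\<phi> (star (x * y)) = star (\<phi> (x * y))" for x y
  proof -
    obtain V :: "nat \<Rightarrow> nat \<Rightarrow> 'b" where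
      "\<phi> (star (star x) * (star x)) = (\<Sum>l<2. star (V l 0) * V l 0)"
      "\<phi> (star (star x) * y) = (\<Sum>l<2. star (V l 0) * V l 1)" "\<phi> (star y * (star x)) = (\<Sum>l<2. star (V l 1) * V l 0)"
      "\<phi> (star y * y) = (\<Sum>l<2. star (V l 1) * V l 1)"
      by (rule star_mult_pair)
    then show ?thesis by (simp add: star_mult star_star star_sum)
  qed
  have "norm (\<phi> (star a) - star (\<phi> a)) \<le> 0"
  proof (rule field_le_epsilon)
    fix e :: real assume "e > 0"
    then obtain u where u: "norm (a * u - a) \<le> e / 2"
      using approximate_unit[of "{a}" "e / 2"] by (metis finite.emptyI finite.insertI half_gt_zero insertI1)
    have "\<phi> (star a) - star (\<phi> a) = star (\<phi> (a * u - a)) - \<phi> (star (a * u - a))"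
      by (simp add: star_diff diff prod)
    also have "norm \<dots> \<le> norm (a * u - a) + norm (a * u - a)"
      using norm_le[of "a * u - a"] norm_le[of "star (a * u - a)"]
      by (intro order.trans[OF norm_triangle_ineq4] add_mono) simp_all
    finally show "norm (\<phi> (star a) - star (\<phi> a)) \<le> 0 + e" using u by simp
  qed
  then show ?thesis by simp
qed

text \<open>The hypothesis makes a sum of squares of \<open>V l 1 * q\<close> vanish, hence each of
  these elements; they are right factors of \<open>\<phi> (star x * y) * q\<close>.\<close>

lemma annihilate_right:
  assumes "\<phi> (star y * y) * q = 0"
  shows "\<phi> (star x * y) * q = 0"
proof -
  obtain V :: "nat \<Rightarrow> nat \<Rightarrow> 'b" where V: "\<phi> (star x * x) = (\<Sum>l<2. star (V l 0) * V l 0)"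
    "\<phi> (star x * y) = (\<Sum>l<2. star (V l 0) * V l 1)" "\<phi> (star y * x) = (\<Sum>l<2. star (V l 1) * V l 0)"
    "\<phi> (star y * y) = (\<Sum>l<2. star (V l 1) * V l 1)"
    by (rule star_mult_pair)
  have "(\<Sum>l<2. star (V l 1 * q) * (V l 1 * q)) = star q * (\<phi> (star y * y) * q)"
    by (simp add: V star_mult sum_distrib_left sum_distrib_right mult.assoc)
  then have "(\<Sum>l<2. star (V l 1 * q) * (V l 1 * q)) = 0" by (simp add: assms)
  then have "V l 1 * q = 0" if "l < 2" for l
    using sum_star_mult_eq_0[of "{..<2}" "\<lambda>l. V l 1 * q" l] that by simp
  then show ?thesis by (simp add: V sum_distrib_right mult.assoc)
qed

lemma annihilate_left:
  assumes "q * \<phi> (star y * y) = 0"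
  shows "q * \<phi> (star y * x) = 0"
proof -
  have "\<phi> (star y * y) * star q = star (q * \<phi> (star y * y))"
    by (simp add: star_mult star_star flip: star_preserving)
  then have "\<phi> (star x * y) * star q = 0" using assms by (simp add: annihilate_right)
  then have "star (\<phi> (star x * y) * star q) = 0" by simp
  then show ?thesis by (simp add: star_mult star_star flip: star_preserving)
qed

text \<open>Approximate units \<open>u\<close> for \<open>x\<close> and \<open>v\<close> for
  \<open>star y\<close> inherit annihilators, so \<open>x * y = 0\<close> gives
  \<open>u * v = v * u = 0\<close> exactly. Order zero applies to \<open>u * u\<close> and
  \<open>v * v\<close>, and the annihilation lemmas carry the vanishing over to
  \<open>\<phi> (x * u) * \<phi> (v * y)\<close>, which is close to the product in question.\<close>

lemma zero_product:
  assumes "x * y = 0"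
  shows "\<phi> x * \<phi> y = 0"
proof -
  have "norm (\<phi> x * \<phi> y) \<le> 0"
  proof (rule field_le_epsilon)
    fix d :: real assume "d > 0"
    define e where "e = d / (norm x + norm y + 1)"
    have e: "e > 0" using \<open>d > 0\<close> by (simp add: e_def add_nonneg_pos)
    obtain u where u: "star u = u" "norm u \<le> 1" "norm (x * u - x) \<le> e" "\<And>w. x * w = 0 \<Longrightarrow> u * w = 0"
      using approximate_unit[of "{x}" e] e by (metis finite.emptyI finite.insertI singletonD singletonI)
    obtain v where v: "star v = v" "norm v \<le> 1" "norm (star y * v - star y) \<le> e"
      "\<And>w. star y * w = 0 \<Longrightarrow> v * w = 0"
      using approximate_unit[of "{star y}" e] e by (metis finite.emptyI finite.insertI singletonD singletonI)
    have "star (v * y - y) = star y * v - star y" by (simp add: star_diff star_mult v)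
    then have vy: "norm (v * y - y) \<le> e" using v(3) by (metis norm_star)
    have "u * y = 0" using u(4) assms by simp
    then have "star (u * y) = 0" by simp
    then have vu: "v * u = 0" using v(4) by (simp add: star_mult u(1))
    then have "star (v * u) = 0" by simp
    then have uv: "u * v = 0" by (simp add: star_mult u(1) v(1))
    have "orthogonal_elements (u * u) (v * v)"
      unfolding orthogonal_elements_def by (simp add: star_mult u(1) v(1) mult.assoc)
        (simp add: uv vu flip: mult.assoc)
    moreover have "positive (u * u)" "positive (v * v)"
      using positive_star_mult[of u] positive_star_mult[of v] u(1) v(1) by simp_all
    ultimately have "\<phi> (star u * u) * \<phi> (star v * v) = 0"
      using order_zero u(1) v(1) unfolding order_zero_def orthogonal_elements_def by auto
    from annihilate_right[OF this, of "star x"] have "\<phi> (x * u) * \<phi> (star v * v) = 0"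
      by (simp add: star_star)
    from annihilate_left[OF this, of y] have "\<phi> (x * u) * \<phi> (v * y) = 0" by (simp add: v)
    then have "\<phi> x * \<phi> y = - (\<phi> (x * u - x) * \<phi> y) - \<phi> (x * u) * \<phi> (v * y - y)"
      by (simp add: diff algebra_simps)
    also have "norm \<dots> \<le> e * norm y + norm x * e"
    proof (intro order.trans[OF norm_triangle_ineq4] add_mono)
      show "norm (- (\<phi> (x * u - x) * \<phi> y)) \<le> e * norm y"
        using u(3) norm_le[of "x * u - x"] norm_le[of y] e
        by (auto intro!: order.trans[OF norm_mult_ineq] mult_mono)
      have "norm (x * u) \<le> norm x"
        using norm_mult_ineq[of x u] mult_left_le[OF u(2) norm_ge_zero[of x]] by linarith
      then show "norm (\<phi> (x * u) * \<phi> (v * y - y)) \<le> norm x * e"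
        using vy norm_le[of "x * u"] norm_le[of "v * y - y"] e
        by (auto intro!: order.trans[OF norm_mult_ineq] mult_mono)
    qed
    also have "\<dots> \<le> (norm x + norm y + 1) * e" using e by (simp add: algebra_simps)
    also have "\<dots> = d"
      using norm_ge_zero[of x] norm_ge_zero[of y] by (simp add: e_def del: norm_ge_zero)
    finally show "norm (\<phi> x * \<phi> y) \<le> 0 + d" by simp
  qed
  then show ?thesis by simp
qed

lemma balanced_self_adjoint:
  assumes b: "star b = b"
  shows "\<phi> (a * b) * \<phi> c = \<phi> a * \<phi> (b * c)"
proof -
  have H: "star (embed b) = embed b" using b by (simp flip: embed_simps)
  \<comment> \<open>\<open>f (b)\<close> may have a scalar part, but its product with an element of
    the ideal has none, so taking \<open>base\<close> loses nothing.\<close>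
  define L where "L f = base (embed a * fc (embed b) f)" for f
  define R where "R f = base (fc (embed b) f * embed c)" for f
  have L: "embed (L f) = embed a * fc (embed b) f" for f
    unfolding L_def by (rule embed_base) simp
  have R: "embed (R f) = fc (embed b) f * embed c" for f
    unfolding R_def by (rule embed_base) simp
  have L_add: "L (\<lambda>t. f t + g t) = L f + L g" and R_add: "R (\<lambda>t. f t + g t) = R f + R g"
    if "continuous_on UNIV f" "continuous_on UNIV g" for f g
    unfolding L_def R_def fc_add[OF H that] distrib_left distrib_right by simp_all
  have L_scale: "L (\<lambda>t. k * f t) = scaleR k (L f)" and R_scale: "R (\<lambda>t. k * f t) = scaleR k (R f)"
    if "continuous_on UNIV f" for f k
    unfolding L_def R_def fc_mult[OF H continuous_on_const that] fc_const[OF H] of_real_def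
    by (simp_all only: mult_scaleR_left mult_scaleR_right mult_1_left base_simps(8))
  have L_norm: "norm (L f) \<le> norm a * k" and R_norm: "norm (R f) \<le> k * norm c"
    if "continuous_on UNIV f" "\<And>t. \<bar>t\<bar> \<le> norm b \<Longrightarrow> \<bar>f t\<bar> \<le> k" for f k
  proof -
    have *: "norm (fc (embed b) f) \<le> k" by (rule norm_fc_le[OF H that(1)]) (simp add: that(2))
    have "norm (embed (L f)) \<le> norm a * k"
      unfolding L using mult_left_mono[OF *, of "norm a"]
      by (intro order.trans[OF norm_mult_ineq]) simp
    then show "norm (L f) \<le> norm a * k" by simp
    have "norm (embed (R f)) \<le> k * norm c"
      unfolding R using mult_right_mono[OF *, of "norm c"]
      by (intro order.trans[OF norm_mult_ineq]) simp
    then show "norm (R f) \<le> k * norm c" by simp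
  qed
  have "\<phi> (L (\<lambda>t. t)) * \<phi> (R (\<lambda>_. 1)) = \<phi> (L (\<lambda>_. 1)) * \<phi> (R (\<lambda>t. t))"
  proof (rule local_bilinear_balanced[where F = "\<lambda>f g. \<phi> (L f) * \<phi> (R g)" and M = "norm b" and C = "norm a * norm c"])
    fix f g :: "real \<Rightarrow> real" and k l
    assume f: "continuous_on UNIV f" and g: "continuous_on UNIV g"
    {
      assume k: "\<And>t. \<bar>t\<bar> \<le> norm b \<Longrightarrow> \<bar>f t\<bar> \<le> k" and l: "\<And>t. \<bar>t\<bar> \<le> norm b \<Longrightarrow> \<bar>g t\<bar> \<le> l"
      have "k \<ge> 0" using k[of 0] by simp
      have "norm (\<phi> (L f) * \<phi> (R g)) \<le> (norm a * k) * (l * norm c)"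
        using order.trans[OF norm_le L_norm[OF f k]] order.trans[OF norm_le R_norm[OF g l]] \<open>k \<ge> 0\<close>
        by (intro order.trans[OF norm_mult_ineq] mult_mono) auto
      then show "norm (\<phi> (L f) * \<phi> (R g)) \<le> norm a * norm c * k * l"
        by (simp add: mult_ac)
    }
    {
      assume "\<And>t. \<bar>t\<bar> \<le> norm b \<Longrightarrow> f t * g t = 0"
      then have "fc (embed b) f * fc (embed b) g = fc (embed b) (\<lambda>_. 0)"
        unfolding fc_mult[OF H f g, symmetric] by (intro fc_cong[OF H]) simp
      then have "embed (L f * R g) = 0"
        unfolding embed_simps L R by (simp add: fc_const[OF H] mult.assoc)
          (simp add: fc_const[OF H] flip: mult.assoc)
      then have "L f * R g = 0" by (metis embed_simps(3) unitization.inject)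
      then show "\<phi> (L f) * \<phi> (R g) = 0" by (rule zero_product)
    }
  qed (simp_all add: L_add R_add L_scale R_scale add scaleR distrib_left distrib_right)
  moreover have "L (\<lambda>_. 1) = a" "R (\<lambda>_. 1) = c" "L (\<lambda>t. t) = a * b" "R (\<lambda>t. t) = b * c"
    by (simp_all add: L_def R_def fc_const[OF H] fc_id[OF H])
  ultimately show ?thesis by simp
qed

lemma balanced: "\<phi> (a * b) * \<phi> c = \<phi> a * \<phi> (b * c)"
proof -
  define x where "x = scaleC (1/2) (b + star b)"
  define y where "y = scaleC (- \<i>/2) (b - star b)"
  have sa: "star x = x" "star y = y"
    by (simp_all add: x_def y_def star_scaleC star_add star_diff star_star add.commute
        complex_vector.scale_right_diff_distrib complex_vector.scale_minus_left)
  have "scaleC (1/2) z + scaleC (1/2) z = z" for z :: 'a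
    by (simp add: scaleC_one flip: scaleC_add_left)
  then have b: "b = x + scaleC \<i> y"
    by (simp add: x_def y_def scaleC_scaleC scaleC_add_right complex_vector.scale_right_diff_distrib)
  show ?thesis
    unfolding b by (simp add: distrib_left distrib_right add scaleC scaleC_mult_left scaleC_mult_right
        balanced_self_adjoint sa)
qed

end

text \<open>The C*-identity enters only as \<open>proper\<close>, so that the lemma also applies to
  matrix algebras, where no norm is given and \<open>proper\<close> is read off from the diagonal
  entries.\<close>

lemma order_zero_if_balanced:
  fixes \<Phi> :: "'a::complex_star_algebra \<Rightarrow> 'b::complex_star_algebra"
  assumes cp: "completely_positive \<Phi>"
    and star: "\<And>x. \<Phi> (star x) = star (\<Phi> x)"
    and balanced: "\<And>x y z. \<Phi> (x * y) * \<Phi> z = \<Phi> x * \<Phi> (y * z)"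
    and proper: "\<And>x :: 'a. star x * x = 0 \<Longrightarrow> x = 0"
  shows "order_zero \<Phi>"
proof -
  have zero: "\<Phi> 0 = 0"
    using cp by (simp add: completely_positive_def clinear_zero)
  have prod: "\<Phi> x * \<Phi> y = 0" if x: "positive x" and "x * y = 0" for x y
  proof -
    obtain s where s: "x = star s * s" using x by (auto simp: positive_def)
    have "star (s * y) * (s * y) = star y * (x * y)" by (simp add: s star_mult mult.assoc)
    also have "\<dots> = 0" by (simp only: that(2) mult_zero_right)
    finally have "s * y = 0" by (rule proper)
    then show ?thesis by (simp add: s balanced zero)
  qed
  have "orthogonal_elements (\<Phi> x) (\<Phi> y)"
    if "positive x" "positive y" "orthogonal_elements x y" for x y
    using that prod[of x y] prod[of y x]
    by (simp add: orthogonal_elements_def positive_star flip: star)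
  with cp show ?thesis by (simp add: order_zero_def)
qed

section \<open>Amplification to matrices\<close>

lemma entry_simps [simp]:
  "entry 0 i j = 0" "entry (X + Y) i j = entry X i j + entry Y i j"
  "entry (X * Y) i j = (\<Sum>l\<in>UNIV. entry X i l * entry Y l j)"
  "entry (scaleC c X) i j = scaleC c (entry X i j)" "entry (star X) i j = star (entry X j i)"
  by (simp_all add: zero_cmat.rep_eq plus_cmat.rep_eq times_cmat.rep_eq scaleC_cmat.rep_eq star_cmat.rep_eq)

lemma entry_Mat [simp]: "entry (Mat f) i j = f i j"
  by (simp add: Mat_inverse)

lemma entry_sum: "entry (\<Sum>l\<in>A. f l) i j = (\<Sum>l\<in>A. entry (f l) i j)"
  by (induction A rule: infinite_finite_induct) simp_all

lemma cmat_eqI: "(\<And>i j. entry X i j = entry Y i j) \<Longrightarrow> X = Y"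
  by (metis entry_inject ext)

lemma entry_amplification [simp]: "entry (amplification \<phi> X) i j = \<phi> (entry X i j)"
  by (simp add: amplification_def)

text \<open>An \<open>n\<close> x \<open>n\<close> matrix of \<open>k\<close> x \<open>k\<close>
  matrices is one matrix indexed by pairs, so a Gram factor over pairs for \<open>\<phi>\<close>
  regroups into one for the amplification.\<close>

lemma completely_positive_amplification:
  assumes \<phi>: "completely_positive \<phi>"
  shows "completely_positive (amplification \<phi> ::
    ('a::complex_star_algebra, 'k::finite) cmat \<Rightarrow> ('b::complex_star_algebra, 'k) cmat)"
  unfolding completely_positive_def
proof (intro conjI allI impI)
  have lin: "clinear \<phi>" using \<phi> by (simp add: completely_positive_def)
  show "clinear (amplification \<phi> :: ('a, 'k) cmat \<Rightarrow> ('b, 'k) cmat)"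
    unfolding clinear_iff by (auto intro!: cmat_eqI simp: clinear_add[OF lin] clinear_scaleC[OF lin])
  fix n and X :: "nat \<Rightarrow> nat \<Rightarrow> ('a, 'k) cmat"
  assume "positive_matrix n X"
  then obtain Z where Z: "\<And>i j. i < n \<Longrightarrow> j < n \<Longrightarrow> X i j = (\<Sum>l<n. star (Z l i) * Z l j)"
    unfolding positive_matrix_def by blast
  define J where "J = {..<n} \<times> (UNIV :: 'k set)"
  define W where "W = (\<lambda>(l, m) (i, r). entry (Z l i) m r)"
  define G where "G = (\<lambda>(i, r) (j, s). entry (X i j) r s)"
  obtain V where V: "\<And>\<alpha> \<beta>. \<alpha> \<in> J \<Longrightarrow> \<beta> \<in> J \<Longrightarrow> \<phi> (G \<alpha> \<beta>) = (\<Sum>l\<in>J. star (V l \<alpha>) * V l \<beta>)"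
  proof (rule completely_positive_gram[OF \<phi>, of J G])
    show "finite J" by (simp add: J_def)
    fix \<alpha> \<beta> assume "\<alpha> \<in> J" "\<beta> \<in> J"
    then show "G \<alpha> \<beta> = (\<Sum>l\<in>J. star (W l \<alpha>) * W l \<beta>)"
      by (auto simp: G_def J_def W_def Z entry_sum sum.cartesian_product intro!: sum.cong)
  qed blast
  show "positive_matrix n (\<lambda>i j. amplification \<phi> (X i j))"
    unfolding positive_matrix_def
  proof (intro exI allI impI cmat_eqI)
    fix i j r s assume "i < n" "j < n"
    then have "\<phi> (G (i, r) (j, s)) = (\<Sum>l\<in>J. star (V l (i, r)) * V l (j, s))"
      by (intro V) (simp_all add: J_def)
    then show "entry (amplification \<phi> (X i j)) r s
      = entry (\<Sum>l<n. star (Mat (\<lambda>m r. V (l, m) (i, r))) * Mat (\<lambda>m r. V (l, m) (j, r))) r s"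
      by (simp add: G_def entry_sum J_def sum.cartesian_product case_prod_beta)
  qed
qed

lemma (in cpc_order_zero) order_zero_amplification:
  "order_zero (amplification \<phi> :: ('a, 'k::finite) cmat \<Rightarrow> ('b, 'k) cmat)"
proof (rule order_zero_if_balanced)
  show "completely_positive (amplification \<phi> :: ('a, 'k) cmat \<Rightarrow> ('b, 'k) cmat)"
    by (rule completely_positive_amplification[OF cp])
  fix X Y Z :: "('a, 'k) cmat"
  show "amplification \<phi> (star X) = star (amplification \<phi> X)"
    by (rule cmat_eqI) (simp add: star_preserving)
  show "amplification \<phi> (X * Y) * amplification \<phi> Z = amplification \<phi> X * amplification \<phi> (Y * Z)"
  proof (rule cmat_eqI)
    fix i j
    have "entry (amplification \<phi> (X * Y) * amplification \<phi> Z) i j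
      = (\<Sum>l\<in>UNIV. \<Sum>m\<in>UNIV. \<phi> (entry X i m) * \<phi> (entry Y m l * entry Z l j))"
      by (simp add: sum sum_distrib_right balanced)
    also have "\<dots> = (\<Sum>m\<in>UNIV. \<Sum>l\<in>UNIV. \<phi> (entry X i m) * \<phi> (entry Y m l * entry Z l j))"
      by (rule sum.swap)
    finally show "entry (amplification \<phi> (X * Y) * amplification \<phi> Z) i j
      = entry (amplification \<phi> X * amplification \<phi> (Y * Z)) i j"
      by (simp add: sum sum_distrib_left)
  qed
  assume X: "star X * X = 0"
  show "X = 0"
  proof (rule cmat_eqI)
    fix i j
    have "(\<Sum>l\<in>UNIV. star (entry X l j) * entry X l j) = 0"
      using arg_cong[OF X, of "\<lambda>W. entry W j j"] by simp
    then show "entry X i j = entry 0 i j"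
      using sum_star_mult_eq_0[of UNIV "\<lambda>l. entry X l j" i] by simp
  qed
qed

section \<open>Maps between tensor products\<close>

lemma ex_clinear_functional:
  fixes v :: "'v::complex_vector"
  assumes "v \<noteq> 0"
  obtains \<omega> :: "'v \<Rightarrow> complex" where "clinear \<omega>" "\<omega> v \<noteq> 0"
proof -
  interpret vector_space_pair "scaleC :: complex \<Rightarrow> 'v \<Rightarrow> 'v" "scaleC :: complex \<Rightarrow> complex \<Rightarrow> complex"
    by (intro vector_space_pair.intro complex_vector.vector_space_axioms)
  have "complex_vector.independent {v}"
    using assms complex_vector.dependent_single by blast
  then obtain \<omega> :: "'v \<Rightarrow> complex" where "clinear \<omega>" "\<forall>x\<in>{v}. \<omega> x = 1"
    using linear_independent_extend[of "{v}" "\<lambda>_. 1"] by blast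
  then show ?thesis by (intro that[of \<omega>]) simp_all
qed

lemma cbilinear_add:
  assumes "cbilinear \<beta>"
  shows "\<beta> (a + a') c = \<beta> a c + \<beta> a' c" "\<beta> a (c + c') = \<beta> a c + \<beta> a c'"
    "\<beta> (a - a') c = \<beta> a c - \<beta> a' c" "\<beta> a (c - c') = \<beta> a c - \<beta> a c'"
    "\<beta> (scaleC k a) c = scaleC k (\<beta> a c)" "\<beta> a (scaleC k c) = scaleC k (\<beta> a c)"
    "\<beta> (\<Sum>i\<in>I. f i) c = (\<Sum>i\<in>I. \<beta> (f i) c)" "\<beta> a (\<Sum>i\<in>I. g i) = (\<Sum>i\<in>I. \<beta> a (g i))"
    "\<beta> 0 c = 0" "\<beta> a 0 = 0"
  using assms unfolding cbilinear_def
  by (auto simp: clinear_add clinear_diff clinear_scaleC clinear_zero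
      clinear_add[where f = "\<lambda>a. \<beta> a c"] clinear_diff[where f = "\<lambda>a. \<beta> a c"]
      clinear_scaleC[where f = "\<lambda>a. \<beta> a c"] clinear_sum[where f = "\<lambda>a. \<beta> a c"]
      clinear_sum[where f = "\<beta> a"] clinear_zero[where f = "\<lambda>a. \<beta> a c"])

text \<open>The universal property is given for scalar forms only. Define \<open>L\<close> on a
  basis chosen among the elementary tensors; if it failed on some \<open>\<tau> a c\<close>, a
  functional \<open>\<omega>\<close> would detect this, although \<open>\<omega>\<close> composed
  with \<open>\<beta>\<close> factors through the tensor product and agrees with
  \<open>\<omega>\<close> after \<open>L\<close> on the basis.\<close>

lemma cstar_tensor_lift:
  fixes \<tau> :: "'a::cstar_algebra \<Rightarrow> 'c::cstar_algebra \<Rightarrow> 't::cstar_algebra"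
    and \<beta> :: "'a \<Rightarrow> 'c \<Rightarrow> 'v::complex_vector"
  assumes \<tau>: "cstar_tensor \<tau>" and \<beta>: "cbilinear \<beta>"
  obtains L where "clinear L" "\<And>a c. L (\<tau> a c) = \<beta> a c"
proof -
  interpret vector_space_pair "scaleC :: complex \<Rightarrow> 't \<Rightarrow> 't" "scaleC :: complex \<Rightarrow> 'v \<Rightarrow> 'v"
    by (intro vector_space_pair.intro complex_vector.vector_space_axioms)
  define R where "R = range (\<lambda>(a, c). \<tau> a c)"
  obtain B where B: "B \<subseteq> R" "complex_vector.independent B" "R \<subseteq> cspan B"
    using complex_vector.maximal_independent_subset[of R] by blast
  have "\<forall>b\<in>B. \<exists>a c. b = \<tau> a c" using B(1) unfolding R_def by fastforce
  then obtain f g where fg: "\<And>b. b \<in> B \<Longrightarrow> b = \<tau> (f b) (g b)" by metis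
  obtain L where L: "clinear L" "\<And>b. b \<in> B \<Longrightarrow> L b = \<beta> (f b) (g b)"
    using linear_independent_extend[OF B(2), of "\<lambda>b. \<beta> (f b) (g b)"] by blast
  have "L (\<tau> a c) = \<beta> a c" for a c
  proof (rule ccontr)
    assume "L (\<tau> a c) \<noteq> \<beta> a c"
    then obtain \<omega> :: "'v \<Rightarrow> complex" where \<omega>: "clinear \<omega>" "\<omega> (L (\<tau> a c) - \<beta> a c) \<noteq> 0"
      using ex_clinear_functional[of "L (\<tau> a c) - \<beta> a c"] by auto
    have "cbilinear (\<lambda>a c. \<omega> (\<beta> a c))"
      using \<omega>(1) by (simp add: cbilinear_def clinear_iff cbilinear_add[OF \<beta>])
    then obtain M where M: "clinear M" "\<And>a c. M (\<tau> a c) = \<omega> (\<beta> a c)"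
      using \<tau> unfolding cstar_tensor_def by blast
    have "\<omega> (L x) = M x" if "x \<in> cspan B" for x
      using that
    proof (induction rule: complex_vector.span_induct_alt)
      case base
      then show ?case using L(1) M(1) \<omega>(1) by (simp add: clinear_zero)
    next
      case (step k b x)
      have "\<omega> (L b) = M b"
        using fg[OF step(1)] M(2)[of "f b" "g b"] L(2)[OF step(1)] by simp
      with step show ?case
        using L(1) M(1) \<omega>(1) by (simp add: clinear_add clinear_scaleC)
    qed
    then have "\<omega> (L (\<tau> a c)) = M (\<tau> a c)"
      using B(3) by (auto simp: R_def)
    then show False using \<omega> M(2) by (simp add: clinear_diff)
  qed
  then show ?thesis using L(1) that by blast
qed

text \<open>Inserting the factor \<open>d\<close> of \<open>norm_defect\<close> shows that
  \<open>(norm a)^2\<close> times the square of \<open>f x\<close> minus the square of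
  \<open>f (a * x)\<close> is itself a square. In the applications \<open>f\<close> is tensoring
  with a fixed element.\<close>

lemma norm_mult_le_if_gram:
  fixes f g :: "'a::cstar_algebra \<Rightarrow> 't::cstar_algebra"
  assumes g: "clinear g" and gram: "\<And>x. star (f x) * f x = g (star x * x)"
  shows "norm (f (a * x)) \<le> norm a * norm (f x)"
proof -
  obtain d where d: "\<And>y. left_action (star d) (left_action d y) = scaleR ((norm a)\<^sup>2) y - star a * (a * y)"
    using norm_defect[of a] by blast
  define z where "z = left_action d x"
  have "star z * z = scaleR ((norm a)\<^sup>2) (star x * x) - star (a * x) * (a * x)"
    unfolding z_def left_action_adjoint d by (simp add: right_diff_distrib star_mult mult.assoc)
  then have "star (f z) * f z = scaleR ((norm a)\<^sup>2) (star (f x) * f x) - star (f (a * x)) * f (a * x)"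
    by (simp add: gram clinear_diff[OF g] clinear_scaleR[OF g])
  then have "norm (star (f (a * x)) * f (a * x)) \<le> norm (scaleR ((norm a)\<^sup>2) (star (f x) * f x))"
    by (intro norm_mono positive_star_mult) (metis positive_star_mult)
  then have "(norm (f (a * x)))\<^sup>2 \<le> (norm a * norm (f x))\<^sup>2"
    by (simp add: cstar_identity power_mult_distrib)
  then show ?thesis by (rule power2_le_imp_le) simp
qed

locale tensor_product =
  fixes \<tau> :: "'a::cstar_algebra \<Rightarrow> 'c::cstar_algebra \<Rightarrow> 't::cstar_algebra"
  assumes tensor: "cstar_tensor \<tau>"
begin

definition algebraic :: "'t set"
  where "algebraic = cspan (range (\<lambda>(a, c). \<tau> a c))"

lemma bilinear: "cbilinear \<tau>" and mult: "\<tau> a c * \<tau> a' c' = \<tau> (a * a') (c * c')"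
  and star: "star (\<tau> a c) = \<tau> (star a) (star c)" and dense: "closure algebraic = UNIV"
  using tensor by (simp_all add: cstar_tensor_def algebraic_def)

lemmas linear_simps = cbilinear_add[OF bilinear]

lemma elementary [simp]: "\<tau> a c \<in> algebraic"
  unfolding algebraic_def by (rule complex_vector.span_base) auto

lemma algebraic_add: "x \<in> algebraic \<Longrightarrow> y \<in> algebraic \<Longrightarrow> x + y \<in> algebraic"
  and algebraic_scaleC: "x \<in> algebraic \<Longrightarrow> scaleC k x \<in> algebraic"
  and algebraic_zero: "0 \<in> algebraic"
  by (simp_all add: algebraic_def complex_vector.span_add complex_vector.span_scale
      complex_vector.span_zero)

lemma algebraic_sum: "(\<And>i. i \<in> I \<Longrightarrow> f i \<in> algebraic) \<Longrightarrow> (\<Sum>i\<in>I. f i) \<in> algebraic"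
  by (simp add: algebraic_def complex_vector.span_sum)

lemma algebraic_cases:
  assumes "x \<in> algebraic"
  obtains N :: nat and a c where "x = (\<Sum>i<N. \<tau> (a i) (c i))"
proof -
  have "\<exists>N a c. x = (\<Sum>i<N::nat. \<tau> (a i) (c i))"
    using assms unfolding algebraic_def
  proof (induction rule: complex_vector.span_induct_alt)
    case base
    then show ?case by (intro exI[of _ 0]) simp
  next
    case (step k b x)
    then obtain N :: nat and a c where x: "x = (\<Sum>i<N. \<tau> (a i) (c i))" by blast
    obtain a' c' where b: "b = \<tau> a' c'" using step(1) by auto
    have "scaleC k b + x = (\<Sum>i<Suc N. \<tau> ((a(N := scaleC k a')) i) ((c(N := c')) i))"
      by (simp add: x b linear_simps)
    then show ?case by blast
  qed
  then show ?thesis using that by blast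
qed

lemma algebraic_mult: "x \<in> algebraic \<Longrightarrow> y \<in> algebraic \<Longrightarrow> x * y \<in> algebraic"
  by (elim algebraic_cases) (simp add: sum_product mult algebraic_sum)

lemma algebraic_star: "x \<in> algebraic \<Longrightarrow> star x \<in> algebraic"
  by (elim algebraic_cases) (simp add: star_sum star algebraic_sum)

lemma norm_mult_left_le: "norm (\<tau> (a * x) y) \<le> norm a * norm (\<tau> x y)"
  by (rule norm_mult_le_if_gram[where g = "\<lambda>b. \<tau> b (star y * y)"])
    (simp_all add: clinear_iff linear_simps star mult)

lemma norm_mult_right_le: "norm (\<tau> x (c * y)) \<le> norm c * norm (\<tau> x y)"
  by (rule norm_mult_le_if_gram[where g = "\<lambda>b. \<tau> (star x * x) b"])
    (simp_all add: clinear_iff linear_simps star mult)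

text \<open>In any C*-norm, squaring produces \<open>\<tau> (star a * a) (star c * c)\<close>;
  extracting \<open>star a\<close> and \<open>star c\<close> leaves one factor
  \<open>norm (\<tau> a c)\<close> to cancel.\<close>

lemma norm_elementary_le: "norm (\<tau> a c) \<le> norm a * norm c"
proof (cases "norm (\<tau> a c) = 0")
  case False
  have "(norm (\<tau> a c))\<^sup>2 = norm (\<tau> (star a * a) (star c * c))"
    by (simp add: cstar_identity[symmetric] star mult)
  also have "\<dots> \<le> norm (star a) * (norm (star c) * norm (\<tau> a c))"
    by (rule order.trans[OF norm_mult_left_le mult_left_mono[OF norm_mult_right_le]]) simp
  finally show ?thesis using False by (simp add: power2_eq_square)
qed simp

end

lemma cstar_square_if_le:
  fixes p :: "'a::complex_star_algebra \<Rightarrow> real"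
  assumes nonneg: "\<And>x. x \<in> S \<Longrightarrow> p x \<ge> 0"
    and mult: "\<And>x y. x \<in> S \<Longrightarrow> y \<in> S \<Longrightarrow> p (x * y) \<le> p x * p y"
    and square: "\<And>x. x \<in> S \<Longrightarrow> (p x)\<^sup>2 \<le> p (star x * x)"
    and closed: "\<And>x. x \<in> S \<Longrightarrow> star x \<in> S" and x: "x \<in> S"
  shows "p (star x * x) = (p x)\<^sup>2"
proof -
  have le: "p x \<le> p (star x)" if "x \<in> S" for x
  proof (cases "p x = 0")
    case False
    have "p x * p x \<le> p (star x) * p x"
      using order.trans[OF square[OF that] mult[OF closed[OF that] that]] by (simp add: power2_eq_square)
    with False nonneg[OF that] show ?thesis by simp
  qed (simp add: nonneg closed that)
  have "p (star x) = p x"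
    using le[OF x] le[OF closed[OF x]] by (simp add: star_star)
  then show ?thesis
    using square[OF x] mult[OF closed[OF x] x] by (simp add: power2_eq_square)
qed

text \<open>Iterating the step gives \<open>(g 0 / k) ^ (2 ^ n) \<le> g n / k\<close>. Taking roots
  erases the constant \<open>C\<close>, so a bound with an arbitrary constant improves to one with
  the sharp constant.\<close>

lemma iterate_bound:
  fixes g :: "nat \<Rightarrow> real"
  assumes step: "\<And>n. (g n)\<^sup>2 \<le> k * g (Suc n)" and growth: "\<And>n. g n \<le> C * m ^ (2 ^ n)"
    and nonneg: "\<And>n. g n \<ge> 0" "k \<ge> 0" "m \<ge> 0"
  shows "g 0 \<le> k * m"
proof (rule ccontr)
  assume *: "\<not> g 0 \<le> k * m"
  then have g0: "g 0 > 0" using mult_nonneg_nonneg[OF nonneg(2,3)] by linarith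
  have "k \<noteq> 0" using step[of 0] g0 by auto
  then have k: "k > 0" using nonneg by simp
  have pow: "(g 0 / k) ^ (2 ^ n) \<le> g n / k" for n
  proof (induction n)
    case (Suc n)
    have "(g 0 / k) ^ (2 ^ Suc n) = ((g 0 / k) ^ (2 ^ n))\<^sup>2"
      by (simp add: power_mult[symmetric] mult.commute)
    also have "\<dots> \<le> (g n / k)\<^sup>2" using Suc g0 k by (intro power_mono) auto
    also have "\<dots> \<le> g (Suc n) / k"
      using step[of n] k by (simp add: power2_eq_square field_simps)
    finally show ?case .
  qed simp
  have "m \<noteq> 0"
  proof
    assume "m = 0"
    then have "g 0 \<le> 0" using growth[of 0] by simp
    with g0 show False by simp
  qed
  then have m: "m > 0" using nonneg by simp
  define r where "r = g 0 / k / m"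
  have r: "r > 1" using * k m by (simp add: r_def field_simps)
  have bound: "r ^ (2 ^ n) \<le> C / k" for n
  proof -
    have "(g 0 / k) ^ (2 ^ n) \<le> C * m ^ (2 ^ n) / k"
      using order.trans[OF pow divide_right_mono[OF growth]] k by simp
    then show ?thesis using m k by (simp add: r_def power_divide field_simps)
  qed
  obtain N where "C / k < r ^ N" using real_arch_pow[OF r] by blast
  also have "r ^ N \<le> r ^ (2 ^ N)" using r less_exp[of N] by (intro power_increasing) auto
  finally show False using bound[of N] by simp
qed

section \<open>Representations on Hilbert spaces\<close>

lemma
  fixes x y z :: "'h::complex_hilbert_space"
  shows cinner_scaleC_left: "cinner (scaleC c x) y = cnj c * cinner x y"
    and cinner_zero_right: "cinner x 0 = 0"
    and cinner_diff_right: "cinner x (y - z) = cinner x y - cinner x z"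
    and cinner_diff_left: "cinner (x - y) z = cinner x z - cinner y z"
    and cinner_sum_right: "cinner x (\<Sum>i\<in>I. f i) = (\<Sum>i\<in>I. cinner x (f i))"
    and cinner_self: "cinner x x = of_real ((norm x)\<^sup>2)"
proof -
  have add: "cinner (x + y) z = cinner x z + cinner y z" for x y z :: 'h
    by (metis cinner_add_right cinner_commute complex_cnj_add)
  show "cinner (scaleC c x) y = cnj c * cinner x y"
    by (metis cinner_scaleC_right cinner_commute complex_cnj_mult)
  show zr: "cinner x 0 = 0" for x :: 'h using cinner_add_right[of x 0 0] by simp
  show "cinner x (y - z) = cinner x y - cinner x z" using cinner_add_right[of x "y - z" z] by simp
  show "cinner (x - y) z = cinner x z - cinner y z" using add[of "x - y" y z] by simp
  show "cinner x (\<Sum>i\<in>I. f i) = (\<Sum>i\<in>I. cinner x (f i))"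
    by (induction I rule: infinite_finite_induct) (simp_all add: zr cinner_add_right)
  show "cinner x x = of_real ((norm x)\<^sup>2)" by (rule norm_eq_cinner[symmetric])
qed

lemma cinner_Cauchy_Schwarz: "cmod (cinner x y) \<le> norm x * norm (y::'h::complex_hilbert_space)"
proof (cases "y = 0")
  case False
  define t where "t = cinner y x / of_real ((norm y)\<^sup>2)"
  have n: "complex_of_real ((norm y)\<^sup>2) \<noteq> 0" using False by simp
  have t: "t * of_real ((norm y)\<^sup>2) = cinner y x" using n by (simp add: t_def)
  have "of_real ((norm (x - scaleC t y))\<^sup>2)
    = cinner x x - t * cinner x y - cnj t * (cinner y x - t * cinner y y)"
    unfolding norm_eq_cinner by (simp add: cinner_diff_left cinner_diff_right cinner_scaleC_left
        cinner_scaleC_right algebra_simps)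
  also have "t * cinner y y = cinner y x" by (simp only: cinner_self t)
  also have "t * cinner x y = of_real ((cmod (cinner x y))\<^sup>2 / (norm y)\<^sup>2)"
    by (simp add: t_def cinner_commute[of y x] complex_norm_square mult.commute del: of_real_power)
  also have "cinner x x = of_real ((norm x)\<^sup>2)" by (rule cinner_self)
  finally have "(norm (x - scaleC t y))\<^sup>2 = (norm x)\<^sup>2 - (cmod (cinner x y))\<^sup>2 / (norm y)\<^sup>2"
    by (simp only: diff_self mult_zero_right diff_zero of_real_eq_iff flip: of_real_diff)
  then have "(cmod (cinner x y))\<^sup>2 / (norm y)\<^sup>2 \<le> (norm x)\<^sup>2"
    using zero_le_power2[of "norm (x - scaleC t y)"] by linarith
  then have "(cmod (cinner x y))\<^sup>2 \<le> (norm x * norm y)\<^sup>2"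
    using False by (simp add: power_mult_distrib divide_le_eq)
  then show ?thesis by (rule power2_le_imp_le) simp
qed (simp add: cinner_zero_right)

lemma norm_le_if_cinner_le_hilbert:
  fixes z :: "'h::complex_hilbert_space"
  assumes "\<And>y. cmod (cinner y z) \<le> M * norm y" and "M \<ge> 0"
  shows "norm z \<le> M"
proof (cases "z = 0")
  case False
  have "cmod (cinner z z) = (norm z)\<^sup>2"
    unfolding cinner_self by (simp only: norm_of_real abs_power2 power2_abs)
  with assms(1)[of z] False show ?thesis by (simp add: power2_eq_square)
qed (simp add: assms)

locale rep =
  fixes \<pi> :: "'a::cstar_algebra \<Rightarrow> 'h::complex_hilbert_space \<Rightarrow> 'h"
  assumes representation: "representation \<pi>"
begin

lemma clinear: "clinear (\<pi> a)" and bounded: "bounded_linear (\<pi> a)" and clinear_left: "clinear (\<lambda>a. \<pi> a x)"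
  and mult: "\<pi> (a * b) x = \<pi> a (\<pi> b x)" and adjoint: "cinner (\<pi> (star a) x) y = cinner x (\<pi> a y)"
  using representation by (auto simp: representation_def)

lemmas add_left = clinear_add[OF clinear_left] and diff_left = clinear_diff[OF clinear_left]
  and scaleC_left = clinear_scaleC[OF clinear_left] and sum_left = clinear_sum[OF clinear_left]
  and zero_left = clinear_zero[OF clinear_left]

lemma adjoint': "cinner (\<pi> a x) y = cinner x (\<pi> (star a) y)"
  using adjoint[of "star a"] by (simp add: star_star)

lemma norm_square: "(norm (\<pi> a x))\<^sup>2 = Re (cinner x (\<pi> (star a * a) x))"
proof -
  have "complex_of_real ((norm (\<pi> a x))\<^sup>2) = cinner x (\<pi> (star a * a) x)"
    by (simp only: norm_eq_cinner mult adjoint')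
  then show ?thesis by (metis Re_complex_of_real)
qed

text \<open>
  With \<open>h = a* a\<close>, the element \<open>\<parallel>a\<parallel>\<^sup>2 h - h\<^sup>2\<close> is positive, so \<open>\<parallel>\<pi>(h) x\<parallel>\<^sup>2 \<le> \<parallel>a\<parallel>\<^sup>2 \<langle>x, \<pi>(h) x\<rangle>\<close>.
\<close>

lemma norm_le: "norm (\<pi> a x) \<le> norm a * norm x"
proof -
  obtain d where d: "\<And>y. left_action (star d) (left_action d y) = scaleR ((norm (star a))\<^sup>2) y - star (star a) * (star a * y)"
    using norm_defect[of "star a"] by blast
  define h where "h = star a * a"
  define z where "z = left_action d a"
  have star_h: "star h = h" by (simp add: h_def star_mult star_star)
  have Re_le: "Re (cinner x (\<pi> h x)) \<le> norm x * norm (\<pi> h x)"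
    using complex_Re_le_cmod[of "cinner x (\<pi> h x)"] cinner_Cauchy_Schwarz[of x "\<pi> h x"] by linarith
  have "star z * z = scaleC (of_real ((norm a)\<^sup>2)) h - star h * h"
    unfolding z_def left_action_adjoint d
    by (simp add: h_def right_diff_distrib star_mult star_star mult.assoc scaleR_eq_scaleC scaleC_mult_right)
  then have "(norm (\<pi> z x))\<^sup>2 = (norm a)\<^sup>2 * Re (cinner x (\<pi> h x)) - (norm (\<pi> h x))\<^sup>2"
    unfolding norm_square[of z] norm_square[of h]
    by (simp add: diff_left scaleC_left cinner_diff_right cinner_scaleC_right del: of_real_power)
  then have "(norm (\<pi> h x))\<^sup>2 \<le> (norm a)\<^sup>2 * Re (cinner x (\<pi> h x))"
    using zero_le_power2[of "norm (\<pi> z x)"] by linarith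
  also have "\<dots> \<le> (norm a)\<^sup>2 * (norm x * norm (\<pi> h x))"
    using Re_le by (intro mult_left_mono) simp_all
  finally have *: "norm (\<pi> h x) \<le> (norm a)\<^sup>2 * norm x"
    by (cases "norm (\<pi> h x) = 0") (simp_all add: power2_eq_square mult.assoc)
  have "(norm (\<pi> a x))\<^sup>2 \<le> norm x * norm (\<pi> h x)"
    using Re_le by (simp add: norm_square[of a] h_def)
  also have "\<dots> \<le> norm x * ((norm a)\<^sup>2 * norm x)" by (intro mult_left_mono *) simp
  also have "\<dots> = (norm a * norm x)\<^sup>2" by (simp add: power2_eq_square)
  finally show ?thesis by (rule power2_le_imp_le) simp
qed

text \<open>The operator norm is a second C*-norm, below the given one and faithful by injectivity,
  so the uniqueness of the norm applies.\<close>

lemma isometric: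
  assumes "inj \<pi>"
  shows "onorm (\<pi> a) = norm a"
proof (rule cstar_norm_unique)
  show nonneg: "onorm (\<pi> a) \<ge> 0" for a by (rule onorm_pos_le[OF bounded])
  show mult: "onorm (\<pi> (a * b)) \<le> onorm (\<pi> a) * onorm (\<pi> b)" for a b
  proof -
    have "\<pi> (a * b) = \<pi> a \<circ> \<pi> b" by (auto simp: mult)
    then show ?thesis using onorm_compose[OF bounded bounded] by metis
  qed
  show "onorm (\<pi> a) \<le> norm a" for a
    by (rule onorm_bound) (simp_all add: norm_le)
  show "a = 0" if "onorm (\<pi> a) = 0" for a
  proof -
    have "\<pi> a = \<pi> 0" using that onorm_eq_0[OF bounded, of a] by (auto simp: zero_left)
    with assms show ?thesis by (simp add: inj_eq)
  qed
  have square: "(onorm (\<pi> a))\<^sup>2 \<le> onorm (\<pi> (star a * a))" for a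
  proof -
    let ?q = "onorm (\<pi> (star a * a))"
    have "norm (\<pi> a x) \<le> sqrt ?q * norm x" for x
    proof (rule power2_le_imp_le)
      have "(norm (\<pi> a x))\<^sup>2 \<le> norm x * norm (\<pi> (star a * a) x)"
        using complex_Re_le_cmod[of "cinner x (\<pi> (star a * a) x)"] cinner_Cauchy_Schwarz[of x "\<pi> (star a * a) x"]
        by (simp add: norm_square)
      also have "\<dots> \<le> norm x * (?q * norm x)" by (intro mult_left_mono onorm bounded) simp
      also have "\<dots> = (sqrt ?q * norm x)\<^sup>2"
        using nonneg by (simp add: power_mult_distrib) (simp add: power2_eq_square)
      finally show "(norm (\<pi> a x))\<^sup>2 \<le> (sqrt ?q * norm x)\<^sup>2" .
    qed (simp add: nonneg)
    then have "onorm (\<pi> a) \<le> sqrt ?q" by (intro onorm_bound) (simp_all add: nonneg)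
    then have "(onorm (\<pi> a))\<^sup>2 \<le> (sqrt ?q)\<^sup>2" by (intro power_mono nonneg)
    then show ?thesis by (simp add: nonneg)
  qed
  show "onorm (\<pi> (star a * a)) = (onorm (\<pi> a))\<^sup>2" for a
    by (rule cstar_square_if_le[where S = UNIV]) (simp_all add: nonneg mult square)
qed

lemma norm_le_if_cinner_le:
  assumes "inj \<pi>" and M: "\<And>x y. cmod (cinner y (\<pi> a x)) \<le> M * norm y * norm x" "M \<ge> 0"
  shows "norm a \<le> M"
proof -
  have "norm (\<pi> a x) \<le> M * norm x" for x
    by (rule norm_le_if_cinner_le_hilbert) (use M in \<open>simp_all add: mult_ac\<close>)
  then have "onorm (\<pi> a) \<le> M" by (intro onorm_bound M)
  then show ?thesis by (simp add: isometric[OF assms(1)])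
qed

end

text \<open>In the picture of the structure theorem this is the vector functional of
  \<open>\<alpha>(a)\<close> at \<open>\<phi>(u) p\<close>. Such functionals are the legs of the
  matrix coefficients of the tensor map.\<close>

lemma (in cpc_order_zero) compressed_functional:
  fixes \<pi> :: "'b \<Rightarrow> 'h::complex_hilbert_space \<Rightarrow> 'h" and u p
  assumes "representation \<pi>"
  defines "\<omega> \<equiv> \<lambda>a. cinner p (\<pi> (\<phi> (star u) * \<phi> (a * u)) p)"
  shows "clinear \<omega>" and "cmod (\<omega> a) \<le> (norm p * norm u)\<^sup>2 * norm a"
proof -
  interpret \<pi>: rep \<pi> by standard (rule assms)
  show "clinear \<omega>"
    unfolding clinear_iff \<omega>_def
    by (simp add: distrib_right distrib_left add \<pi>.add_left cinner_add_right scaleC_mult_left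
        scaleC_mult_right scaleC \<pi>.scaleC_left cinner_scaleC_right scaleC_complex_def)
  have "norm (\<phi> (star u) * \<phi> (a * u)) \<le> norm u * (norm a * norm u)"
    using norm_le[of "star u"] order.trans[OF norm_le norm_mult_ineq, of a u]
    by (intro order.trans[OF norm_mult_ineq] mult_mono) simp_all
  then have "norm p * (norm (\<phi> (star u) * \<phi> (a * u)) * norm p) \<le> norm p * ((norm u * (norm a * norm u)) * norm p)"
    by (intro mult_left_mono mult_right_mono) simp_all
  moreover have "cmod (\<omega> a) \<le> norm p * (norm (\<phi> (star u) * \<phi> (a * u)) * norm p)"
    unfolding \<omega>_def
    by (rule order.trans[OF cinner_Cauchy_Schwarz mult_left_mono[OF \<pi>.norm_le]]) simp
  ultimately show "cmod (\<omega> a) \<le> (norm p * norm u)\<^sup>2 * norm a"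
    by (simp add: power2_eq_square mult_ac)
qed

text \<open>Slicing one leg at a time: \<open>z\<close> is the slice by \<open>\<omega>'\<close>,
  and its matrix coefficients are values of \<open>\<omega>'\<close> at the slices \<open>w\<close>
  by vector functionals, whose own coefficients are those of \<open>t\<close> at product vectors.
  Bounded functionals are thus reduced to vector functionals without extending states.\<close>

lemma minimal_tensor_functional_bound:
  fixes \<omega> :: "'a::cstar_algebra \<Rightarrow> complex" and \<omega>' :: "'c::cstar_algebra \<Rightarrow> complex"
  assumes min: "minimal_tensor \<pi> \<rho> \<theta> \<tau>"
    and \<omega>: "clinear \<omega>" "\<And>a. cmod (\<omega> a) \<le> k * norm a" and \<omega>': "clinear \<omega>'" "\<And>c. cmod (\<omega>' c) \<le> l * norm c"
    and kl: "k \<ge> 0" "l \<ge> 0"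
  shows "cmod (\<Sum>i\<in>I. \<omega> (a i) * \<omega>' (c i)) \<le> k * l * norm (\<Sum>i\<in>I. \<tau> (a i) (c i))"
proof -
  obtain \<sigma> where rep: "representation \<pi>" "inj \<pi>" "representation \<rho>" "inj \<rho>" "representation \<sigma>"
    and \<theta>: "hilbert_tensor \<theta>" and \<sigma>: "\<And>a c x y. \<sigma> (\<tau> a c) (\<theta> x y) = \<theta> (\<pi> a x) (\<rho> c y)"
    using min by (auto simp: minimal_tensor_def)
  interpret \<pi>: rep \<pi> by standard (rule rep)
  interpret \<rho>: rep \<rho> by standard (rule rep)
  interpret \<sigma>: rep \<sigma> by standard (rule rep)
  have cinner_\<theta>: "cinner (\<theta> x y) (\<theta> x' y') = cinner x x' * cinner y y'" for x y x' y'
    using \<theta> by (simp add: hilbert_tensor_def)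
  have norm_\<theta>: "norm (\<theta> x y) = norm x * norm y" for x y
  proof -
    have "complex_of_real ((norm (\<theta> x y))\<^sup>2) = of_real ((norm x * norm y)\<^sup>2)"
      by (simp only: norm_eq_cinner cinner_\<theta> power_mult_distrib of_real_mult)
    then have "(norm (\<theta> x y))\<^sup>2 = (norm x * norm y)\<^sup>2" by (simp only: of_real_eq_iff)
    then show ?thesis by (rule power2_eq_imp_eq) simp_all
  qed
  define t where "t = (\<Sum>i\<in>I. \<tau> (a i) (c i))"
  define z where "z = (\<Sum>i\<in>I. scaleC (\<omega>' (c i)) (a i))"
  have "norm z \<le> l * norm t"
  proof (rule \<pi>.norm_le_if_cinner_le)
    fix x y
    define w where "w = (\<Sum>i\<in>I. scaleC (cinner y (\<pi> (a i) x)) (c i))"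
    have "norm w \<le> norm t * norm x * norm y"
    proof (rule \<rho>.norm_le_if_cinner_le)
      fix x' y'
      have "cinner y' (\<rho> w x') = (\<Sum>i\<in>I. cinner y (\<pi> (a i) x) * cinner y' (\<rho> (c i) x'))"
        by (simp add: w_def \<rho>.sum_left \<rho>.scaleC_left cinner_sum_right cinner_scaleC_right)
      also have "\<dots> = cinner (\<theta> y y') (\<sigma> t (\<theta> x x'))"
        by (simp add: t_def \<sigma>.sum_left \<sigma> cinner_sum_right cinner_\<theta>)
      finally have "cmod (cinner y' (\<rho> w x')) \<le> norm (\<theta> y y') * (norm t * norm (\<theta> x x'))"
        using order.trans[OF cinner_Cauchy_Schwarz mult_left_mono[OF \<sigma>.norm_le]] by simp
      then show "cmod (cinner y' (\<rho> w x')) \<le> norm t * norm x * norm y * norm y' * norm x'"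
        by (simp add: norm_\<theta> mult_ac)
    qed (simp_all add: rep)
    then have "l * norm w \<le> l * (norm t * norm x * norm y)" by (intro mult_left_mono kl)
    moreover have "cinner y (\<pi> z x) = \<omega>' w"
      by (simp add: z_def w_def \<pi>.sum_left \<pi>.scaleC_left cinner_sum_right cinner_scaleC_right
          clinear_sum[OF \<omega>'(1)] clinear_scaleC[OF \<omega>'(1)] scaleC_complex_def mult.commute)
    ultimately show "cmod (cinner y (\<pi> z x)) \<le> l * norm t * norm y * norm x"
      using \<omega>'(2)[of w] by (simp add: mult_ac)
  qed (simp_all add: rep kl)
  then have "k * norm z \<le> k * (l * norm t)" by (intro mult_left_mono kl)
  moreover have "\<omega> z = (\<Sum>i\<in>I. \<omega> (a i) * \<omega>' (c i))"
    by (simp add: z_def clinear_sum[OF \<omega>(1)] clinear_scaleC[OF \<omega>(1)] scaleC_complex_def mult.commute)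
  ultimately show ?thesis using \<omega>(2)[of z] by (simp add: t_def mult.assoc)
qed

section \<open>The map on the algebraic tensor product\<close>

locale tensor_map =
  \<phi>: cpc_order_zero \<phi> + \<psi>: cpc_order_zero \<psi> + dom: tensor_product \<tau> + cod: tensor_product \<tau>'
  for \<phi> :: "'a::cstar_algebra \<Rightarrow> 'b::cstar_algebra" and \<psi> :: "'c::cstar_algebra \<Rightarrow> 'd::cstar_algebra"
    and \<tau> :: "'a \<Rightarrow> 'c \<Rightarrow> 's::cstar_algebra" and \<tau>' :: "'b \<Rightarrow> 'd \<Rightarrow> 't::cstar_algebra" +
  fixes L :: "'s \<Rightarrow> 't"
  assumes linear: "clinear L" and L: "L (\<tau> a c) = \<tau>' (\<phi> a) (\<psi> c)"
begin

lemmas L_sum = clinear_sum[OF linear]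

lemma L_balanced:
  assumes "x \<in> dom.algebraic" "y \<in> dom.algebraic" "z \<in> dom.algebraic"
  shows "L (x * y) * L z = L x * L (y * z)"
proof -
  obtain N1 :: nat and a1 c1 where x: "x = (\<Sum>i<N1. \<tau> (a1 i) (c1 i))" using assms(1) by (rule dom.algebraic_cases)
  obtain N2 :: nat and a2 c2 where y: "y = (\<Sum>i<N2. \<tau> (a2 i) (c2 i))" using assms(2) by (rule dom.algebraic_cases)
  obtain N3 :: nat and a3 c3 where z: "z = (\<Sum>i<N3. \<tau> (a3 i) (c3 i))" using assms(3) by (rule dom.algebraic_cases)
  have "L (x * y) * L z = (\<Sum>i<N1. \<Sum>j<N2. L (\<tau> (a1 i * a2 j) (c1 i * c2 j))) * (\<Sum>k<N3. L (\<tau> (a3 k) (c3 k)))"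
    by (simp add: x y z sum_product dom.mult L_sum)
  also have "\<dots> = (\<Sum>i<N1. \<Sum>j<N2. \<Sum>k<N3. L (\<tau> (a1 i * a2 j) (c1 i * c2 j)) * L (\<tau> (a3 k) (c3 k)))"
    by (simp only: sum_distrib_right) (simp only: sum_distrib_left)
  also have "\<dots> = (\<Sum>i<N1. \<Sum>j<N2. \<Sum>k<N3. L (\<tau> (a1 i) (c1 i)) * L (\<tau> (a2 j * a3 k) (c2 j * c3 k)))"
    by (simp add: L cod.mult \<phi>.balanced \<psi>.balanced)
  also have "\<dots> = (\<Sum>i<N1. L (\<tau> (a1 i) (c1 i))) * (\<Sum>j<N2. \<Sum>k<N3. L (\<tau> (a2 j * a3 k) (c2 j * c3 k)))"
    by (simp only: sum_distrib_right) (simp only: sum_distrib_left)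
  also have "\<dots> = L x * L (y * z)"
    by (simp add: x y z sum_product dom.mult L_sum)
  finally show ?thesis .
qed

lemma L_star: "x \<in> dom.algebraic \<Longrightarrow> L (star x) = star (L x)"
  by (elim dom.algebraic_cases)
    (simp add: star_sum dom.star L_sum L cod.star \<phi>.star_preserving \<psi>.star_preserving)

lemma norm_L_elementary_le: "norm (L (\<tau> a c)) \<le> norm a * norm c"
  unfolding L using \<phi>.norm_le[of a] \<psi>.norm_le[of c]
  by (intro order.trans[OF cod.norm_elementary_le] mult_mono) simp_all

lemma norm_L_le:
  assumes bound: "\<And>y. y \<in> dom.algebraic \<Longrightarrow> norm (L (x * y)) \<le> norm x * norm (L y)"
    and x: "x \<in> dom.algebraic"
  shows "norm (L x) \<le> norm x"
proof (rule field_le_epsilon)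
  fix \<delta> :: real assume \<delta>: "\<delta> > 0"
  obtain N :: nat and a c where x: "x = (\<Sum>i<N. \<tau> (a i) (c i))" using x by (rule dom.algebraic_cases)
  define M where "M = 1 + (\<Sum>i<N. norm (c i) + norm (a i))"
  have M: "M > 0" unfolding M_def by (intro add_pos_nonneg sum_nonneg) simp_all
  define e where "e = \<delta> / M"
  have e: "e > 0" using \<delta> M by (simp add: e_def)
  obtain u where u: "norm u \<le> 1" "\<And>a'. a' \<in> a ` {..<N} \<Longrightarrow> norm (a' * u - a') \<le> e"
    using approximate_unit[of "a ` {..<N}" e] e by (metis finite_imageI finite_lessThan)
  obtain v where v: "norm v \<le> 1" "\<And>c'. c' \<in> c ` {..<N} \<Longrightarrow> norm (c' * v - c') \<le> e"
    using approximate_unit[of "c ` {..<N}" e] e by (metis finite_imageI finite_lessThan)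
  \<comment> \<open>Contractivity of \<open>L\<close> is the goal and not yet available; the
    perturbation by the approximate units is written as two elementary tensors, to which the bound
    by the product of norms applies.\<close>
  have est: "norm (L (\<tau> (a i) (c i) * \<tau> u v) - L (\<tau> (a i) (c i))) \<le> e * (norm (c i) + norm (a i))" if "i < N" for i
  proof -
    have "L (\<tau> (a i) (c i) * \<tau> u v) - L (\<tau> (a i) (c i))
      = L (\<tau> (a i * u - a i) (c i * v)) + L (\<tau> (a i) (c i * v - c i))"
      unfolding L dom.mult by (simp add: \<phi>.diff \<psi>.diff cod.linear_simps)
    also have "norm \<dots> \<le> e * norm (c i) + norm (a i) * e"
    proof (intro norm_triangle_mono)
      have "norm (c i * v) \<le> norm (c i)"
        using norm_mult_ineq[of "c i" v] mult_left_le[OF v(1) norm_ge_zero[of "c i"]] by linarith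
      then show "norm (L (\<tau> (a i * u - a i) (c i * v))) \<le> e * norm (c i)"
        using u(2)[of "a i"] that e by (intro order.trans[OF norm_L_elementary_le] mult_mono) simp_all
      show "norm (L (\<tau> (a i) (c i * v - c i))) \<le> norm (a i) * e"
        using v(2)[of "c i"] that by (intro order.trans[OF norm_L_elementary_le] mult_mono) simp_all
    qed
    finally show ?thesis by (simp add: algebra_simps)
  qed
  have "L (x * \<tau> u v) - L x = (\<Sum>i<N. L (\<tau> (a i) (c i) * \<tau> u v) - L (\<tau> (a i) (c i)))"
    by (simp add: x L_sum sum_distrib_right sum_subtractf)
  also have "norm \<dots> \<le> (\<Sum>i<N. e * (norm (c i) + norm (a i)))"
    by (rule sum_norm_le) (simp add: est)
  also have "\<dots> = e * (M - 1)" by (simp add: M_def sum_distrib_left)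
  also have "\<dots> \<le> e * M" using e by (intro mult_left_mono) simp_all
  also have "\<dots> = \<delta>" using M by (simp add: e_def)
  finally have "norm (L x) \<le> norm (L (x * \<tau> u v)) + \<delta>"
    using norm_triangle_ineq2[of "L x" "L (x * \<tau> u v)"] by (simp add: norm_minus_commute)
  moreover have "norm (L (x * \<tau> u v)) \<le> norm x * norm (L (\<tau> u v))" by (rule bound) simp
  moreover have "norm (L (\<tau> u v)) \<le> 1"
    using norm_L_elementary_le[of u v] mult_le_one[OF u(1) _ v(1)] by simp
  then have "norm x * norm (L (\<tau> u v)) \<le> norm x" by (simp add: mult_left_le)
  ultimately show "norm (L x) \<le> norm x + \<delta>" by linarith
qed

text \<open>In the square of \<open>L (x * y)\<close> the identity moves \<open>star x\<close> from
  the left factor to the right one, which leaves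
  \<open>star (L y) * L (star x * x * y)\<close>.\<close>

lemma norm_L_mult_square:
  assumes "x \<in> dom.algebraic" "y \<in> dom.algebraic"
  shows "(norm (L (x * y)))\<^sup>2 \<le> norm (L y) * norm (L (star x * x * y))"
proof -
  note mem = assms dom.algebraic_mult dom.algebraic_star
  have "star (L (x * y)) * L (x * y) = L (star y * star x) * L (x * y)"
    by (simp add: L_star[symmetric] star_mult mem)
  also have "\<dots> = L (star y) * L (star x * (x * y))" by (rule L_balanced) (simp_all add: mem)
  also have "L (star y) = star (L y)" by (simp add: L_star mem)
  finally have "(norm (L (x * y)))\<^sup>2 = norm (star (L y) * L (star x * x * y))"
    by (simp add: cstar_identity[symmetric] mult.assoc)
  also have "\<dots> \<le> norm (L y) * norm (L (star x * x * y))"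
    using norm_mult_ineq[of "star (L y)"] by simp
  finally show ?thesis .
qed

text \<open>Elementary tensors are closed under \<open>x |-> star x * x\<close>, so the iteration
  never leaves them; expanding \<open>y\<close> gives a crude constant \<open>C\<close> valid at
  every stage. This makes the seminorm below finite.\<close>

lemma norm_L_elementary_mult_le:
  assumes y: "y \<in> dom.algebraic"
  shows "norm (L (\<tau> a c * y)) \<le> (norm a * norm c) * norm (L y)"
proof -
  obtain N :: nat and a1 c1 where y': "y = (\<Sum>i<N. \<tau> (a1 i) (c1 i))" using y by (rule dom.algebraic_cases)
  define C where "C = (\<Sum>i<N. norm (a1 i) * norm (c1 i))"
  define A where "A n = ((\<lambda>x. star x * x) ^^ n) a" for n
  define D where "D n = ((\<lambda>x. star x * x) ^^ n) c" for n
  have norm_A: "norm (A n) = norm a ^ (2 ^ n)" and norm_D: "norm (D n) = norm c ^ (2 ^ n)" for n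
    by (induction n) (simp_all add: A_def D_def cstar_identity power_mult[symmetric] mult.commute)
  have "norm (L (\<tau> (A 0) (D 0) * y)) \<le> norm (L y) * (norm a * norm c)"
  proof (rule iterate_bound[where C = C])
    fix n
    have "star (\<tau> (A n) (D n)) * \<tau> (A n) (D n) = \<tau> (A (Suc n)) (D (Suc n))"
      by (simp add: dom.star dom.mult A_def D_def)
    then show "(norm (L (\<tau> (A n) (D n) * y)))\<^sup>2 \<le> norm (L y) * norm (L (\<tau> (A (Suc n)) (D (Suc n)) * y))"
      using norm_L_mult_square[of "\<tau> (A n) (D n)" y] y by simp
    have "norm (L (\<tau> (A n) (D n) * y)) = norm (\<Sum>i<N. L (\<tau> (A n * a1 i) (D n * c1 i)))"
      by (simp add: y' sum_distrib_left dom.mult L_sum)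
    also have "\<dots> \<le> (\<Sum>i<N. norm (A n) * norm (D n) * (norm (a1 i) * norm (c1 i)))"
    proof (rule sum_norm_le)
      fix i
      have "norm (L (\<tau> (A n * a1 i) (D n * c1 i))) \<le> (norm (A n) * norm (a1 i)) * (norm (D n) * norm (c1 i))"
        by (intro order.trans[OF norm_L_elementary_le] mult_mono norm_mult_ineq) simp_all
      then show "norm (L (\<tau> (A n * a1 i) (D n * c1 i))) \<le> norm (A n) * norm (D n) * (norm (a1 i) * norm (c1 i))"
        by (simp add: mult_ac)
    qed
    also have "\<dots> = C * (norm a * norm c) ^ (2 ^ n)"
      by (simp add: C_def norm_A norm_D power_mult_distrib sum_distrib_left sum_distrib_right mult_ac)
    finally show "norm (L (\<tau> (A n) (D n) * y)) \<le> C * (norm a * norm c) ^ (2 ^ n)" .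
  qed simp_all
  then show ?thesis by (simp add: A_def D_def mult.commute)
qed

section \<open>The seminorm of the action, and the maximal norm\<close>

definition bounds :: "'s \<Rightarrow> real set"
  where "bounds x = {K. K \<ge> 0 \<and> (\<forall>y\<in>dom.algebraic. norm (L (x * y)) \<le> K * norm (L y))}"

text \<open>The operator norm of \<open>L y |-> L (x * y)\<close> on the image of the algebraic
  tensor product.\<close>

definition seminorm :: "'s \<Rightarrow> real"
  where "seminorm x = Inf (bounds x)"

lemma bounds_nonempty:
  assumes "x \<in> dom.algebraic"
  shows "bounds x \<noteq> {}"
proof -
  obtain N :: nat and a c where x: "x = (\<Sum>i<N. \<tau> (a i) (c i))" using assms by (rule dom.algebraic_cases)
  have "norm (L (x * y)) \<le> (\<Sum>i<N. norm (a i) * norm (c i)) * norm (L y)" if "y \<in> dom.algebraic" for y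
    unfolding x sum_distrib_right L_sum
    by (intro sum_norm_le norm_L_elementary_mult_le that)
  then show ?thesis
    by (auto simp: bounds_def intro!: exI[of _ "\<Sum>i<N. norm (a i) * norm (c i)"] sum_nonneg)
qed

lemma seminorm_le: "K \<in> bounds x \<Longrightarrow> seminorm x \<le> K"
  unfolding seminorm_def by (intro cInf_lower bdd_belowI[of _ 0]) (auto simp: bounds_def)

lemma seminorm_bounds:
  assumes "x \<in> dom.algebraic"
  shows "seminorm x \<in> bounds x"
  unfolding bounds_def mem_Collect_eq
proof (intro conjI ballI)
  show "seminorm x \<ge> 0"
    unfolding seminorm_def by (rule cInf_greatest[OF bounds_nonempty[OF assms]]) (simp add: bounds_def)
  fix y assume y: "y \<in> dom.algebraic"
  obtain K where K: "K \<in> bounds x" using bounds_nonempty[OF assms] by blast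
  show "norm (L (x * y)) \<le> seminorm x * norm (L y)"
  \<comment> \<open>\<open>L y = 0\<close> forces \<open>L (x * y) = 0\<close>, by any one element
    of \<open>bounds x\<close>: the action on values is well defined.\<close>
  proof (cases "norm (L y) = 0")
    case True
    then show ?thesis using K y by (auto simp: bounds_def)
  next
    case False
    then have pos: "norm (L y) > 0" by simp
    have "norm (L (x * y)) / norm (L y) \<le> seminorm x"
      unfolding seminorm_def
      by (rule cInf_greatest[OF bounds_nonempty[OF assms]]) (use y pos in \<open>auto simp: bounds_def divide_le_eq\<close>)
    then show ?thesis using pos by (simp add: divide_le_eq)
  qed
qed

lemma cstar_seminorm: "cstar_seminorm_on dom.algebraic seminorm"
proof -
  have nonneg: "seminorm x \<ge> 0" if "x \<in> dom.algebraic" for x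
    using seminorm_bounds[OF that] by (simp add: bounds_def)
  have bound: "norm (L (x * y)) \<le> seminorm x * norm (L y)" if "x \<in> dom.algebraic" "y \<in> dom.algebraic" for x y
    using seminorm_bounds[OF that(1)] that(2) by (simp add: bounds_def)
  have add: "seminorm (x + y) \<le> seminorm x + seminorm y" if "x \<in> dom.algebraic" "y \<in> dom.algebraic" for x y
  proof (rule seminorm_le, unfold bounds_def mem_Collect_eq, intro conjI ballI)
    fix z assume "z \<in> dom.algebraic"
    then show "norm (L ((x + y) * z)) \<le> (seminorm x + seminorm y) * norm (L z)"
      using bound that by (simp add: distrib_right clinear_add[OF linear] norm_triangle_mono)
  qed (use nonneg that in simp)
  have scale_le: "seminorm (scaleC k x) \<le> cmod k * seminorm x" if "x \<in> dom.algebraic" for k x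
  proof (rule seminorm_le, unfold bounds_def mem_Collect_eq, intro conjI ballI)
    fix z assume "z \<in> dom.algebraic"
    then show "norm (L (scaleC k x * z)) \<le> cmod k * seminorm x * norm (L z)"
      using bound[OF that] by (simp add: scaleC_mult_left clinear_scaleC[OF linear] norm_scaleC mult_left_mono mult.assoc)
  qed (use nonneg that in simp)
  have scale: "seminorm (scaleC k x) = cmod k * seminorm x" if x: "x \<in> dom.algebraic" for k x
  proof (cases "k = 0")
    case True
    then show ?thesis using scale_le[OF x, of k] nonneg[of "scaleC k x"] dom.algebraic_scaleC[OF x] dom.algebraic_zero by simp
  next
    case False
    have "seminorm (scaleC (1 / k) (scaleC k x)) \<le> cmod (1 / k) * seminorm (scaleC k x)"
      by (intro scale_le dom.algebraic_scaleC x)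
    then have "cmod k * seminorm x \<le> seminorm (scaleC k x)"
      using False by (simp add: scaleC_scaleC scaleC_one norm_divide field_simps)
    with scale_le[OF x] show ?thesis by (intro order.antisym)
  qed
  have mult: "seminorm (x * y) \<le> seminorm x * seminorm y" if "x \<in> dom.algebraic" "y \<in> dom.algebraic" for x y
  proof (rule seminorm_le, unfold bounds_def mem_Collect_eq, intro conjI ballI)
    fix z assume z: "z \<in> dom.algebraic"
    have "norm (L (x * (y * z))) \<le> seminorm x * norm (L (y * z))"
      by (intro bound that dom.algebraic_mult z)
    also have "\<dots> \<le> seminorm x * (seminorm y * norm (L z))"
      by (intro mult_left_mono bound nonneg that z)
    finally show "norm (L (x * y * z)) \<le> seminorm x * seminorm y * norm (L z)" by (simp add: mult.assoc)
  qed (use nonneg that in simp)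
  have square: "(seminorm x)\<^sup>2 \<le> seminorm (star x * x)" if x: "x \<in> dom.algebraic" for x
  proof -
    have mem: "star x * x \<in> dom.algebraic" by (intro dom.algebraic_mult dom.algebraic_star x)
    let ?s = "sqrt (seminorm (star x * x))"
    have s: "?s \<ge> 0" "?s\<^sup>2 = seminorm (star x * x)" using nonneg[OF mem] by simp_all
    have "seminorm x \<le> ?s"
    proof (rule seminorm_le, unfold bounds_def mem_Collect_eq, intro conjI ballI)
      fix y assume y: "y \<in> dom.algebraic"
      have "(norm (L (x * y)))\<^sup>2 \<le> norm (L y) * norm (L (star x * x * y))"
        by (rule norm_L_mult_square[OF x y])
      also have "\<dots> \<le> norm (L y) * (?s\<^sup>2 * norm (L y))"
        unfolding s(2) by (intro mult_left_mono bound mem y) simp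
      also have "\<dots> = (?s * norm (L y))\<^sup>2" by (simp only: power2_eq_square mult_ac)
      finally show "norm (L (x * y)) \<le> ?s * norm (L y)"
        by (rule power2_le_imp_le) (use s in simp)
    qed (rule s)
    then have "(seminorm x)\<^sup>2 \<le> ?s\<^sup>2" by (intro power_mono nonneg x)
    then show ?thesis by (simp only: s)
  qed
  show ?thesis
    unfolding cstar_seminorm_on_def
    using nonneg add scale mult
      cstar_square_if_le[of dom.algebraic seminorm, OF nonneg mult square dom.algebraic_star] by blast
qed

lemma norm_L_mult_le_maximal:
  assumes "maximal_tensor \<tau>" "x \<in> dom.algebraic" "y \<in> dom.algebraic"
  shows "norm (L (x * y)) \<le> norm x * norm (L y)"
proof -
  have "seminorm x \<le> norm x"
    using assms(1,2) cstar_seminorm unfolding maximal_tensor_def dom.algebraic_def by blast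
  moreover have "norm (L (x * y)) \<le> seminorm x * norm (L y)"
    using seminorm_bounds[OF assms(2)] assms(3) by (simp add: bounds_def)
  ultimately show ?thesis
    by (meson mult_right_mono norm_ge_zero order.trans)
qed

text \<open>The minimal norm need not dominate every C*-seminorm, so the estimate is made for one
  vector \<open>z\<close> of the Hilbert space at a time, where the squares become inner products
  and the iteration applies; density of \<open>H\<close> then covers all vectors.\<close>

lemma norm_L_mult_le_minimal:
  assumes min: "minimal_tensor \<pi> \<rho> \<theta> \<tau>" and min': "minimal_tensor \<pi>' \<rho>' \<theta>' \<tau>'"
    and x: "x \<in> dom.algebraic" and y: "y \<in> dom.algebraic"
  shows "norm (L (x * y)) \<le> norm x * norm (L y)"
proof -
  obtain \<sigma> where rep: "representation \<pi>'" "representation \<rho>'" "representation \<sigma>"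
    and \<theta>: "hilbert_tensor \<theta>'" and \<sigma>: "\<And>a c x y. \<sigma> (\<tau>' a c) (\<theta>' x y) = \<theta>' (\<pi>' a x) (\<rho>' c y)"
    and norm_\<sigma>: "\<And>z. norm z = onorm (\<sigma> z)"
    using min' by (auto simp: minimal_tensor_def)
  interpret \<pi>: rep \<pi>' by standard (rule rep)
  interpret \<rho>: rep \<rho>' by standard (rule rep)
  interpret \<sigma>: rep \<sigma> by standard (rule rep)
  have cinner_\<theta>: "cinner (\<theta>' x y) (\<theta>' x' y') = cinner x x' * cinner y y'" for x y x' y'
    using \<theta> by (simp add: hilbert_tensor_def)
  define H where "H = cspan (range (\<lambda>(x, y). \<theta>' x y))"
  have H_dense: "closure H = UNIV" using \<theta> by (simp add: hilbert_tensor_def H_def)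
  \<comment> \<open>\<open>K\<close> may depend on \<open>y\<close> and \<open>z\<close>, since the
    iteration erases it. A constant of this kind survives sums, so elementary tensors and product
    vectors suffice.\<close>
  define good where "good y z \<longleftrightarrow> (\<exists>K. \<forall>x\<in>dom.algebraic. norm (\<sigma> (L (x * y)) z) \<le> K * norm x)" for y z
  have good_add: "good (y + y') z" if g: "good y z" "good y' z" for y y' z
  proof -
    obtain K where K1: "\<And>x. x \<in> dom.algebraic \<Longrightarrow> norm (\<sigma> (L (x * y)) z) \<le> K * norm x"
      using g(1) unfolding good_def by blast
    obtain K' where K2: "\<And>x. x \<in> dom.algebraic \<Longrightarrow> norm (\<sigma> (L (x * y')) z) \<le> K' * norm x"
      using g(2) unfolding good_def by blast
    note K = K1 K2
    have "norm (\<sigma> (L (x * (y + y'))) z) \<le> (K + K') * norm x" if "x \<in> dom.algebraic" for x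
      using K[OF that] by (simp add: distrib_left distrib_right clinear_add[OF linear] \<sigma>.add_left norm_triangle_mono)
    then show ?thesis unfolding good_def by blast
  qed
  have good_add': "good y (z + z')" if g: "good y z" "good y z'" for y z z'
  proof -
    obtain K where K1: "\<And>x. x \<in> dom.algebraic \<Longrightarrow> norm (\<sigma> (L (x * y)) z) \<le> K * norm x"
      using g(1) unfolding good_def by blast
    obtain K' where K2: "\<And>x. x \<in> dom.algebraic \<Longrightarrow> norm (\<sigma> (L (x * y)) z') \<le> K' * norm x"
      using g(2) unfolding good_def by blast
    note K = K1 K2
    have "norm (\<sigma> (L (x * y)) (z + z')) \<le> (K + K') * norm x" if "x \<in> dom.algebraic" for x
      using K[OF that] by (simp add: distrib_right clinear_add[OF \<sigma>.clinear] norm_triangle_mono)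
    then show ?thesis unfolding good_def by blast
  qed
  have good_elementary: "good (\<tau> u v) (\<theta>' p q)" for u v p q
  proof -
    \<comment> \<open>At a product vector the coefficient of
      \<open>L (star (\<tau> u v)) * L (x * \<tau> u v)\<close> splits into a product of bounded
      functionals of the two legs, to which the minimal norm of the domain applies.\<close>
    define \<omega> where "\<omega> = (\<lambda>a. cinner p (\<pi>' (\<phi> (star u) * \<phi> (a * u)) p))"
    define \<omega>' where "\<omega>' = (\<lambda>c. cinner q (\<rho>' (\<psi> (star v) * \<psi> (c * v)) q))"
    define k where "k = (norm p * norm u)\<^sup>2"
    define l where "l = (norm q * norm v)\<^sup>2"
    have kl: "k \<ge> 0" "l \<ge> 0" by (simp_all add: k_def l_def)
    have \<omega>: "clinear \<omega>" "cmod (\<omega> a) \<le> k * norm a" and \<omega>': "clinear \<omega>'" "cmod (\<omega>' c) \<le> l * norm c" for a c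
      unfolding \<omega>_def \<omega>'_def k_def l_def
      by (rule \<phi>.compressed_functional \<psi>.compressed_functional rep)+
    have functional: "cmod (cinner (\<theta>' p q) (\<sigma> (L (star (\<tau> u v)) * L (x * \<tau> u v)) (\<theta>' p q))) \<le> k * l * norm x"
      if alg: "x \<in> dom.algebraic" for x
    proof -
      obtain N :: nat and a c where x: "x = (\<Sum>i<N. \<tau> (a i) (c i))" using alg by (rule dom.algebraic_cases)
      have "cinner (\<theta>' p q) (\<sigma> (L (star (\<tau> u v)) * L (x * \<tau> u v)) (\<theta>' p q)) = (\<Sum>i<N. \<omega> (a i) * \<omega>' (c i))"
        by (simp add: x sum_distrib_right sum_distrib_left dom.mult dom.star L_sum L cod.mult \<sigma>.sum_left \<sigma>
            cinner_sum_right cinner_\<theta> \<omega>_def \<omega>'_def)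
      then show ?thesis
        using minimal_tensor_functional_bound[OF min \<omega> \<omega>' kl, of a c "{..<N}"] x by simp
    qed
    have "norm (\<sigma> (L (x * \<tau> u v)) (\<theta>' p q)) \<le> sqrt (k * l) * norm x" if x: "x \<in> dom.algebraic" for x
    proof (rule power2_le_imp_le)
      have mem: "star x \<in> dom.algebraic" "star x * x \<in> dom.algebraic" "x * \<tau> u v \<in> dom.algebraic"
        by (simp_all add: dom.algebraic_star dom.algebraic_mult x)
      have "star (L (x * \<tau> u v)) * L (x * \<tau> u v) = L (star (\<tau> u v) * star x) * L (x * \<tau> u v)"
        by (simp only: L_star[OF mem(3), symmetric] star_mult)
      also have "\<dots> = L (star (\<tau> u v)) * L (star x * (x * \<tau> u v))"
        by (rule L_balanced) (simp_all add: mem dom.algebraic_star)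
      finally have "(norm (\<sigma> (L (x * \<tau> u v)) (\<theta>' p q)))\<^sup>2
        = Re (cinner (\<theta>' p q) (\<sigma> (L (star (\<tau> u v)) * L (star x * x * \<tau> u v)) (\<theta>' p q)))"
        by (simp add: \<sigma>.norm_square mult.assoc)
      also have "\<dots> \<le> k * l * norm (star x * x)"
        using functional[OF mem(2)] complex_Re_le_cmod order.trans by blast
      also have "\<dots> = (sqrt (k * l) * norm x)\<^sup>2"
        using kl by (simp add: cstar_identity power_mult_distrib)
      finally show "(norm (\<sigma> (L (x * \<tau> u v)) (\<theta>' p q)))\<^sup>2 \<le> (sqrt (k * l) * norm x)\<^sup>2" .
    qed (simp add: kl)
    then show ?thesis unfolding good_def by blast
  qed
  have good_zero: "good 0 z" "good y 0" for y z
    unfolding good_def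
    by (auto intro!: exI[of _ 0] simp: clinear_zero[OF linear] \<sigma>.zero_left clinear_zero[OF \<sigma>.clinear])
  have good_vec: "good (\<tau> u v) z" if "z \<in> H" for u v z
    using that unfolding H_def
  proof (induction rule: complex_vector.span_induct_alt)
    case (step k w z)
    obtain p q where w: "w = \<theta>' p q" using step(1) by auto
    have "scaleC k w = \<theta>' (scaleC k p) q"
      using \<theta> by (simp add: w hilbert_tensor_def cbilinear_add)
    then show ?case using step good_elementary good_add' by simp
  qed (rule good_zero)
  have good: "good y z" if "z \<in> H" for z
  proof -
    obtain N :: nat and a c where y: "y = (\<Sum>i<N. \<tau> (a i) (c i))" using y by (rule dom.algebraic_cases)
    have "good (\<Sum>i<n. \<tau> (a i) (c i)) z" for n :: nat
      by (induction n) (simp_all add: good_zero good_add good_vec that)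
    then show ?thesis by (simp add: y)
  qed
  \<comment> \<open>Replacing \<open>x\<close> by \<open>star x * x\<close> repeatedly keeps the
    norms exact powers of \<open>norm x\<close>, while \<open>y\<close> and \<open>z\<close> stay
    fixed; hence \<open>K\<close> is the same at each stage.\<close>
  have step: "norm (\<sigma> (L (x * y)) z) \<le> norm (\<sigma> (L y) z) * norm x" if z: "z \<in> H" for z
  proof -
    obtain K where K: "\<And>x. x \<in> dom.algebraic \<Longrightarrow> norm (\<sigma> (L (x * y)) z) \<le> K * norm x"
      using good[OF z] unfolding good_def by blast
    define X where "X n = ((\<lambda>x. star x * x) ^^ n) x" for n
    have X: "X n \<in> dom.algebraic" "norm (X n) = norm x ^ (2 ^ n)" for n
      by (induction n) (simp_all add: X_def x dom.algebraic_mult dom.algebraic_star cstar_identity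
          power_mult[symmetric] mult.commute)
    have "norm (\<sigma> (L (X 0 * y)) z) \<le> norm (\<sigma> (L y) z) * norm x"
    proof (rule iterate_bound[where C = K])
      fix n
      show "norm (\<sigma> (L (X n * y)) z) \<le> K * norm x ^ 2 ^ n" using K[OF X(1)] X(2) by simp
      have mem: "X n * y \<in> dom.algebraic" "star (X n) \<in> dom.algebraic" "star y \<in> dom.algebraic"
        by (simp_all add: dom.algebraic_mult dom.algebraic_star X y)
      have "star (L (X n * y)) * L (X n * y) = L (star y * star (X n)) * L (X n * y)"
        by (simp only: L_star[OF mem(1), symmetric] star_mult)
      also have "\<dots> = L (star y) * L (star (X n) * (X n * y))" by (rule L_balanced) (simp_all add: mem)
      also have "\<dots> = star (L y) * L (X (Suc n) * y)" by (simp add: L_star y X_def mult.assoc)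
      finally have "(norm (\<sigma> (L (X n * y)) z))\<^sup>2 = Re (cinner (\<sigma> (L y) z) (\<sigma> (L (X (Suc n) * y)) z))"
        by (simp add: \<sigma>.norm_square \<sigma>.mult \<sigma>.adjoint')
      then show "(norm (\<sigma> (L (X n * y)) z))\<^sup>2 \<le> norm (\<sigma> (L y) z) * norm (\<sigma> (L (X (Suc n) * y)) z)"
        using complex_Re_le_cmod cinner_Cauchy_Schwarz order.trans by metis
    qed simp_all
    then show ?thesis by (simp add: X_def)
  qed
  have "norm (\<sigma> (L (x * y)) z) \<le> (norm x * norm (L y)) * norm z" for z
  proof -
    have "H \<subseteq> {z. norm (\<sigma> (L (x * y)) z) \<le> norm (\<sigma> (L y) z) * norm x}" using step by blast
    moreover have "closed {z. norm (\<sigma> (L (x * y)) z) \<le> norm (\<sigma> (L y) z) * norm x}"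
      by (intro closed_Collect_le continuous_intros linear_continuous_on \<sigma>.bounded)
    ultimately have "norm (\<sigma> (L (x * y)) z) \<le> norm (\<sigma> (L y) z) * norm x"
      using closure_minimal[of H] H_dense by blast
    also have "\<dots> \<le> (norm (L y) * norm z) * norm x" by (intro mult_right_mono \<sigma>.norm_le) simp
    finally show ?thesis by (simp add: mult_ac)
  qed
  then show ?thesis unfolding norm_\<sigma>[of "L (x * y)"] by (intro onorm_bound) simp_all
qed

end

section \<open>Extension to the completed tensor product\<close>

lemma (in tensor_map) tensor_map_extension:
  assumes contractive: "\<And>x. x \<in> dom.algebraic \<Longrightarrow> norm (L x) \<le> norm x"
  obtains \<Phi> where "is_tensor_map \<tau> \<tau>' \<phi> \<psi> \<Phi>"
proof -
  have dist: "dist (L x) (L y) \<le> dist x y" if "x \<in> dom.algebraic" "y \<in> dom.algebraic" for x y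
  proof -
    have "x - y \<in> dom.algebraic"
      using that unfolding dom.algebraic_def by (rule complex_vector.span_diff)
    from contractive[OF this] show ?thesis by (simp add: dist_norm clinear_diff[OF linear])
  qed
  have "uniformly_continuous_on dom.algebraic L"
    unfolding uniformly_continuous_on_def using dist by (meson order_le_less_trans)
  then obtain \<Phi> where \<Phi>: "uniformly_continuous_on (closure dom.algebraic) \<Phi>" "\<And>x. x \<in> dom.algebraic \<Longrightarrow> L x = \<Phi> x"
    by (rule uniformly_continuous_on_extension_on_closure) blast
  have cont: "continuous_on UNIV \<Phi>"
    using uniformly_continuous_imp_continuous[OF \<Phi>(1)] by (simp add: dom.dense)
  have lim: "\<exists>s. (\<forall>n. s n \<in> dom.algebraic) \<and> s \<longlonglongrightarrow> x" for x
    using dom.dense closure_sequential[of x dom.algebraic] by simp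
  have tend: "(\<lambda>n. \<Phi> (s n)) \<longlonglongrightarrow> \<Phi> x" if "s \<longlonglongrightarrow> x" for s x
    using continuous_on_tendsto_compose[OF cont that] by simp
  have "clinear \<Phi>"
    unfolding clinear_iff
  proof (intro conjI allI)
    fix x y k
    obtain s t where s: "\<And>n. s n \<in> dom.algebraic" "s \<longlonglongrightarrow> x" and t: "\<And>n. t n \<in> dom.algebraic" "t \<longlonglongrightarrow> y"
      using lim[of x] lim[of y] by blast
    have "\<Phi> (s n + t n) = \<Phi> (s n) + \<Phi> (t n)" "\<Phi> (scaleC k (s n)) = scaleC k (\<Phi> (s n))" for n
      using s(1)[of n] t(1)[of n] clinear_add[OF linear] clinear_scaleC[OF linear]
      by (simp_all flip: \<Phi>(2) add: dom.algebraic_add dom.algebraic_scaleC)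
    then have "(\<lambda>n. \<Phi> (s n) + \<Phi> (t n)) \<longlonglongrightarrow> \<Phi> (x + y)" "(\<lambda>n. scaleC k (\<Phi> (s n))) \<longlonglongrightarrow> \<Phi> (scaleC k x)"
      using tend[OF tendsto_add[OF s(2) t(2)]] tend[OF tendsto_scaleC[OF s(2), of k]] by simp_all
    then show "\<Phi> (x + y) = \<Phi> x + \<Phi> y" "\<Phi> (scaleC k x) = scaleC k (\<Phi> x)"
      using LIMSEQ_unique tendsto_add[OF tend[OF s(2)] tend[OF t(2)]] tendsto_scaleC[OF tend[OF s(2)]]
      by blast+
  qed
  moreover have "\<Phi> (\<tau> a c) = \<tau>' (\<phi> a) (\<psi> c)" for a c
    using \<Phi>(2)[of "\<tau> a c"] by (simp add: L)
  ultimately show ?thesis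
    using cont by (intro that[of \<Phi>]) (simp add: is_tensor_map_def)
qed

context tensor_map
begin

lemma tensor_map_eq_algebraic:
  assumes \<Phi>: "is_tensor_map \<tau> \<tau>' \<phi> \<psi> \<Phi>" and x: "x \<in> dom.algebraic"
  shows "\<Phi> x = L x"
proof -
  have lin: "clinear \<Phi>" and elem: "\<Phi> (\<tau> a c) = L (\<tau> a c)" for a c
    using \<Phi> by (simp_all add: is_tensor_map_def L)
  show ?thesis
    using x by (elim dom.algebraic_cases) (simp add: clinear_sum[OF lin] elem L_sum)
qed

lemma dense_sequence:
  fixes x :: 's
  obtains s where "\<And>n. s n \<in> dom.algebraic" "s \<longlonglongrightarrow> x"
  using dom.dense closure_sequential[of x dom.algebraic] by auto

lemma tensor_map_unique:
  assumes \<Phi>: "is_tensor_map \<tau> \<tau>' \<phi> \<psi> \<Phi>" and \<Phi>': "is_tensor_map \<tau> \<tau>' \<phi> \<psi> \<Phi>'"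
  shows "\<Phi> = \<Phi>'"
proof
  fix x
  have cont: "continuous_on UNIV \<Phi>" "continuous_on UNIV \<Phi>'"
    using \<Phi> \<Phi>' by (simp_all add: is_tensor_map_def)
  obtain s where s: "\<And>n. s n \<in> dom.algebraic" "s \<longlonglongrightarrow> x"
      using dense_sequence[of x] by blast
  have "(\<lambda>n. \<Phi> (s n)) \<longlonglongrightarrow> \<Phi> x" "(\<lambda>n. \<Phi>' (s n)) \<longlonglongrightarrow> \<Phi>' x"
    using continuous_on_tendsto_compose[OF cont(1) s(2)] continuous_on_tendsto_compose[OF cont(2) s(2)]
    by simp_all
  then show "\<Phi> x = \<Phi>' x"
    using s(1) by (simp add: tensor_map_eq_algebraic[OF \<Phi>] tensor_map_eq_algebraic[OF \<Phi>'] LIMSEQ_unique)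
qed

text \<open>Gram vectors for \<open>\<phi>\<close> and for \<open>\<psi>\<close>, both indexed by
  the pairs (entry, summand) in \<open>J\<close>, are tensored to Gram vectors indexed by
  \<open>J \<times> J\<close>. Their number differs from \<open>n\<close>, so positivity is
  concluded from a sum of rank-one matrices.\<close>

lemma positive_matrix_algebraic:
  assumes z: "\<And>i. i < n \<Longrightarrow> z i \<in> dom.algebraic"
  shows "positive_matrix n (\<lambda>i j. L (star (z i) * z j))"
proof -
  have "\<exists>N a c. i < n \<longrightarrow> z i = (\<Sum>p<N::nat. \<tau> (a p) (c p))" for i
    using z[of i] dom.algebraic_cases[of "z i"] by metis
  then obtain N :: "nat \<Rightarrow> nat" and a c where z': "\<And>i. i < n \<Longrightarrow> z i = (\<Sum>p<N i. \<tau> (a i p) (c i p))"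
    by metis
  define J where "J = (SIGMA i:{..<n}. {..<N i})"
  have J: "finite J" by (simp add: J_def)
  obtain V where V: "\<And>\<alpha> \<beta>. \<alpha> \<in> J \<Longrightarrow> \<beta> \<in> J \<Longrightarrow>
      \<phi> (star (case_prod a \<alpha>) * case_prod a \<beta>) = (\<Sum>l\<in>J. star (V l \<alpha>) * V l \<beta>)"
    using completely_positive_rank_one[OF \<phi>.cp J, of "case_prod a"] by blast
  obtain W where W: "\<And>\<alpha> \<beta>. \<alpha> \<in> J \<Longrightarrow> \<beta> \<in> J \<Longrightarrow>
      \<psi> (star (case_prod c \<alpha>) * case_prod c \<beta>) = (\<Sum>l\<in>J. star (W l \<alpha>) * W l \<beta>)"
    using completely_positive_rank_one[OF \<psi>.cp J, of "case_prod c"] by blast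
  define Y where "Y = (\<lambda>(l, m) i. \<Sum>p<N i. \<tau>' (V l (i, p)) (W m (i, p)))"
  have eq: "L (star (z i) * z j) = (\<Sum>r\<in>J \<times> J. star (Y r i) * Y r j)" if ij: "i < n" "j < n" for i j
  proof -
    have "L (star (z i) * z j) = (\<Sum>p<N i. \<Sum>q<N j.
        \<tau>' (\<phi> (star (a i p) * a j q)) (\<psi> (star (c i p) * c j q)))"
      using ij by (simp add: z' star_sum dom.star sum_product dom.mult L_sum L)
    also have "\<dots> = (\<Sum>p<N i. \<Sum>q<N j. \<Sum>r\<in>J \<times> J.
        star (\<tau>' (V (fst r) (i, p)) (W (snd r) (i, p))) * \<tau>' (V (fst r) (j, q)) (W (snd r) (j, q)))"
    proof (intro sum.cong refl)
      fix p q assume "p \<in> {..<N i}" "q \<in> {..<N j}"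
      then have mem: "(i, p) \<in> J" "(j, q) \<in> J" using ij by (auto simp: J_def)
      have "\<tau>' (\<phi> (star (a i p) * a j q)) (\<psi> (star (c i p) * c j q)) = (\<Sum>l\<in>J. \<Sum>m\<in>J.
          \<tau>' (star (V l (i, p)) * V l (j, q)) (star (W m (i, p)) * W m (j, q)))"
        using V[OF mem] W[OF mem] by (simp add: cod.linear_simps) (rule sum.swap)
      also have "\<dots> = (\<Sum>r\<in>J \<times> J.
          star (\<tau>' (V (fst r) (i, p)) (W (snd r) (i, p))) * \<tau>' (V (fst r) (j, q)) (W (snd r) (j, q)))"
        by (simp add: sum.cartesian_product cod.star cod.mult case_prod_beta)
      finally show "\<tau>' (\<phi> (star (a i p) * a j q)) (\<psi> (star (c i p) * c j q)) = (\<Sum>r\<in>J \<times> J.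
          star (\<tau>' (V (fst r) (i, p)) (W (snd r) (i, p))) * \<tau>' (V (fst r) (j, q)) (W (snd r) (j, q)))" .
    qed
    also have "\<dots> = (\<Sum>p<N i. \<Sum>r\<in>J \<times> J. \<Sum>q<N j.
        star (\<tau>' (V (fst r) (i, p)) (W (snd r) (i, p))) * \<tau>' (V (fst r) (j, q)) (W (snd r) (j, q)))"
      by (intro sum.cong refl sum.swap)
    also have "\<dots> = (\<Sum>r\<in>J \<times> J. \<Sum>p<N i. \<Sum>q<N j.
        star (\<tau>' (V (fst r) (i, p)) (W (snd r) (i, p))) * \<tau>' (V (fst r) (j, q)) (W (snd r) (j, q)))"
      by (rule sum.swap)
    also have "\<dots> = (\<Sum>r\<in>J \<times> J. star (Y r i) * Y r j)"
      by (simp add: Y_def case_prod_beta star_sum sum_product)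
    finally show ?thesis .
  qed
  have "positive_matrix n (\<lambda>i j. \<Sum>r\<in>J \<times> J. star (Y r i) * Y r j)"
    by (intro positive_matrix_sum positive_matrix_rank_one) (simp add: J)
  then show ?thesis
    unfolding positive_matrix_def using eq by auto
qed

lemma
  assumes \<Phi>: "is_tensor_map \<tau> \<tau>' \<phi> \<psi> \<Phi>"
    and contractive: "\<And>x. x \<in> dom.algebraic \<Longrightarrow> norm (L x) \<le> norm x"
  shows cpc_tensor_map: "cpc \<Phi>" and order_zero_tensor_map: "order_zero \<Phi>"
proof -
  have lin: "clinear \<Phi>" and cont: "continuous_on UNIV \<Phi>"
    using \<Phi> by (simp_all add: is_tensor_map_def)
  have tend: "(\<lambda>n. \<Phi> (s n)) \<longlonglongrightarrow> \<Phi> x" if "s \<longlonglongrightarrow> x" for s x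
    using continuous_on_tendsto_compose[OF cont that] by simp
  note eq = tensor_map_eq_algebraic[OF \<Phi>]
  have cp: "completely_positive \<Phi>"
    unfolding completely_positive_def
  proof (intro conjI allI impI lin)
    fix n and X :: "nat \<Rightarrow> nat \<Rightarrow> 's" assume "positive_matrix n X"
    then obtain Z where Z: "\<And>i j. i < n \<Longrightarrow> j < n \<Longrightarrow> X i j = (\<Sum>l<n. star (Z l i) * Z l j)"
      unfolding positive_matrix_def by blast
    \<comment> \<open>Approximating the entries of a positive matrix may destroy positivity;
      approximating the vector \<open>z\<close> keeps the rank-one form, and \<open>X\<close> is a
      sum of \<open>n\<close> matrices of this form.\<close>
    have rank_one: "positive_matrix n (\<lambda>i j. \<Phi> (star (z i) * z j))" for z
    proof -
      have "\<exists>s. (\<forall>n. s n \<in> dom.algebraic) \<and> s \<longlonglongrightarrow> z i" for i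
        using dense_sequence[of "z i"] by metis
      then obtain s where s: "\<And>i n. s i n \<in> dom.algebraic" "\<And>i. s i \<longlonglongrightarrow> z i"
        by metis
      show ?thesis
      proof (rule positive_matrix_lim)
        show "(\<lambda>m. \<Phi> (star (s i m) * s j m)) \<longlonglongrightarrow> \<Phi> (star (z i) * z j)" for i j
          by (intro tend tendsto_mult tendsto_star s)
        show "positive_matrix n (\<lambda>i j. \<Phi> (star (s i m) * s j m))" for m
          using positive_matrix_algebraic[of n "\<lambda>i. s i m"] s(1)
          by (simp add: eq dom.algebraic_mult dom.algebraic_star)
      qed
    qed
    have "positive_matrix n (\<lambda>i j. \<Sum>l<n. \<Phi> (star (Z l i) * Z l j))"
      by (intro positive_matrix_sum rank_one) simp
    then show "positive_matrix n (\<lambda>i j. \<Phi> (X i j))"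
      unfolding positive_matrix_def by (simp add: Z clinear_sum[OF lin])
  qed
  have "norm (\<Phi> x) \<le> norm x" for x
  proof -
    obtain s where s: "\<And>n. s n \<in> dom.algebraic" "s \<longlonglongrightarrow> x"
      using dense_sequence[of x] by blast
    show ?thesis
      using s(1) contractive
      by (intro LIMSEQ_le[OF tendsto_norm[OF tend[OF s(2)]] tendsto_norm[OF s(2)]]) (simp add: eq)
  qed
  with cp show "cpc \<Phi>" by (simp add: cpc_def)
  show "order_zero \<Phi>"
  proof (rule order_zero_if_balanced[OF cp])
    fix x y z
    obtain s where s: "\<And>n. s n \<in> dom.algebraic" "s \<longlonglongrightarrow> x"
      using dense_sequence[of x] by blast
    obtain t where t: "\<And>n. t n \<in> dom.algebraic" "t \<longlonglongrightarrow> y"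
      using dense_sequence[of y] by blast
    obtain u where u: "\<And>n. u n \<in> dom.algebraic" "u \<longlonglongrightarrow> z"
      using dense_sequence[of z] by blast
    have "(\<lambda>n. \<Phi> (star (s n))) \<longlonglongrightarrow> \<Phi> (star x)" "(\<lambda>n. star (\<Phi> (s n))) \<longlonglongrightarrow> star (\<Phi> x)"
      by (intro tend tendsto_star s)+
    then show "\<Phi> (star x) = star (\<Phi> x)"
      using s(1) by (simp add: eq dom.algebraic_star L_star LIMSEQ_unique)
    have "(\<lambda>n. \<Phi> (s n * t n) * \<Phi> (u n)) \<longlonglongrightarrow> \<Phi> (x * y) * \<Phi> z"
      "(\<lambda>n. \<Phi> (s n) * \<Phi> (t n * u n)) \<longlonglongrightarrow> \<Phi> x * \<Phi> (y * z)"
      by (intro tendsto_mult tend s t u)+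
    then show "\<Phi> (x * y) * \<Phi> z = \<Phi> x * \<Phi> (y * z)"
      using s(1) t(1) u(1) by (simp add: eq dom.algebraic_mult L_balanced LIMSEQ_unique)
    assume "star x * x = 0"
    then show "x = 0" using cstar_identity[of x] by simp
  qed
qed

end

theorem corollary3p3:
  fixes \<phi> :: "'a::cstar_algebra \<Rightarrow> 'b::cstar_algebra"
    and \<psi> :: "'c::cstar_algebra \<Rightarrow> 'd::cstar_algebra"
    and \<tau> :: "'a \<Rightarrow> 'c \<Rightarrow> 'ac::cstar_algebra"
    and \<tau>' :: "'b \<Rightarrow> 'd \<Rightarrow> 'bd::cstar_algebra"
    and \<pi>A :: "'a \<Rightarrow> 'ha::complex_hilbert_space \<Rightarrow> 'ha"
    and \<pi>B :: "'b \<Rightarrow> 'hb::complex_hilbert_space \<Rightarrow> 'hb"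
    and \<pi>C :: "'c \<Rightarrow> 'hc::complex_hilbert_space \<Rightarrow> 'hc"
    and \<pi>D :: "'d \<Rightarrow> 'hd::complex_hilbert_space \<Rightarrow> 'hd"
    and \<theta> :: "'ha \<Rightarrow> 'hc \<Rightarrow> 'hac::complex_hilbert_space"
    and \<theta>' :: "'hb \<Rightarrow> 'hd \<Rightarrow> 'hbd::complex_hilbert_space"
  assumes "cpc \<phi>" and "order_zero \<phi>" and "cpc \<psi>" and "order_zero \<psi>"
  shows "((minimal_tensor \<pi>A \<pi>C \<theta> \<tau> \<and> minimal_tensor \<pi>B \<pi>D \<theta>' \<tau>' \<or>
           maximal_tensor \<tau> \<and> maximal_tensor \<tau>') \<longrightarrow>
          (\<exists>!\<Phi>. is_tensor_map \<tau> \<tau>' \<phi> \<psi> \<Phi>) \<and>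
          (\<forall>\<Phi>. is_tensor_map \<tau> \<tau>' \<phi> \<psi> \<Phi> \<longrightarrow> cpc \<Phi> \<and> order_zero \<Phi>)) \<and>
         order_zero (amplification \<phi> :: ('a, 'k::finite) cmat \<Rightarrow> ('b, 'k) cmat)"
proof (intro conjI[of "_ \<longrightarrow> _"] impI)
  interpret \<phi>: cpc_order_zero \<phi> by standard (rule assms)+
  interpret \<psi>: cpc_order_zero \<psi> by standard (rule assms)+
  show "order_zero (amplification \<phi> :: ('a, 'k) cmat \<Rightarrow> ('b, 'k) cmat)"
    by (rule \<phi>.order_zero_amplification)
  assume *: "minimal_tensor \<pi>A \<pi>C \<theta> \<tau> \<and> minimal_tensor \<pi>B \<pi>D \<theta>' \<tau>' \<or> maximal_tensor \<tau> \<and> maximal_tensor \<tau>'"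
  then have \<tau>: "cstar_tensor \<tau>" "cstar_tensor \<tau>'"
    by (auto simp: minimal_tensor_def maximal_tensor_def)
  interpret cod: tensor_product \<tau>' by standard (rule \<tau>)
  have "cbilinear (\<lambda>a c. \<tau>' (\<phi> a) (\<psi> c))"
    by (simp add: cbilinear_def clinear_iff cod.linear_simps \<phi>.add \<psi>.add \<phi>.scaleC \<psi>.scaleC)
  then obtain L where L: "clinear L" "\<And>a c. L (\<tau> a c) = \<tau>' (\<phi> a) (\<psi> c)"
    using cstar_tensor_lift[OF \<tau>(1)] by blast
  interpret tensor_map \<phi> \<psi> \<tau> \<tau>' L 
    by standard (simp_all add: \<tau> L clinear_add[OF L(1)] clinear_scaleC[OF L(1)])
  \<comment> \<open>The only estimate for which the minimal and the maximal norm require different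
    arguments.\<close>
  have "norm (L (x * y)) \<le> norm x * norm (L y)" if "x \<in> dom.algebraic" "y \<in> dom.algebraic" for x y
    using * norm_L_mult_le_minimal norm_L_mult_le_maximal that by blast
  then have contractive: "norm (L x) \<le> norm x" if "x \<in> dom.algebraic" for x
    using norm_L_le that by blast
  obtain \<Phi> where "is_tensor_map \<tau> \<tau>' \<phi> \<psi> \<Phi>"
    using tensor_map_extension contractive by blast
  then show "(\<exists>!\<Phi>. is_tensor_map \<tau> \<tau>' \<phi> \<psi> \<Phi>) \<and>
      (\<forall>\<Phi>. is_tensor_map \<tau> \<tau>' \<phi> \<psi> \<Phi> \<longrightarrow> cpc \<Phi> \<and> order_zero \<Phi>)"
    using tensor_map_unique cpc_tensor_map order_zero_tensor_map contractive by blast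
qed

end
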